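(* Let the response process and the adaptive $p$-step-ahead algorithm be as described in the context, with true parameter point $\overline\theta\in\Theta$, adaptive estimators $\widehat\theta_k$ employed by the algorithm, and adaptive least squares estimators $\widehat\theta_k^{(\mathrm{LS})}$. Assume the following. (a1) There is a nondecreasing sequence $\mathcal F_0\subseteq\mathcal F_1\subseteq\cdots$ of sub-sigma-fields of $\mathcal F$ such that for each $k\in\mathbb N$ the random vector $\boldsymbol X_k=(X_{n_{k-1}+1},\ldots,X_{n_k})$ is $\mathcal F_{k-1}$-measurable and $\boldsymbol Y_k=(Y_{n_{k-1}+1},\ldots,Y_{n_k})^{T}$ is $\mathcal F_k$-measurable. (a2) $Y_i=\mu(X_i,\overline\theta)+e_i$ for all $i\in\mathbb N$, with real-valued square integrable random errors $e_i$ such that, with $\boldsymbol e_k=(e_{n_{k-1}+1},\ldots,e_{n_k})^{T}$, one has $\mathrm E(\boldsymbol e_k\mid\mathcal F_{k-1})=0$ a.s. for all $k\in\mathbb N$ and $\sup_{k\in\mathbb N}\mathrm E(\|\boldsymbol e_k\|^2\mid\mathcal F_{k-1})<\infty$ a.s. (b5) $\Theta\subseteq\mathbb R^p$ with the Euclidean metric, its interior $\mathrm{int}(\Theta)$ in $\mathbb R^p$ is nonempty, for each fixed $x\in\mathcal X$ the function $\theta\mapsto\mu(x,\theta)$ is twice differentiable on $\mathrm{int}(\Theta)$, with gradient $\nabla\mu(x,\theta)$ and Hessian matrix $\nabla^2\mu(x,\theta)$ (with respect to $\theta$), the functions $(x,\theta)\mapsto\nabla\mu(x,\theta)$ and $(x,\theta)\mapsto\nabla^2\mu(x,\theta)$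 are continuous on $\mathcal X\times\mathrm{int}(\Theta)$, and $f_\theta(x)=\nabla\mu(x,\theta)$ for all $x\in\mathcal X$ and $\theta\in\mathrm{int}(\Theta)$. (L) For all $\varepsilon>0$, $\ \frac1k\sum_{j=1}^k\mathrm E\bigl(\|\boldsymbol e_j\|^2\,\mathbf 1(\|\boldsymbol e_j\|>\varepsilon\sqrt k)\,\big|\,\mathcal F_{j-1}\bigr)\to0$ almost surely as $k\to\infty$. (AH) $\mathrm E(\boldsymbol e_k\boldsymbol e_k^{T}\mid\mathcal F_{k-1})\to\sigma^2(\overline\theta)\,I_p$ almost surely as $k\to\infty$, for some positive real constant $\sigma^2(\overline\theta)$, where $I_p$ is the $p\times p$ identity matrix. (SD)$(\overline\theta)$ The information matrices $M(\eta^*,\overline\theta)$ of all locally D-optimal saturated designs $\eta^*$ at $\overline\theta$ coincide; denote their common value by $M_{\mathrm s*}(\overline\theta)$. Assume moreover that $\widehat\theta_k\to\overline\theta$ a.s. and $\widehat\theta_k^{(\mathrm{LS})}\to\overline\theta$ a.s. as $k\to\infty$, and that $\overline\theta\in\mathrm{int}(\Theta)$. Then $$\sqrt{n_k}\,\bigl(\widehat\theta_k^{(\mathrm{LS})}-\overline\theta\bigr)\ \longrightarrow\ \mathrm N\bigl(0,\ \sigma^2(\overline\theta)\,M_{\mathrm s*}^{-1}(\overline\theta)\bigr)\quad\text{in distribution as }k\to\infty .$$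
   Context: Setting: $p\in\mathbb N$; $\mathcal X$ (experimental region) and $\Theta$ (parameter space) are compact metric spaces; $\mu:\mathcal X\times\Theta\to\mathbb R$ is continuous; $f_\theta:\mathcal X\to\mathbb R^p$, $\theta\in\Theta$, is a family of functions such that $(x,\theta)\mapsto f_\theta(x)$ is continuous on $\mathcal X\times\Theta$ and, for each $\theta\in\Theta$, the image $f_\theta(\mathcal X)$ spans $\mathbb R^p$. Vectors are column vectors, $\|\cdot\|$ is the Euclidean norm, $\mathbf 1(A)$ is the indicator of the event $A$, and $\mathrm N(0,C)$ is the $p$-dimensional normal distribution with mean $0$ and positive definite covariance matrix $C$. Designs: A design is a probability measure $\xi$ on $\mathcal X$ with finite support. Its information matrix at $\theta$ is $M(\xi,\theta)=\sum_{x\in\mathrm{supp}(\xi)}\xi(x)f_\theta(x)f_\theta^{T}(x)$. A design is saturated if its support has exactly $p$ points. A locally D-optimal saturated design at $\overline\theta$ is a saturated design maximizing $\det M(\eta,\overline\theta)$ over all saturated designs $\eta$. Process and algorithm: $X_i$ and $Y_i$, $i\in\mathbb N$, are random variables on a probability space $(\Omega,\mathcal F,\mathbb P_{\overline\theta})$ with values in $\mathcal X$ and $\mathbb R$, respectively, where $\overline\theta\in\Theta$ is the true parameter point. Let $n_1\in\mathbb N$, $n_0:=0$, and $n_k:=n_1+(k-1)p$ for $k\ge1$. The adaptive estimators employed by the algorithm are $\Theta$-valued estimators $\widehat\theta_k=\widehat\theta_k(X_1,Y_1,\ldots,X_{n_k},Y_{n_k})$, $k\ge1$. The points $X_1,\ldots,X_{n_1}$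 are arbitrary initial design points, and the $p$-step-ahead algorithm chooses the subsequent points so that for every $k\ge1$ (pathwise) $$\bigl(\det[f_{\widehat\theta_k}(X_{n_k+1}),\ldots,f_{\widehat\theta_k}(X_{n_k+p})]\bigr)^2=\max_{z_1,\ldots,z_p\in\mathcal X}\bigl(\det[f_{\widehat\theta_k}(z_1),\ldots,f_{\widehat\theta_k}(z_p)]\bigr)^2 .$$ The adaptive least squares estimator $\widehat\theta_k^{(\mathrm{LS})}=\widehat\theta_k^{(\mathrm{LS})}(X_1,Y_1,\ldots,X_{n_k},Y_{n_k})$, $k\ge1$, is a $\Theta$-valued random variable that (pathwise) minimizes $\sum_{i=1}^{n_k}(Y_i-\mu(X_i,\theta))^2$ over $\theta\in\Theta$. It need not coincide with $\widehat\theta_k$. *)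

theory Defs
  imports "HOL-Probability.Probability"
begin

text \<open>
  The dimension \<open>p\<close> is \<open>CARD('p)\<close>, and \<open>\<real>\<^sup>p\<close> is \<open>real ^ 'p\<close>. Observations are indexed by
  \<open>i \<ge> 1\<close>; the values at index \<open>0\<close> of the processes are never used.
\<close>

text \<open>
  The positions \<open>1, \<dots>, p\<close> inside a block of \<open>p\<close> observations, matched with the index type by a
  fixed enumeration. A different enumeration would only permute the columns of a determinant that
  occurs squared, and simultaneously permute the rows and columns of a matrix that is compared
  with a multiple of the identity.
\<close>
definition pos :: "'p::finite \<Rightarrow> nat" where
  "pos j = Suc (to_nat_on UNIV j)"

lemma bij_betw_pos: "bij_betw pos (UNIV :: 'p::finite set) {1..CARD('p)}"
proof -
  have "bij_betw (to_nat_on UNIV) (UNIV :: 'p set) {..<CARD('p)}"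
    by (rule to_nat_on_finite) simp
  moreover have "bij_betw Suc {..<CARD('p)} {1..CARD('p)}"
    by (simp add: bij_betw_def lessThan_atLeast0 image_Suc_atLeastLessThan atLeastLessThanSuc_atLeastAtMost)
  ultimately have "bij_betw (Suc \<circ> to_nat_on UNIV) (UNIV :: 'p set) {1..CARD('p)}"
    by (rule bij_betw_trans)
  then show ?thesis
    by (simp add: pos_def[abs_def] comp_def)
qed


definition sample_size :: "nat \<Rightarrow> nat \<Rightarrow> nat \<Rightarrow> nat" where
  "sample_size p n1 k = (if k = 0 then 0 else n1 + (k - 1) * p)"

text \<open>
  The index set of the \<open>k\<close>-th block, \<open>k \<ge> 1\<close>. The first block has length \<open>n1\<close>, all others have
  length \<open>p\<close>.
\<close>
definition block :: "nat \<Rightarrow> nat \<Rightarrow> nat \<Rightarrow> nat set" where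
  "block p n1 k = {sample_size p n1 (k - 1) + 1 .. sample_size p n1 k}"

definition observations ::
  "(nat \<Rightarrow> 'w \<Rightarrow> 'x) \<Rightarrow> (nat \<Rightarrow> 'w \<Rightarrow> real) \<Rightarrow> nat \<Rightarrow> 'w \<Rightarrow> nat \<Rightarrow> 'x \<times> real" where
  "observations X Y n \<omega> = (\<lambda>i\<in>{1..n}. (X i \<omega>, Y i \<omega>))"

text \<open>
  \<open>est k\<close> is a measurable \<open>\<Theta>\<close>-valued function of the first \<open>N k\<close> observations, for all \<open>k \<ge> 1\<close>.
\<close>
definition adaptive_estimators ::
  "'w measure \<Rightarrow> 'x::metric_space set \<Rightarrow> (real ^ 'p) set \<Rightarrow> (nat \<Rightarrow> 'w \<Rightarrow> 'x) \<Rightarrow>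
    (nat \<Rightarrow> 'w \<Rightarrow> real) \<Rightarrow> (nat \<Rightarrow> nat) \<Rightarrow> (nat \<Rightarrow> 'w \<Rightarrow> real ^ 'p) \<Rightarrow> bool" where
  "adaptive_estimators P \<X> \<Theta> X Y N est \<longleftrightarrow>
    (\<forall>k\<ge>1. \<exists>T \<in> PiM {1..N k} (\<lambda>_. restrict_space borel \<X> \<Otimes>\<^sub>M borel) \<rightarrow>\<^sub>M restrict_space borel \<Theta>.
       \<forall>\<omega>\<in>space P. est k \<omega> = T (observations X Y (N k) \<omega>))"


text \<open>\<open>(det [f\<^sub>\<theta>(z\<^sub>1), \<dots>, f\<^sub>\<theta>(z\<^sub>p)])\<^sup>2\<close>\<close>
definition sq_det ::
  "(real ^ 'p \<Rightarrow> 'x \<Rightarrow> real ^ 'p) \<Rightarrow> real ^ 'p \<Rightarrow> ('p::finite \<Rightarrow> 'x) \<Rightarrow> real" where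
  "sq_det f \<theta> z = (det (\<chi> i j. f \<theta> (z j) $ i))\<^sup>2"


definition is_design :: "'x set \<Rightarrow> 'x pmf \<Rightarrow> bool" where
  "is_design \<X> \<xi> \<longleftrightarrow> finite (set_pmf \<xi>) \<and> set_pmf \<xi> \<subseteq> \<X>"

definition info_matrix ::
  "(real ^ 'p \<Rightarrow> 'x \<Rightarrow> real ^ 'p) \<Rightarrow> 'x pmf \<Rightarrow> real ^ 'p \<Rightarrow> real ^ 'p ^ 'p" where
  "info_matrix f \<xi> \<theta> =
    (\<Sum>x\<in>set_pmf \<xi>. pmf \<xi> x *\<^sub>R (\<chi> i j. f \<theta> x $ i * f \<theta> x $ j))"

definition saturated_design :: "'p::finite itself \<Rightarrow> 'x set \<Rightarrow> 'x pmf \<Rightarrow> bool" where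
  "saturated_design _ \<X> \<xi> \<longleftrightarrow> is_design \<X> \<xi> \<and> card (set_pmf \<xi>) = CARD('p)"

definition D_optimal_saturated ::
  "'x set \<Rightarrow> (real ^ 'p \<Rightarrow> 'x \<Rightarrow> real ^ 'p) \<Rightarrow> real ^ 'p \<Rightarrow> 'x pmf \<Rightarrow> bool" where
  "D_optimal_saturated \<X> f \<theta> \<xi> \<longleftrightarrow>
    is_arg_max (\<lambda>\<eta>. det (info_matrix f \<eta> \<theta>)) (saturated_design TYPE('p) \<X>) \<xi>"

text \<open>
  The common information matrix of all locally D-optimal saturated designs at \<open>\<theta>\<close>; only
  meaningful if these information matrices do coincide.
\<close>
definition D_optimal_saturated_info ::
  "'x set \<Rightarrow> (real ^ 'p \<Rightarrow> 'x \<Rightarrow> real ^ 'p) \<Rightarrow> real ^ 'p \<Rightarrow> real ^ 'p ^ 'p" where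
  "D_optimal_saturated_info \<X> f \<theta> =
    (THE M. \<exists>\<eta>. D_optimal_saturated \<X> f \<theta> \<eta> \<and> M = info_matrix f \<eta> \<theta>)"


text \<open>
  The centred normal distribution with covariance matrix \<open>C\<close>, for positive definite \<open>C\<close>.
\<close>
definition centred_normal :: "real ^ 'p ^ 'p \<Rightarrow> (real ^ 'p) measure" where
  "centred_normal C = density lborel
    (\<lambda>x. ennreal (exp (- (x \<bullet> (matrix_inv C *v x)) / 2) / sqrt ((2 * pi) ^ CARD('p) * det C)))"

text \<open>
  Weak convergence against bounded continuous functions. The library's \<open>weak_conv_m\<close> is restricted
  to measures on the real line.
\<close>
definition converges_in_distribution ::
  "'w measure \<Rightarrow> (nat \<Rightarrow> 'w \<Rightarrow> 'a::metric_space) \<Rightarrow> 'a measure \<Rightarrow> bool" where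
  "converges_in_distribution P Z \<nu> \<longleftrightarrow>
    (\<forall>g :: 'a \<Rightarrow> real. continuous_on UNIV g \<and> bounded (range g) \<longrightarrow>
      (\<lambda>k. \<integral>z. g z \<partial>distr P borel (Z k)) \<longlonglongrightarrow> (\<integral>z. g z \<partial>\<nu>))"

end

theory Submission
  imports Defs "HOL-Real_Asymp.Real_Asymp"
begin

text \<open>The normal equation of the least squares problem, linearized at the true parameter \<open>\<theta>\<^sub>0\<close>, reads
  \<open>L\<^sub>n = J\<^sub>n (\<theta> - \<theta>\<^sub>0) + R\<^sub>n\<close> at the estimate \<open>\<theta>\<close>, where \<open>L\<^sub>n = \<Sum>\<^sub>i e\<^sub>i f\<^sub>i\<close> is the score, \<open>J\<^sub>n = \<Sum>\<^sub>i f\<^sub>i f\<^sub>i\<^sup>T\<close>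
  is the accumulated information and \<open>f\<^sub>i\<close> is the gradient of the mean response at \<open>\<theta>\<^sub>0\<close> and the \<open>i\<close>-th
  design point. Consistency of the estimator, uniform Taylor expansions over the compact design space
  and a weak law of large numbers for the errors bound the remainder by \<open>o(n) \<bar>\<theta> - \<theta>\<^sub>0\<bar>\<close> in probability
  (\<open>score_linearization\<close>, \<open>hess_score_negligible\<close>, \<open>abs_errors_bounded\<close>).

  Since the adaptive estimators converge to \<open>\<theta>\<^sub>0\<close>, the points of a late block nearly maximize the
  determinant criterion at \<open>\<theta>\<^sub>0\<close>. By compactness and the uniqueness assumption on the optimal information
  matrix, the information of the \<open>k\<close>-th block converges to \<open>p M\<close>, where \<open>M\<close> is the common information
  matrix of the D-optimal saturated designs (\<open>information_of_adaptive_blocks\<close>); hence \<open>J\<^sub>n / n\<close> converges to \<open>M\<close>.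

  The score is a martingale along the blocks. Its conditional covariances converge to \<open>\<sigma>\<^sup>2 p M\<close> because the
  error covariances become spherical while the block information converges. After a truncation that
  almost surely affects finitely many blocks only, the conditional variances are bounded, and a
  martingale central limit theorem (\<open>char_partial_sum_tendsto\<close>) yields the limits of the characteristic
  functions of \<open>L\<^sub>n / \<surd>n\<close> (\<open>char_T\<close>), namely those of the normal distribution with covariance \<open>\<sigma>\<^sup>2 M\<close>.
  Therefore \<open>\<surd>n (\<theta> - \<theta>\<^sub>0)\<close>, which is asymptotically \<open>M\<^sup>-\<^sup>1 L\<^sub>n / \<surd>n\<close> (\<open>linearized_estimator_close\<close>), has
  characteristic functions converging to those of the normal distribution with covariance
  \<open>\<sigma>\<^sup>2 M\<^sup>-\<^sup>1\<close> (\<open>char_centred_normal\<close>). As the sequence is tight, this implies convergence in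
  distribution (\<open>converges_in_distribution_char_tight\<close>).\<close>


section \<open>Linear images of Lebesgue measure and normal distributions\<close>

lemma borel_measurable_linear:
  fixes f :: "'a::euclidean_space \<Rightarrow> 'b::real_normed_vector"
  assumes "linear f"
  shows "f \<in> borel_measurable borel"
  using assms by (auto intro!: borel_measurable_continuous_onI linear_continuous_on simp: linear_conv_bounded_linear)

lemma det_matrix_stretch: "det (matrix (\<lambda>x::real^'n. \<chi> i. c i * x $ i)) = (\<Prod>i\<in>UNIV. c i)"
  by (simp add: axis_def matrix_def det_diagonal)

lemma det_matrix_transposition:
  fixes m n :: "'n::finite"
  shows "\<bar>det (matrix (\<lambda>x::real^'n. \<chi> i. x $ Transposition.transpose m n i))\<bar> = 1"
proof -
  let ?h = "\<lambda>x::real^'n. \<chi> i. x $ Transposition.transpose m n i"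
  have "matrix ?h = (\<chi> i. mat 1 $ Transposition.transpose m n i)"
    by (auto simp: vec_eq_iff matrix_def mat_def axis_def)
  then have "det (matrix ?h) = of_int (sign (Transposition.transpose m n)) * det (mat 1 :: real^'n^'n)"
    using det_permute_rows[OF permutes_swap_id[of m UNIV n], of "mat 1 :: real^'n^'n"] by simp
  then show ?thesis
    by (simp add: sign_swap_id abs_mult)
qed

lemma det_matrix_shear:
  fixes m n :: "'n::finite"
  assumes "m \<noteq> n"
  shows "det (matrix (\<lambda>x::real^'n. \<chi> i. if i = m then x $ m + x $ n else x $ i)) = 1"
proof -
  have "matrix (\<lambda>x::real^'n. \<chi> i. if i = m then x $ m + x $ n else x $ i)
      = (\<chi> k. if k = m then row m (mat 1) + 1 *s row n (mat 1) else row k (mat 1))"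
    by (auto simp: vec_eq_iff matrix_def mat_def axis_def row_def)
  then show ?thesis
    using det_row_operation[OF assms, of "mat 1 :: real^'n^'n" 1] by simp
qed

text \<open>A translation moves the box to one with nonnegative coordinates in direction \<open>n\<close>, where the shear is
  known to preserve the volume.\<close>
lemma measure_shear_cbox:
  fixes a b :: "real^'n"
  assumes "m \<noteq> n"
  defines "g \<equiv> \<lambda>x::real^'n. \<chi> i. if i = m then x $ m + x $ n else x $ i"
  shows "measure lebesgue (g ` cbox a b) = measure lebesgue (cbox a b)"
proof (cases "cbox a b = {}")
  case False
  have lin: "linear g"
    unfolding g_def by (rule linearI) (auto simp: algebra_simps plus_vec_def scaleR_vec_def vec_eq_iff)
  define v :: "real^'n" where "v = axis n (a $ n)"
  \<comment> \<open>after subtracting \<open>v\<close>, the lower bound of the coordinate \<open>n\<close> is zero\<close>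
  have "g ` cbox a b = (+) (g v) ` g ` cbox (a - v) (b - v)"
  proof -
    have "cbox a b = (+) v ` cbox (a - v) (b - v)"
      using cbox_translation[of v "a - v" "b - v"] by simp
    then show ?thesis
      by (simp add: image_image linear_add[OF lin])
  qed
  then have "measure lebesgue (g ` cbox a b) = measure lebesgue (g ` cbox (a - v) (b - v))"
    by (simp add: measure_translation)
  also have "\<dots> = measure lebesgue (cbox (a - v) (b - v))"
  proof -
    have "cbox (a - v) (b - v) \<noteq> {}"
      using False by (auto simp: interval_ne_empty_cart)
    then show ?thesis
      unfolding g_def by (rule measure_shear_interval[OF assms(1)]) (simp add: v_def)
  qed
  also have "\<dots> = measure lebesgue (cbox a b)"
    using measure_translation[of v "cbox (a - v) (b - v)"] cbox_translation[of v "a - v" "b - v"] by simp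
  finally show ?thesis .
qed simp

lemma distr_lborel_shear:
  fixes m n :: "'n::finite"
  assumes "m \<noteq> n"
  shows "distr lborel borel (\<lambda>x::real^'n. \<chi> i. if i = m then x $ m + x $ n else x $ i) = lborel"
proof -
  define g :: "real^'n \<Rightarrow> real^'n" where "g = (\<lambda>x. \<chi> i. if i = m then x $ m + x $ n else x $ i)"
  define h :: "real^'n \<Rightarrow> real^'n" where "h = (\<lambda>x. \<chi> i. if i = m then x $ m - x $ n else x $ i)"
  have gh: "g (h x) = x" and hg: "h (g x) = x" for x
    using assms by (auto simp: g_def h_def vec_eq_iff)
  have lin: "linear g"
    unfolding g_def by (rule linearI) (auto simp: algebra_simps plus_vec_def scaleR_vec_def vec_eq_iff)
  have linh: "linear h"
    unfolding h_def by (rule linearI) (auto simp: algebra_simps plus_vec_def scaleR_vec_def vec_eq_iff)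
  have [measurable]: "g \<in> borel_measurable borel" "h \<in> borel_measurable borel"
    by (rule borel_measurable_linear lin linh)+
  have suff: "g ` S \<in> lmeasurable \<and> 1 * measure lebesgue S = measure lebesgue (g ` S)" if "S \<in> lmeasurable" for S
    by (rule measure_linear_sufficient[OF lin that]) (use measure_shear_cbox[OF assms] in \<open>auto simp: g_def\<close>)
  have "lborel = distr lborel borel h"
  proof (rule lborel_eqI)
    fix l u :: "real^'n" assume le: "\<And>b. b \<in> Basis \<Longrightarrow> l \<bullet> b \<le> u \<bullet> b"
    have eq: "h -` box l u = g ` box l u"
    proof safe
      fix x assume "h x \<in> box l u"
      then show "x \<in> g ` box l u" using gh[of x] by (metis imageI)
    qed (simp add: hg)
    have meas: "g ` box l u \<in> sets borel"
      unfolding eq[symmetric] using measurable_sets[of h borel borel "box l u"] by simp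
    have "emeasure (distr lborel borel h) (box l u) = emeasure lebesgue (g ` box l u)"
      by (simp add: emeasure_distr eq meas)
    also have "\<dots> = ennreal (measure lebesgue (g ` box l u))"
      using suff[of "box l u"] by (intro emeasure_eq_measure2) auto
    also have "\<dots> = ennreal (measure lebesgue (box l u))"
      using suff[of "box l u"] by simp
    also have "\<dots> = ennreal (\<Prod>b\<in>Basis. (u - l) \<bullet> b)"
      using le by (simp add: measure_lborel_box_eq inner_diff_left)
    finally show "emeasure (distr lborel borel h) (box l u) = ennreal (\<Prod>b\<in>Basis. (u - l) \<bullet> b)" .
  qed simp
  then have "distr lborel borel g = distr (distr lborel borel h) borel g"
    by simp
  also have "\<dots> = distr lborel borel (\<lambda>x. x)"
    by (subst distr_distr) (auto simp: comp_def gh)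
  also have "\<dots> = lborel"
    by (rule distr_id2) simp
  finally show ?thesis
    by (simp add: g_def)
qed

lemma distr_lborel_transposition:
  fixes m n :: "'n::finite"
  shows "distr lborel borel (\<lambda>x::real^'n. \<chi> i. x $ Transposition.transpose m n i) = lborel"
proof (rule lborel_eqI[symmetric])
  let ?h = "\<lambda>x::real^'n. \<chi> i. x $ Transposition.transpose m n i"
  fix l u :: "real^'n" assume le: "\<And>b. b \<in> Basis \<Longrightarrow> l \<bullet> b \<le> u \<bullet> b"
  have le': "l $ i \<le> u $ i" for i
    using le[of "axis i 1"] by (simp add: axis_in_Basis_iff cart_eq_inner_axis)
  have lin: "linear ?h"
    by (rule linearI) (simp_all add: plus_vec_def scaleR_vec_def)
  have [measurable]: "?h \<in> borel_measurable borel"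
    by (rule borel_measurable_linear[OF lin])
  have eq: "?h -` box l u = box (?h l) (?h u)"
    by (auto simp: mem_box_cart) (metis transpose_involutory)+
  have P: "(\<Prod>b\<in>Basis. (u - l) \<bullet> b) = (\<Prod>i\<in>UNIV. (u - l) $ i)" for u l :: "real^'n"
    by (rule prod.reindex_bij_witness[of _ "\<lambda>i. axis i 1" "\<lambda>b. SOME i. b = axis i 1"])
       (auto simp: Basis_vec_def axis_eq_axis inner_axis)
  have "emeasure (distr lborel borel ?h) (box l u) = emeasure lborel (box (?h l) (?h u))"
    by (simp add: emeasure_distr eq)
  also have "\<dots> = ennreal (\<Prod>b\<in>Basis. (?h u - ?h l) \<bullet> b)"
    by (rule emeasure_lborel_box) (auto simp: Basis_vec_def inner_axis le')
  also have "(\<Prod>b\<in>Basis. (?h u - ?h l) \<bullet> b) = (\<Prod>i\<in>UNIV. (u - l) $ Transposition.transpose m n i)"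
    by (simp add: P)
  also have "\<dots> = (\<Prod>i\<in>UNIV. (u - l) $ i)"
    using prod.permute[OF permutes_swap_id[of m UNIV n], of "\<lambda>i. (u - l) $ i"] by (simp add: comp_def)
  finally show "emeasure (distr lborel borel ?h) (box l u) = ennreal (\<Prod>b\<in>Basis. (u - l) \<bullet> b)"
    by (simp add: P)
qed simp

lemma distr_lborel_stretch:
  fixes c :: "'n::finite \<Rightarrow> real"
  assumes c: "\<And>i. c i \<noteq> 0"
  shows "lborel = density (distr lborel borel (\<lambda>x::real^'n. \<chi> i. c i * x $ i)) (\<lambda>_. ennreal \<bar>\<Prod>i\<in>UNIV. c i\<bar>)"
proof -
  \<comment> \<open>\<open>SOME i. b = axis i 1\<close> inverts the bijection between coordinates and basis vectors\<close>
  let ?d = "\<lambda>b::real^'n. c (SOME i. b = axis i 1)"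
  have P: "(\<Prod>b\<in>Basis. \<bar>?d b\<bar>) = \<bar>\<Prod>i\<in>UNIV. c i\<bar>"
    unfolding abs_prod by (rule prod.reindex_bij_witness[of _ "\<lambda>i. axis i 1" "\<lambda>b. SOME i. b = axis i 1"])
       (auto simp: Basis_vec_def axis_eq_axis inner_axis)
  have T: "0 + (\<Sum>j\<in>Basis. (?d j * (x \<bullet> j)) *\<^sub>R j) = (\<chi> i. c i * x $ i)" for x :: "real^'n"
  proof -
    have "(\<Sum>j\<in>Basis. (?d j * (x \<bullet> j)) *\<^sub>R j) = (\<Sum>i\<in>UNIV. (c i * x $ i) *\<^sub>R axis i 1)"
      by (rule sum.reindex_bij_witness[of _ "\<lambda>i. axis i 1" "\<lambda>b. SOME i. b = axis i 1"])
         (auto simp: Basis_vec_def axis_eq_axis inner_axis)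
    also have "\<dots> = (\<chi> i. c i * x $ i)"
      by (simp add: vec_eq_iff axis_def if_distrib[of "(*) _"] cong: if_cong)
    finally show ?thesis by simp
  qed
  show ?thesis
    using lborel_affine_euclidean[of ?d "0 :: real^'n"] c unfolding T P by simp
qed

text \<open>Change of variables for linear maps. Every linear map is composed of stretches, transpositions of
  coordinates, shears and maps with a vanishing coordinate; the determinant of the latter is zero, and
  the claim is multiplicative along compositions.\<close>
theorem lborel_linear_image:
  fixes f :: "real^'n \<Rightarrow> real^'n"
  assumes "linear f" and "det (matrix f) \<noteq> 0"
  shows "lborel = density (distr lborel borel f) (\<lambda>_. ennreal \<bar>det (matrix f)\<bar>)"
proof -
  have "det (matrix f) \<noteq> 0 \<longrightarrow> lborel = density (distr lborel borel f) (\<lambda>_. ennreal \<bar>det (matrix f)\<bar>)"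
  proof (rule induct_linear_elementary[OF \<open>linear f\<close>])
    fix f g :: "real^'n \<Rightarrow> real^'n"
    assume lin: "linear f" "linear g"
      and f: "det (matrix f) \<noteq> 0 \<longrightarrow> lborel = density (distr lborel borel f) (\<lambda>_. ennreal \<bar>det (matrix f)\<bar>)"
      and g: "det (matrix g) \<noteq> 0 \<longrightarrow> lborel = density (distr lborel borel g) (\<lambda>_. ennreal \<bar>det (matrix g)\<bar>)"
    note [measurable] = borel_measurable_linear[OF lin(1)] borel_measurable_linear[OF lin(2)]
    show "det (matrix (f \<circ> g)) \<noteq> 0 \<longrightarrow>
      lborel = density (distr lborel borel (f \<circ> g)) (\<lambda>_. ennreal \<bar>det (matrix (f \<circ> g))\<bar>)"
    proof
      assume "det (matrix (f \<circ> g)) \<noteq> 0"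
      then have nz: "det (matrix f) \<noteq> 0" "det (matrix g) \<noteq> 0"
        by (auto simp: matrix_compose[OF lin(2,1)] det_mul)
      have "lborel = density (distr lborel borel f) (\<lambda>_. ennreal \<bar>det (matrix f)\<bar>)"
        using f nz by blast
      also have "distr lborel borel f = distr (density (distr lborel borel g) (\<lambda>_. ennreal \<bar>det (matrix g)\<bar>)) borel f"
        using g nz by simp
      also have "\<dots> = density (distr (distr lborel borel g) borel f) (\<lambda>_. ennreal \<bar>det (matrix g)\<bar>)"
        by (subst density_distr) auto
      also have "distr (distr lborel borel g) borel f = distr lborel borel (f \<circ> g)"
        by (subst distr_distr) auto
      also have "density (density (distr lborel borel (f \<circ> g)) (\<lambda>_. ennreal \<bar>det (matrix g)\<bar>)) (\<lambda>_. ennreal \<bar>det (matrix f)\<bar>)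
        = density (distr lborel borel (f \<circ> g)) (\<lambda>_. ennreal \<bar>det (matrix (f \<circ> g))\<bar>)"
        by (subst density_density_eq) (auto simp: matrix_compose[OF lin(2,1)] det_mul abs_mult ennreal_mult' mult.commute)
      finally show "lborel = density (distr lborel borel (f \<circ> g)) (\<lambda>_. ennreal \<bar>det (matrix (f \<circ> g))\<bar>)" .
    qed
  next
    fix f :: "real^'n \<Rightarrow> real^'n" and i
    assume "linear f" and 0: "\<And>x. f x $ i = 0"
    then have "\<not> inj f"
      by (metis (full_types) linear_injective_imp_surjective one_neq_zero surjE vec_component)
    then show "det (matrix f) \<noteq> 0 \<longrightarrow> lborel = density (distr lborel borel f) (\<lambda>_. ennreal \<bar>det (matrix f)\<bar>)"
      using det_nz_iff_inj[OF \<open>linear f\<close>] by blast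
  next
    fix c :: "'n \<Rightarrow> real"
    show "det (matrix (\<lambda>x::real^'n. \<chi> i. c i * x $ i)) \<noteq> 0 \<longrightarrow> lborel = density (distr lborel borel
      (\<lambda>x::real^'n. \<chi> i. c i * x $ i)) (\<lambda>_. ennreal \<bar>det (matrix (\<lambda>x::real^'n. \<chi> i. c i * x $ i))\<bar>)"
      using distr_lborel_stretch[of c] by (simp add: det_matrix_stretch)
  next
    fix m n :: 'n assume "m \<noteq> n"
    show "det (matrix (\<lambda>x::real^'n. \<chi> i. x $ Transposition.transpose m n i)) \<noteq> 0 \<longrightarrow>
      lborel = density (distr lborel borel (\<lambda>x::real^'n. \<chi> i. x $ Transposition.transpose m n i))
        (\<lambda>_. ennreal \<bar>det (matrix (\<lambda>x::real^'n. \<chi> i. x $ Transposition.transpose m n i))\<bar>)"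
      by (simp add: det_matrix_transposition distr_lborel_transposition density_1)
  next
    fix m n :: 'n assume "m \<noteq> n"
    then show "det (matrix (\<lambda>x::real^'n. \<chi> i. if i = m then x $ m + x $ n else x $ i)) \<noteq> 0 \<longrightarrow>
      lborel = density (distr lborel borel (\<lambda>x::real^'n. \<chi> i. if i = m then x $ m + x $ n else x $ i))
        (\<lambda>_. ennreal \<bar>det (matrix (\<lambda>x::real^'n. \<chi> i. if i = m then x $ m + x $ n else x $ i))\<bar>)"
      by (simp add: det_matrix_shear distr_lborel_shear density_1)
  qed
  with assms(2) show ?thesis by blast
qed

lemma
  fixes A :: "'a::semiring_1^'n^'n"
  assumes "invertible A"
  shows matrix_inv_left: "matrix_inv A ** A = mat 1"
    and matrix_inv_right: "A ** matrix_inv A = mat 1"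
  using someI_ex[OF assms[unfolded invertible_def]] by (simp_all add: matrix_inv_def)

lemma integral_lborel_vec_prod:
  fixes f :: "'n::finite \<Rightarrow> real \<Rightarrow> complex"
  assumes int: "\<And>i. integrable lborel (f i)"
  shows "(\<integral>x. (\<Prod>i\<in>UNIV. f i (x $ i)) \<partial>(lborel :: (real^'n) measure)) = (\<Prod>i\<in>UNIV. \<integral>t. f i t \<partial>lborel)"
proof -
  interpret product_sigma_finite "\<lambda>_::real^'n. lborel :: real measure" ..
  \<comment> \<open>\<open>?ix\<close> inverts the bijection between coordinates and basis vectors\<close>
  let ?ix = "\<lambda>b::real^'n. SOME i. b = axis i 1"
  have [measurable]: "f i \<in> borel_measurable borel" for i
    using borel_measurable_integrable[OF int[of i]] by simp
  have coord: "(\<Sum>b\<in>Basis. y b *\<^sub>R b) $ i = y (axis i 1)" for y :: "real^'n \<Rightarrow> real" and i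
  proof -
    have "(\<Sum>b\<in>Basis. y b *\<^sub>R b) $ i = (\<Sum>b\<in>Basis. y b *\<^sub>R b) \<bullet> axis i 1"
      by (simp add: inner_axis)
    also have "\<dots> = (\<Sum>b\<in>Basis. if b = axis i 1 then y b else 0)"
      by (subst inner_sum_left, rule sum.cong) (auto simp: inner_Basis axis_in_Basis_iff)
    also have "\<dots> = y (axis i 1)"
      by (simp add: axis_in_Basis_iff)
    finally show ?thesis .
  qed
  have reindex: "(\<Prod>i\<in>UNIV. F i) = (\<Prod>b\<in>Basis. F (?ix b))" for F :: "'n \<Rightarrow> complex"
    by (rule prod.reindex_bij_witness[of _ ?ix "\<lambda>i. axis i 1"])
       (auto simp: Basis_vec_def axis_eq_axis)
  have eq: "(\<Prod>i\<in>UNIV. f i ((\<Sum>b\<in>Basis. y b *\<^sub>R b) $ i)) = (\<Prod>b\<in>Basis. f (?ix b) (y b))" for y :: "real^'n \<Rightarrow> real"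
    unfolding coord by (subst reindex, rule prod.cong) (auto simp: Basis_vec_def axis_eq_axis)
  have "(\<integral>x. (\<Prod>i\<in>UNIV. f i (x $ i)) \<partial>(lborel :: (real^'n) measure))
      = (\<integral>y. (\<Prod>b\<in>Basis. f (?ix b) (y b)) \<partial>(\<Pi>\<^sub>M b\<in>Basis. lborel))"
    by (subst lborel_eq, subst integral_distr) (simp_all add: eq del: sum_component)
  also have "\<dots> = (\<Prod>b\<in>Basis. \<integral>t. f (?ix b) t \<partial>lborel)"
    by (rule product_integral_prod) (use int in auto)
  also have "\<dots> = (\<Prod>i\<in>UNIV. \<integral>t. f i t \<partial>lborel)"
    by (rule reindex[symmetric])
  finally show "(\<integral>x. (\<Prod>i\<in>UNIV. f i (x $ i)) \<partial>(lborel :: (real^'n) measure)) = (\<Prod>i\<in>UNIV. \<integral>t. f i t \<partial>lborel)" .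
qed

text \<open>The standard normal distribution, given by the product of the one-dimensional densities.\<close>
definition std_gaussian :: "(real ^ 'p) measure" where
  "std_gaussian = density lborel (\<lambda>x. ennreal (\<Prod>i\<in>UNIV. std_normal_density (x $ i)))"

lemma sets_std_gaussian [simp, measurable_cong]: "sets std_gaussian = sets borel"
  and space_std_gaussian [simp]: "space std_gaussian = UNIV"
  by (simp_all add: std_gaussian_def)

lemma char_std_gaussian:
  fixes u :: "real^'p"
  shows "(\<integral>x. iexp (u \<bullet> x) \<partial>std_gaussian) = complex_of_real (exp (- (u \<bullet> u) / 2))"
proof -
  let ?f = "\<lambda>i t. std_normal_density t *\<^sub>R iexp (u $ i * t)"
  have int: "integrable lborel (?f i)" for i
    by (rule Bochner_Integration.integrable_bound[OF integrable_normal_density[of 1 0]]) auto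
  have "(\<integral>x. iexp (u \<bullet> x) \<partial>std_gaussian)
      = (\<integral>x. (\<Prod>i\<in>UNIV. std_normal_density (x $ i)) *\<^sub>R iexp (u \<bullet> x) \<partial>lborel)"
    unfolding std_gaussian_def
    by (rule integral_density) (auto intro!: prod_nonneg)
  also have "\<dots> = (\<integral>x. (\<Prod>i\<in>UNIV. ?f i (x $ i)) \<partial>(lborel :: (real^'p) measure))"
    by (intro Bochner_Integration.integral_cong refl)
       (simp add: scaleR_conv_of_real prod.distrib inner_vec_def sum_distrib_left exp_sum)
  also have "\<dots> = (\<Prod>i\<in>UNIV. \<integral>t. ?f i t \<partial>lborel)"
    by (rule integral_lborel_vec_prod[OF int])
  also have "\<dots> = (\<Prod>i\<in>UNIV. char std_normal_distribution (u $ i))"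
    unfolding char_def by (subst integral_density) auto
  also have "\<dots> = complex_of_real (exp (- (u \<bullet> u) / 2))"
    by (simp add: char_std_normal_distribution exp_sum[symmetric] inner_vec_def sum_negf
      sum_divide_distrib power2_eq_square of_real_prod[symmetric] del: of_real_prod of_real_exp)
  finally show ?thesis .
qed

lemma prob_space_std_gaussian: "prob_space (std_gaussian :: (real^'p) measure)"
proof
  let ?S = "std_gaussian :: (real^'p) measure"
  \<comment> \<open>the total mass is the value of the characteristic function at zero\<close>
  have "complex_of_real (measure ?S (space ?S)) = 1"
    using char_std_gaussian[of "0 :: real^'p"] by (simp add: scaleR_conv_of_real)
  then have "measure ?S (space ?S) = 1"
    using of_real_eq_1_iff by blast
  then show "emeasure ?S (space ?S) = 1"
    by (metis emeasure_eq_ennreal_measure ennreal_1 measure_def enn2real_top zero_neq_one)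
qed

text \<open>A centred normal vector with covariance \<open>A A\<^sup>T\<close> is the image under \<open>A\<close> of a standard one.\<close>
lemma centred_normal_eq_distr:
  fixes A :: "real^'p^'p"
  assumes "invertible A"
  shows "centred_normal (A ** transpose A) = distr std_gaussian borel ((*v) A)"
proof -
  let ?C = "A ** transpose A"
  let ?\<psi> = "\<lambda>x. ennreal (exp (- (x \<bullet> (matrix_inv ?C *v x)) / 2) / sqrt ((2 * pi) ^ CARD('p) * det ?C))"
  have detA: "det A \<noteq> 0"
    using assms by (simp add: invertible_det_nz)
  have "det ?C = (det A)\<^sup>2"
    by (simp add: det_mul det_transpose power2_eq_square)
  then have sqrtC: "sqrt ((2 * pi) ^ CARD('p) * det ?C) = sqrt ((2 * pi) ^ CARD('p)) * \<bar>det A\<bar>"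
    by (simp add: real_sqrt_mult)
  have invC: "matrix_inv ?C ** ?C = mat 1"
    using detA by (intro matrix_inv_left) (simp add: invertible_det_nz det_mul det_transpose)
  then have AB: "transpose A ** (matrix_inv ?C ** A) = mat 1"
    by (metis matrix_left_right_inverse matrix_mul_assoc)
  have quad: "(A *v y) \<bullet> (matrix_inv ?C *v (A *v y)) = y \<bullet> y" for y
  proof -
    have "(A *v y) \<bullet> (matrix_inv ?C *v (A *v y)) = y \<bullet> (transpose A *v (matrix_inv ?C *v (A *v y)))"
      by (metis dot_lmul_matrix vector_transpose_matrix)
    then show ?thesis
      using AB by (simp add: matrix_vector_mul_assoc)
  qed
  have [measurable]: "(*v) A \<in> borel_measurable borel"
    by (rule borel_measurable_linear) simp
  have [measurable]: "(*v) (matrix_inv ?C) \<in> borel_measurable borel"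
    by (rule borel_measurable_linear) simp
  have "lborel = density (distr lborel borel ((*v) A)) (\<lambda>_. ennreal \<bar>det A\<bar>)"
    using lborel_linear_image[of "(*v) A"] detA by simp
  then have "centred_normal ?C = density (density (distr lborel borel ((*v) A)) (\<lambda>_. ennreal \<bar>det A\<bar>)) ?\<psi>"
    unfolding centred_normal_def by simp
  also have "\<dots> = density (distr lborel borel ((*v) A)) (\<lambda>x. ennreal \<bar>det A\<bar> * ?\<psi> x)"
    by (rule density_density_eq) auto
  also have "\<dots> = distr (density lborel (\<lambda>y. ennreal \<bar>det A\<bar> * ?\<psi> (A *v y))) borel ((*v) A)"
    by (rule density_distr) auto
  also have "(\<lambda>y. ennreal \<bar>det A\<bar> * ?\<psi> (A *v y)) = (\<lambda>y. ennreal (\<Prod>i\<in>UNIV. std_normal_density (y $ i)))"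
  proof
    fix y :: "real^'p"
    have "sqrt ((2 * pi) ^ CARD('p)) = sqrt (2 * pi) ^ CARD('p)"
      by (rule real_sqrt_power)
    then have "(\<Prod>i\<in>UNIV. std_normal_density (y $ i)) = exp (- (y \<bullet> y) / 2) / sqrt ((2 * pi) ^ CARD('p))"
      by (simp add: std_normal_density_def prod_dividef exp_sum[symmetric] inner_vec_def sum_negf
        sum_divide_distrib power2_eq_square prod_constant del: power_mult_distrib)
    then show "ennreal \<bar>det A\<bar> * ?\<psi> (A *v y) = ennreal (\<Prod>i\<in>UNIV. std_normal_density (y $ i))"
      unfolding sqrtC quad using detA by (subst ennreal_mult[symmetric]) auto
  qed
  finally show ?thesis
    by (simp add: std_gaussian_def)
qed

lemma sets_centred_normal [simp, measurable_cong]: "sets (centred_normal C) = sets borel"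
  and space_centred_normal [simp]: "space (centred_normal C) = UNIV"
  by (simp_all add: centred_normal_def)

lemma
  fixes A :: "real^'p^'p" and u :: "real^'p"
  assumes "invertible A"
  shows prob_space_centred_normal: "prob_space (centred_normal (A ** transpose A))"
    and char_centred_normal: "(\<integral>x. iexp (u \<bullet> x) \<partial>centred_normal (A ** transpose A))
        = complex_of_real (exp (- (u \<bullet> ((A ** transpose A) *v u)) / 2))"
proof -
  have [measurable]: "(*v) A \<in> borel_measurable borel"
    by (rule borel_measurable_linear) simp
  interpret std: prob_space "std_gaussian :: (real^'p) measure"
    by (rule prob_space_std_gaussian)
  show "prob_space (centred_normal (A ** transpose A))"
    unfolding centred_normal_eq_distr[OF assms] by (rule std.prob_space_distr) simp
  have adj: "u \<bullet> (A *v x) = (transpose A *v u) \<bullet> x" for x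
    by (metis dot_lmul_matrix vector_transpose_matrix transpose_transpose)
  have "(\<integral>x. iexp (u \<bullet> x) \<partial>centred_normal (A ** transpose A))
      = (\<integral>x. iexp ((transpose A *v u) \<bullet> x) \<partial>std_gaussian)"
    unfolding centred_normal_eq_distr[OF assms] by (subst integral_distr) (auto simp: adj)
  also have "\<dots> = complex_of_real (exp (- (u \<bullet> ((A ** transpose A) *v u)) / 2))"
    unfolding char_std_gaussian using adj[of "transpose A *v u"] by (simp add: matrix_vector_mul_assoc del: transpose_matrix_vector)
  finally show "(\<integral>x. iexp (u \<bullet> x) \<partial>centred_normal (A ** transpose A))
      = complex_of_real (exp (- (u \<bullet> ((A ** transpose A) *v u)) / 2))" .
qed


section \<open>Weak convergence from characteristic functions\<close>

text \<open>Real trigonometric polynomials: the linear span of the waves \<open>cos (u \<bullet> x + c)\<close>. The phase \<open>c\<close>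
  accounts for the sines and makes the span closed under products.\<close>
inductive trig_poly :: "('a::real_inner \<Rightarrow> real) \<Rightarrow> bool" where
  cos: "trig_poly (\<lambda>x. cos (u \<bullet> x + c))"
| add: "trig_poly f \<Longrightarrow> trig_poly g \<Longrightarrow> trig_poly (\<lambda>x. f x + g x)"
| scale: "trig_poly f \<Longrightarrow> trig_poly (\<lambda>x. r * f x)"

lemma trig_poly_const: "trig_poly (\<lambda>x. r)"
  using trig_poly.scale[OF trig_poly.cos[of 0 0], of r] by simp

lemma trig_poly_sum:
  assumes "finite I" "\<And>i. i \<in> I \<Longrightarrow> trig_poly (f i)"
  shows "trig_poly (\<lambda>x. \<Sum>i\<in>I. f i x)"
  using assms by (induction I rule: finite_induct) (auto intro: trig_poly_const trig_poly.add)

lemma trig_poly_mult: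
  assumes "trig_poly f" "trig_poly g"
  shows "trig_poly (\<lambda>x. f x * g x)"
  using assms
proof (induction arbitrary: g rule: trig_poly.induct)
  case (cos u c)
  from cos show ?case
  proof (induction rule: trig_poly.induct)
    case (cos v d)
    have "(\<lambda>x. cos (u \<bullet> x + c) * cos (v \<bullet> x + d))
        = (\<lambda>x. (1/2) * cos ((u - v) \<bullet> x + (c - d)) + (1/2) * cos ((u + v) \<bullet> x + (c + d)))"
      unfolding fun_eq_iff cos_times_cos inner_add_left inner_diff_left
      by (simp add: algebra_simps add_divide_distrib)
    then show ?case
      by (simp only:) (intro trig_poly.intros)
  next
    case (add f g)
    then show ?case by (simp add: ring_distribs trig_poly.add)
  next
    case (scale f r)
    then show ?case
      using trig_poly.scale[OF scale.IH, of r] by (simp add: mult.left_commute)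
  qed
next
  case (add f1 f2)
  then show ?case by (simp add: ring_distribs trig_poly.add)
next
  case (scale f r)
  then show ?case
    using trig_poly.scale[OF scale.IH[OF scale.prems], of r] by (simp add: mult.assoc)
qed

text \<open>The coordinatewise sine maps the box on which it is injective onto a cube. Composition with it turns
  polynomials, which approximate uniformly on the cube, into trigonometric polynomials, which are
  bounded on the whole space by their bound on that box.\<close>
lemma trig_poly_compose_sin:
  fixes q :: "real^'p \<Rightarrow> real"
  assumes "real_polynomial_function q"
  shows "trig_poly (\<lambda>x::real^'p. q (\<chi> i. sin (s * x $ i)))"
  using assms
proof (induction rule: real_polynomial_function.induct)
  case (linear f)
  interpret bounded_linear f by fact
  have sin: "trig_poly (\<lambda>x::real^'p. sin (s * x $ i))" for i
  proof -
    have "sin (s * x $ i) = cos ((s *\<^sub>R axis i 1) \<bullet> x + (- (pi / 2)))" for x :: "real^'p"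
      by (simp add: inner_axis' cos_diff)
    then have "(\<lambda>x::real^'p. sin (s * x $ i)) = (\<lambda>x. cos ((s *\<^sub>R axis i 1) \<bullet> x + (- (pi / 2))))"
      by (rule ext)
    then show ?thesis
      by (metis trig_poly.cos)
  qed
  have f: "f y = (\<Sum>i\<in>UNIV. f (axis i 1) * y $ i)" for y
  proof -
    have "f y = f (\<Sum>i\<in>UNIV. y $ i *\<^sub>R axis i 1)"
      using basis_expansion[of y] by (simp add: scalar_mult_eq_scaleR)
    then show ?thesis
      by (simp add: sum scaleR mult.commute)
  qed
  have "(\<lambda>x::real^'p. f (\<chi> i. sin (s * x $ i))) = (\<lambda>x. \<Sum>i\<in>UNIV. f (axis i 1) * sin (s * x $ i))"
    by (rule ext, subst f) simp
  then show ?case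
    by (simp only:) (intro trig_poly_sum trig_poly.scale sin finite)
qed (auto intro: trig_poly_const trig_poly.add trig_poly_mult)

lemma trig_poly_continuous: "trig_poly h \<Longrightarrow> continuous_on UNIV h"
  by (induction rule: trig_poly.induct) (auto intro!: continuous_intros)

lemma trig_poly_bounded: "trig_poly h \<Longrightarrow> \<exists>K. \<forall>x. \<bar>h x\<bar> \<le> K"
proof (induction rule: trig_poly.induct)
  case (cos u c)
  show ?case by (rule exI[of _ 1]) simp
next
  case (add f g)
  then obtain K L where "\<forall>x. \<bar>f x\<bar> \<le> K" "\<forall>x. \<bar>g x\<bar> \<le> L" by blast
  then show ?case by (intro exI[of _ "K + L"]) (metis abs_triangle_ineq add_mono order_trans)
next
  case (scale f r)
  then obtain K where "\<forall>x. \<bar>f x\<bar> \<le> K" by blast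
  then show ?case by (intro exI[of _ "\<bar>r\<bar> * K"]) (simp add: abs_mult mult_left_mono)
qed

lemma integrable_bounded_continuous:
  fixes h :: "'a::topological_space \<Rightarrow> real"
  assumes "prob_space M" "sets M = sets borel" "continuous_on UNIV h" "\<And>x. \<bar>h x\<bar> \<le> K"
  shows "integrable M h"
proof -
  interpret prob_space M by fact
  show ?thesis
    using assms by (intro integrable_const_bound[of _ K])
      (auto simp: measurable_cong_sets[OF assms(2) refl] borel_measurable_continuous_onI)
qed

lemma tendsto_integral_trig_poly:
  fixes Q :: "nat \<Rightarrow> 'a::euclidean_space measure"
  assumes Q: "\<And>k. prob_space (Q k)" "\<And>k. sets (Q k) = sets borel"
    and N: "prob_space N" "sets N = sets borel"
    and char: "\<And>u. (\<lambda>k. \<integral>x. iexp (u \<bullet> x) \<partial>Q k) \<longlonglongrightarrow> (\<integral>x. iexp (u \<bullet> x) \<partial>N)"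
    and "trig_poly h"
  shows "(\<lambda>k. \<integral>x. h x \<partial>Q k) \<longlonglongrightarrow> (\<integral>x. h x \<partial>N)"
  using \<open>trig_poly h\<close>
proof (induction rule: trig_poly.induct)
  case (cos u c)
  have eq: "(\<integral>x. cos (u \<bullet> x + c) \<partial>M) = Re (cis c * (\<integral>x. iexp (u \<bullet> x) \<partial>M))"
    if M: "prob_space M" "sets M = sets borel" for M :: "'a measure"
  proof -
    interpret prob_space M by fact
    have "integrable M (\<lambda>x. iexp (u \<bullet> x))"
      by (rule integrable_const_bound[of _ 1])
         (auto simp: measurable_cong_sets[OF M(2) refl] intro!: borel_measurable_continuous_onI continuous_intros)
    then have "integrable M (\<lambda>x. cis c * iexp (u \<bullet> x))" by simp
    then have "Re (\<integral>x. cis c * iexp (u \<bullet> x) \<partial>M) = (\<integral>x. Re (cis c * iexp (u \<bullet> x)) \<partial>M)"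
      by (rule integral_Re[symmetric])
    then show ?thesis
      by (simp add: Re_exp Im_exp cos_add algebra_simps)
  qed
  have "(\<lambda>k. Re (cis c * (\<integral>x. iexp (u \<bullet> x) \<partial>Q k))) \<longlonglongrightarrow> Re (cis c * (\<integral>x. iexp (u \<bullet> x) \<partial>N))"
    by (intro tendsto_intros char)
  then show ?case
    by (simp add: eq Q N)
next
  case (add f g)
  have I: "integrable M h" if M: "prob_space M" "sets M = sets borel" and h: "trig_poly h" for M :: "'a measure" and h
  proof -
    obtain K where "\<And>x. \<bar>h x\<bar> \<le> K" using trig_poly_bounded[OF h] by blast
    with M trig_poly_continuous[OF h] show ?thesis by (rule integrable_bounded_continuous)
  qed
  show ?case
    using tendsto_add[OF add.IH] add.hyps by (simp add: I Q N)
next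
  case (scale f r)
  then show ?case by (auto intro: tendsto_mult_left)
qed

lemma (in prob_space) tail_tendsto_0:
  fixes Z :: "'a \<Rightarrow> real"
  assumes [measurable]: "Z \<in> borel_measurable M" and "\<epsilon> > 0"
  shows "\<forall>\<^sub>F R in at_top. prob {\<omega> \<in> space M. R < Z \<omega>} < \<epsilon>"
proof -
  define A where "A = (\<lambda>n::nat. {\<omega> \<in> space M. real n < Z \<omega>})"
  have "(\<lambda>n. prob (A n)) \<longlonglongrightarrow> prob (\<Inter>n. A n)"
    by (rule finite_Lim_measure_decseq) (auto simp: A_def decseq_def)
  also have "(\<Inter>n. A n) = {}"
    unfolding A_def by auto (meson not_less real_arch_simple)
  finally have "\<forall>\<^sub>F n in sequentially. prob (A n) < \<epsilon>"
    using \<open>\<epsilon> > 0\<close> by (auto dest: order_tendstoD)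
  then obtain n where n: "prob (A n) < \<epsilon>"
    by (auto simp: eventually_sequentially)
  show ?thesis
    unfolding eventually_at_top_linorder
  proof (intro exI allI impI)
    fix R :: real assume "real n \<le> R"
    then have "prob {\<omega> \<in> space M. R < Z \<omega>} \<le> prob (A n)"
      by (intro finite_measure_mono) (auto simp: A_def)
    with n show "prob {\<omega> \<in> space M. R < Z \<omega>} < \<epsilon>" by simp
  qed
qed

text \<open>A version of Levy's continuity theorem on \<open>\<real>\<^sup>p\<close>. On a large ball the test function \<open>g\<close> equals
  \<open>y \<mapsto> g (arcsin y / s)\<close> composed with \<open>x \<mapsto> sin (s x)\<close>. Approximating the former by a polynomial yields
  a trigonometric polynomial \<open>h\<close> that is close to \<open>g\<close> on the ball and bounded elsewhere; the integrals
  of \<open>h\<close> converge by assumption, and tightness makes the rest small.\<close>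
lemma weak_convergence_char_tight:
  fixes Q :: "nat \<Rightarrow> (real^'p) measure"
  assumes Q: "\<And>k. prob_space (Q k)" "\<And>k. sets (Q k) = sets borel"
    and N: "prob_space N" "sets N = sets borel"
    and char: "\<And>u. (\<lambda>k. \<integral>x. iexp (u \<bullet> x) \<partial>Q k) \<longlonglongrightarrow> (\<integral>x. iexp (u \<bullet> x) \<partial>N)"
    and tight: "\<And>\<epsilon>. \<epsilon> > 0 \<Longrightarrow> \<exists>R. \<forall>\<^sub>F k in sequentially. measure (Q k) {x. R < norm x} < \<epsilon>"
    and g: "continuous_on UNIV g" "bounded (range g)"
  shows "(\<lambda>k. \<integral>x. g x \<partial>Q k) \<longlonglongrightarrow> (\<integral>x. g x \<partial>N :: real)"
proof (rule tendstoI)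
  fix \<epsilon> :: real assume "\<epsilon> > 0"
  obtain G where "G > 0" and G: "\<And>x. \<bar>g x\<bar> \<le> G"
    using g(2) unfolding bounded_pos by auto
  define \<delta> where "\<delta> = \<epsilon> / (8 * (2 * G + 1))"
  define \<eta> where "\<eta> = min 1 (\<epsilon> / 8)"
  have "\<delta> > 0" "\<eta> > 0" "\<eta> \<le> 1" "\<eta> \<le> \<epsilon> / 8"
    using \<open>\<epsilon> > 0\<close> \<open>G > 0\<close> by (auto simp: \<delta>_def \<eta>_def)
  interpret N: prob_space N by fact
  have spN: "space N = UNIV" using sets_eq_imp_space_eq[OF N(2)] by simp
  have "norm \<in> borel_measurable N" by (simp add: measurable_cong_sets[OF N(2) refl])
  from N.tail_tendsto_0[OF this \<open>\<delta> > 0\<close>] obtain R1 where R1: "\<And>R. R \<ge> R1 \<Longrightarrow> measure N {x. R < norm x} < \<delta>"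
    by (auto simp: eventually_at_top_linorder spN)
  obtain R2 where R2: "\<forall>\<^sub>F k in sequentially. measure (Q k) {x. R2 < norm x} < \<delta>"
    using tight[OF \<open>\<delta> > 0\<close>] by blast
  define R where "R = max 1 (max R1 R2)"
  have "R > 0" "R \<ge> R1" "R \<ge> R2" by (auto simp: R_def)
  \<comment> \<open>then \<open>s * R = pi / 2\<close>, so \<open>arcsin\<close> inverts \<open>sin\<close> at \<open>s * x $ i\<close> whenever \<open>norm x \<le> R\<close>\<close>
  define s where "s = pi / (2 * R)"
  have "s > 0" using \<open>R > 0\<close> by (simp add: s_def)
  let ?B = "{y :: real^'p. \<forall>i. -1 \<le> y $ i \<and> y $ i \<le> 1}"
  have B: "?B = cbox (\<chi> i. -1) (\<chi> i. 1)"
    by (auto simp: mem_box_cart)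
  have "continuous_on ?B (\<lambda>y. g (\<chi> i. arcsin (y $ i) / s))"
    using \<open>s > 0\<close> by (intro continuous_on_compose2[OF g(1)]) (auto intro!: continuous_intros)
  moreover have "compact ?B"
    unfolding B by (rule compact_cbox)
  ultimately obtain q where q: "real_polynomial_function q"
    and qg: "\<And>y. y \<in> ?B \<Longrightarrow> \<bar>g (\<chi> i. arcsin (y $ i) / s) - q y\<bar> < \<eta>"
    using Stone_Weierstrass_real_polynomial_function \<open>\<eta> > 0\<close> by blast
  define h where "h = (\<lambda>x::real^'p. q (\<chi> i. sin (s * x $ i)))"
  have h: "trig_poly h"
    unfolding h_def by (rule trig_poly_compose_sin[OF q])
  have near: "\<bar>g x - h x\<bar> \<le> \<eta>" if "norm x \<le> R" for x
  proof -
    have "arcsin (sin (s * x $ i)) / s = x $ i" for i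
    proof -
      have "\<bar>x $ i\<bar> \<le> R" using component_le_norm_cart[of x i] that by simp
      then have "\<bar>s * x $ i\<bar> \<le> s * R" using \<open>s > 0\<close> by (simp add: abs_mult)
      also have "s * R = pi / 2" using \<open>R > 0\<close> by (simp add: s_def)
      finally show ?thesis using \<open>s > 0\<close> by (simp add: arcsin_sin)
    qed
    then show ?thesis
      using qg[of "\<chi> i. sin (s * x $ i)"] by (simp add: h_def)
  qed
  have far: "\<bar>g x - h x\<bar> \<le> 2 * G + \<eta>" for x
    using qg[of "\<chi> i. sin (s * x $ i)"] G[of x] G[of "\<chi> i. arcsin ((\<chi> i. sin (s * x $ i)) $ i) / s"]
    by (auto simp: h_def)
  have diff: "\<bar>(\<integral>x. g x \<partial>M) - (\<integral>x. h x \<partial>M)\<bar> \<le> \<epsilon> / 4"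
    if M: "prob_space M" "sets M = sets borel" and tail: "measure M {x. R < norm x} < \<delta>" for M
  proof -
    interpret prob_space M by fact
    have spM: "space M = UNIV" using sets_eq_imp_space_eq[OF M(2)] by simp
    have T: "{x. R < norm x} \<in> sets M" unfolding M(2) by measurable
    obtain K where K: "\<And>x. \<bar>h x\<bar> \<le> K" using trig_poly_bounded[OF h] by blast
    have ig: "integrable M g" by (rule integrable_bounded_continuous[OF M g(1) G])
    have ih: "integrable M h" by (rule integrable_bounded_continuous[OF M trig_poly_continuous[OF h] K])
    have iT: "integrable M (indicator {x. R < norm x} :: _ \<Rightarrow> real)"
      using T by (simp add: emeasure_eq_measure)
    have "\<bar>(\<integral>x. g x \<partial>M) - (\<integral>x. h x \<partial>M)\<bar> = \<bar>\<integral>x. g x - h x \<partial>M\<bar>"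
      by (simp add: ig ih)
    also have "\<dots> \<le> (\<integral>x. \<bar>g x - h x\<bar> \<partial>M)"
      by (rule integral_abs_bound)
    also have "\<dots> \<le> (\<integral>x. \<eta> + (2 * G + \<eta>) * indicator {x. R < norm x} x \<partial>M)"
    proof (rule integral_mono)
      show "integrable M (\<lambda>x. \<bar>g x - h x\<bar>)" using ig ih by simp
      show "integrable M (\<lambda>x. \<eta> + (2 * G + \<eta>) * indicator {x. R < norm x} x)"
        using iT by simp
      show "\<bar>g x - h x\<bar> \<le> \<eta> + (2 * G + \<eta>) * indicator {x. R < norm x} x" for x
        using near[of x] far[of x] \<open>\<eta> > 0\<close> by (cases "R < norm x") auto
    qed
    also have "\<dots> = \<eta> + (2 * G + \<eta>) * measure M {x. R < norm x}"
      using iT T prob_space by (simp add: spM)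
    also have "\<dots> \<le> \<epsilon> / 8 + (2 * G + 1) * \<delta>"
      using tail \<open>\<eta> \<le> 1\<close> \<open>\<eta> \<le> \<epsilon> / 8\<close> \<open>G > 0\<close> \<open>\<delta> > 0\<close> \<open>\<eta> > 0\<close> by (intro add_mono mult_mono) auto
    also have "(2 * G + 1) * \<delta> = \<epsilon> / 8"
      using \<open>G > 0\<close> nonzero_mult_divide_mult_cancel_left[of "2 * G + 1" \<epsilon> 8] by (simp add: \<delta>_def mult.commute)
    also have "\<epsilon> / 8 + \<epsilon> / 8 = \<epsilon> / 4"
      by simp
    finally show ?thesis .
  qed
  have "\<forall>\<^sub>F k in sequentially. dist (\<integral>x. h x \<partial>Q k) (\<integral>x. h x \<partial>N) < \<epsilon> / 4"
    using tendsto_integral_trig_poly[OF Q N char h] \<open>\<epsilon> > 0\<close> by (intro tendstoD) auto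
  then show "\<forall>\<^sub>F k in sequentially. dist (\<integral>x. g x \<partial>Q k) (\<integral>x. g x \<partial>N) < \<epsilon>"
    using R2
  proof eventually_elim
    case (elim k)
    interpret Qk: prob_space "Q k" by (rule Q)
    have "measure (Q k) {x. R < norm x} \<le> measure (Q k) {x. R2 < norm x}"
      using \<open>R \<ge> R2\<close> by (intro Qk.finite_measure_mono) (auto simp: Q(2))
    then have "\<bar>(\<integral>x. g x \<partial>Q k) - (\<integral>x. h x \<partial>Q k)\<bar> \<le> \<epsilon> / 4"
      using elim by (intro diff Q) simp
    moreover have "\<bar>(\<integral>x. g x \<partial>N) - (\<integral>x. h x \<partial>N)\<bar> \<le> \<epsilon> / 4"
      by (intro diff N R1 \<open>R \<ge> R1\<close>)
    ultimately show ?case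
      using elim(1) \<open>\<epsilon> > 0\<close> unfolding dist_real_def by linarith
  qed
qed

lemma converges_in_distribution_char_tight:
  fixes Z :: "nat \<Rightarrow> 'w \<Rightarrow> real^'p"
  assumes P: "prob_space P" and Z: "\<forall>\<^sub>F k in sequentially. Z k \<in> borel_measurable P"
    and N: "prob_space N" "sets N = sets borel"
    and char: "\<And>u. (\<lambda>k. \<integral>\<omega>. iexp (u \<bullet> Z k \<omega>) \<partial>P) \<longlonglongrightarrow> (\<integral>x. iexp (u \<bullet> x) \<partial>N)"
    and tight: "\<And>\<epsilon>. \<epsilon> > 0 \<Longrightarrow> \<exists>R. \<forall>\<^sub>F k in sequentially. measure P {\<omega> \<in> space P. R < norm (Z k \<omega>)} < \<epsilon>"
  shows "converges_in_distribution P Z N"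
  unfolding converges_in_distribution_def
proof (intro allI impI, elim conjE)
  fix g :: "real^'p \<Rightarrow> real" assume g: "continuous_on UNIV g" "bounded (range g)"
  \<comment> \<open>finitely many \<open>Z k\<close> need not be measurable; replacing them does not affect the limit\<close>
  define Z' where "Z' = (\<lambda>k. if Z k \<in> borel_measurable P then Z k else (\<lambda>_. 0))"
  have [measurable]: "Z' k \<in> borel_measurable P" for k
    by (simp add: Z'_def)
  have Z': "\<forall>\<^sub>F k in sequentially. Z' k = Z k"
    using Z by eventually_elim (simp add: Z'_def)
  interpret prob_space P by fact
  have "(\<lambda>k. \<integral>x. g x \<partial>distr P borel (Z' k)) \<longlonglongrightarrow> (\<integral>x. g x \<partial>N)"
  proof (rule weak_convergence_char_tight[OF _ _ N _ _ g])
    fix u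
    have "\<forall>\<^sub>F k in sequentially. (\<integral>x. iexp (u \<bullet> x) \<partial>distr P borel (Z' k)) = (\<integral>\<omega>. iexp (u \<bullet> Z k \<omega>) \<partial>P)"
      using Z' Z by eventually_elim (subst integral_distr, auto)
    then show "(\<lambda>k. \<integral>x. iexp (u \<bullet> x) \<partial>distr P borel (Z' k)) \<longlonglongrightarrow> (\<integral>x. iexp (u \<bullet> x) \<partial>N)"
      using char[of u] by (simp add: tendsto_cong)
  next
    fix \<epsilon> :: real assume "\<epsilon> > 0"
    then obtain R where "\<forall>\<^sub>F k in sequentially. measure P {\<omega> \<in> space P. R < norm (Z k \<omega>)} < \<epsilon>"
      using tight by blast
    then have "\<forall>\<^sub>F k in sequentially. measure (distr P borel (Z' k)) {x. R < norm x} < \<epsilon>"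
      using Z'
    proof eventually_elim
      case (elim k)
      have "measure (distr P borel (Z' k)) {x. R < norm x} = measure P {\<omega> \<in> space P. R < norm (Z' k \<omega>)}"
        by (subst measure_distr) (auto intro!: arg_cong[where f="measure P"])
      with elim show ?case by simp
    qed
    then show "\<exists>R. \<forall>\<^sub>F k in sequentially. measure (distr P borel (Z' k)) {x. R < norm x} < \<epsilon>" ..
  qed (auto intro: prob_space_distr)
  then show "(\<lambda>k. \<integral>x. g x \<partial>distr P borel (Z k)) \<longlonglongrightarrow> (\<integral>x. g x \<partial>N)"
    by (rule Lim_transform_eventually) (use Z' in eventually_elim, auto)
qed


section \<open>A central limit theorem for martingale differences\<close>

lemma cesaro_mean_tendsto:
  fixes x :: "nat \<Rightarrow> 'a::real_normed_vector"
  assumes "x \<longlonglongrightarrow> L"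
  shows "(\<lambda>K. (1 / real K) *\<^sub>R (\<Sum>j<K. x j)) \<longlonglongrightarrow> L"
proof (rule tendstoI)
  fix r :: real assume "r > 0"
  then obtain N where N: "\<And>j. j \<ge> N \<Longrightarrow> norm (x j - L) < r / 2"
    using LIMSEQ_D[OF assms, of "r / 2"] by auto
  define C where "C = (\<Sum>j<N. norm (x j - L))"
  have "C \<ge> 0" by (simp add: C_def sum_nonneg)
  have "(\<lambda>K. C / real K) \<longlonglongrightarrow> 0"
    by real_asymp
  then have "\<forall>\<^sub>F K in sequentially. C / real K < r / 2"
    using \<open>r > 0\<close> by (intro order_tendstoD) auto
  then show "\<forall>\<^sub>F K in sequentially. dist ((1 / real K) *\<^sub>R (\<Sum>j<K. x j)) L < r"
    using eventually_gt_at_top[of 0]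
  proof eventually_elim
    case (elim K)
    have "(1 / real K) *\<^sub>R (\<Sum>j<K. x j) - L = (1 / real K) *\<^sub>R (\<Sum>j<K. x j - L)"
      using elim by (simp add: sum_subtractf scaleR_diff_right sum_constant_scaleR)
    then have "dist ((1 / real K) *\<^sub>R (\<Sum>j<K. x j)) L = norm (\<Sum>j<K. x j - L) / real K"
      by (simp add: dist_norm)
    also have "\<dots> \<le> (\<Sum>j<K. norm (x j - L)) / real K"
      by (intro divide_right_mono norm_sum) simp
    also have "(\<Sum>j<K. norm (x j - L)) \<le> (\<Sum>j\<in>{..<N} \<union> {N..<K}. norm (x j - L))"
      by (intro sum_mono2) auto
    also have "\<dots> = C + (\<Sum>j\<in>{N..<K}. norm (x j - L))"
      unfolding C_def by (intro sum.union_disjoint) auto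
    also have "(\<Sum>j\<in>{N..<K}. norm (x j - L)) \<le> (\<Sum>j\<in>{N..<K}. r / 2)"
      using N by (intro sum_mono) (simp add: less_imp_le)
    also have "\<dots> \<le> real K * (r / 2)"
      using \<open>r > 0\<close> by (simp add: field_simps)
    also have "(C + real K * (r / 2)) / real K = C / real K + r / 2"
      using elim by (simp add: field_simps)
    also have "\<dots> < r"
      using elim(1) by linarith
    finally show ?case
      using elim by (simp add: divide_right_mono)
  qed
qed

lemma integrable_mult_of_square_integrable:
  fixes X Y :: "'w \<Rightarrow> real"
  assumes [measurable]: "X \<in> borel_measurable M" "Y \<in> borel_measurable M"
    and "integrable M (\<lambda>\<omega>. (X \<omega>)\<^sup>2)" "integrable M (\<lambda>\<omega>. (Y \<omega>)\<^sup>2)"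
  shows "integrable M (\<lambda>\<omega>. X \<omega> * Y \<omega>)"
proof (rule Bochner_Integration.integrable_bound)
  show "integrable M (\<lambda>\<omega>. (X \<omega>)\<^sup>2 + (Y \<omega>)\<^sup>2)" using assms by simp
  have "\<bar>X \<omega> * Y \<omega>\<bar> \<le> (X \<omega>)\<^sup>2 + (Y \<omega>)\<^sup>2" for \<omega>
  proof -
    have "0 \<le> \<bar>X \<omega>\<bar> * \<bar>Y \<omega>\<bar>" by simp
    moreover have "2 * \<bar>X \<omega>\<bar> * \<bar>Y \<omega>\<bar> \<le> (X \<omega>)\<^sup>2 + (Y \<omega>)\<^sup>2"
      using sum_squares_bound[of "\<bar>X \<omega>\<bar>" "\<bar>Y \<omega>\<bar>"] by simp
    ultimately show ?thesis unfolding abs_mult by linarith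
  qed
  then show "AE \<omega> in M. norm (X \<omega> * Y \<omega>) \<le> norm ((X \<omega>)\<^sup>2 + (Y \<omega>)\<^sup>2)"
    by (auto intro!: AE_I2 order_trans[OF _ abs_ge_self])
qed simp

lemma (in prob_space) integrable_of_square_integrable:
  fixes X :: "'a \<Rightarrow> real"
  assumes [measurable]: "X \<in> borel_measurable M" and "integrable M (\<lambda>\<omega>. (X \<omega>)\<^sup>2)"
  shows "integrable M X"
  using integrable_mult_of_square_integrable[of X M "\<lambda>_. 1"] assms by simp

lemma (in sigma_finite_subalgebra) cond_exp_complex_intg:
  fixes Z :: "'a \<Rightarrow> complex" and g :: "'a \<Rightarrow> real"
  assumes Z[measurable]: "Z \<in> borel_measurable F" and bnd: "\<And>\<omega>. norm (Z \<omega>) \<le> 1" and g: "integrable M g"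
  shows "(\<integral>\<omega>. Z \<omega> * complex_of_real (g \<omega>) \<partial>M) = (\<integral>\<omega>. Z \<omega> * complex_of_real (real_cond_exp M F g \<omega>) \<partial>M)"
proof -
  have [measurable]: "Z \<in> borel_measurable M"
    by (rule measurable_from_subalg[OF subalg Z])
  have [measurable]: "g \<in> borel_measurable M" using g by auto
  have bd: "integrable M (\<lambda>\<omega>. Z \<omega> * complex_of_real (f \<omega>))" if "integrable M f" for f :: "'a \<Rightarrow> real"
  proof (rule Bochner_Integration.integrable_bound[OF that])
    show "AE \<omega> in M. norm (Z \<omega> * complex_of_real (f \<omega>)) \<le> norm (f \<omega>)"
      using bnd by (auto simp: norm_mult intro!: mult_left_le_one_le)
  qed (use that in measurable)
  have re: "integrable M (\<lambda>\<omega>. Re (Z \<omega>) * g \<omega>)" "integrable M (\<lambda>\<omega>. Im (Z \<omega>) * g \<omega>)"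
    using integrable_Re[OF bd[OF g]] integrable_Im[OF bd[OF g]] by simp_all
  note ce = real_cond_exp_int(1)[OF g]
  show ?thesis
  proof (rule complex_eqI)
    show "Re (\<integral>\<omega>. Z \<omega> * complex_of_real (g \<omega>) \<partial>M) = Re (\<integral>\<omega>. Z \<omega> * complex_of_real (real_cond_exp M F g \<omega>) \<partial>M)"
      using real_cond_exp_intg(2)[OF re(1)] by (simp add: integral_Re[symmetric] bd g ce del: integral_Re)
    show "Im (\<integral>\<omega>. Z \<omega> * complex_of_real (g \<omega>) \<partial>M) = Im (\<integral>\<omega>. Z \<omega> * complex_of_real (real_cond_exp M F g \<omega>) \<partial>M)"
      using real_cond_exp_intg(2)[OF re(2)] by (simp add: integral_Im[symmetric] bd g ce del: integral_Im)
  qed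
qed

text \<open>Square integrable martingale differences; the increment \<open>D j\<close> leads from time \<open>j\<close> to time \<open>Suc j\<close>.\<close>
locale martingale_differences = prob_space P for P :: "'w measure" +
  fixes F :: "nat \<Rightarrow> 'w measure" and D :: "nat \<Rightarrow> 'w \<Rightarrow> real"
  assumes subalgebra: "\<And>j. subalgebra P (F j)"
    and filtration: "\<And>j. sets (F j) \<subseteq> sets (F (Suc j))"
    and adapted: "\<And>j. D j \<in> borel_measurable (F (Suc j))"
    and square_integrable: "\<And>j. integrable P (\<lambda>\<omega>. (D j \<omega>)\<^sup>2)"
    and centred: "\<And>j. AE \<omega> in P. real_cond_exp P (F j) (D j) \<omega> = 0"
begin

lemma sigma_finite_F: "sigma_finite_subalgebra P (F j)"
  by (intro finite_measure_subalgebra_is_sigma_finite finite_measure_subalgebra.intro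
    finite_measure_subalgebra_axioms.intro subalgebra) unfold_locales

lemma measurable_F_mono:
  assumes "i \<le> j" "f \<in> borel_measurable (F i)"
  shows "f \<in> borel_measurable (F j)"
proof -
  have "sets (F i) \<subseteq> sets (F j)"
    using lift_Suc_mono_le[of "\<lambda>j. sets (F j)", OF filtration assms(1)] .
  moreover have "space (F i) = space (F j)"
    using subalgebra by (simp add: subalgebra_def)
  ultimately show ?thesis
    using assms(2) by (auto simp: measurable_def)
qed

lemma D_measurable [measurable]: "D j \<in> borel_measurable P"
  by (rule measurable_from_subalg[OF subalgebra adapted])

lemma integrable_D: "integrable P (D j)"
  by (rule integrable_of_square_integrable[OF D_measurable square_integrable])

lemma partial_sum_measurable: "(\<lambda>\<omega>. \<Sum>i<j. D i \<omega>) \<in> borel_measurable (F j)"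
  by (intro borel_measurable_sum measurable_F_mono[OF _ adapted]) simp

lemma partial_sum_square:
  "integrable P (\<lambda>\<omega>. (\<Sum>j<K. D j \<omega>)\<^sup>2) \<and> (\<integral>\<omega>. (\<Sum>j<K. D j \<omega>)\<^sup>2 \<partial>P) = (\<Sum>j<K. \<integral>\<omega>. (D j \<omega>)\<^sup>2 \<partial>P)"
proof (induction K)
  case (Suc K)
  interpret FK: sigma_finite_subalgebra P "F K" by (rule sigma_finite_F)
  have "integrable P (\<lambda>\<omega>. (\<Sum>j<K. D j \<omega>) * D K \<omega>)"
    using Suc.IH square_integrable by (intro integrable_mult_of_square_integrable) auto
  note cross = this FK.real_cond_exp_intg(2)[OF this partial_sum_measurable D_measurable]
  have "(\<integral>\<omega>. (\<Sum>j<K. D j \<omega>) * real_cond_exp P (F K) (D K) \<omega> \<partial>P) = (\<integral>\<omega>. 0 \<partial>P)"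
    using centred[of K] by (intro integral_cong_AE) auto
  with cross have "(\<integral>\<omega>. (\<Sum>j<K. D j \<omega>) * D K \<omega> \<partial>P) = 0" by simp
  then show ?case
    using Suc.IH square_integrable[of K] cross(1)
    by (simp add: power2_sum mult.assoc)
qed simp

text \<open>Writing \<open>h = t / \<surd>K\<close>, the second order expansion of \<open>exp (\<i> h D\<^sub>j)\<close> shows that one more summand
  multiplies the characteristic function of the partial sum by nearly \<open>1 - h\<^sup>2 \<tau>\<^sup>2 / 2\<close>.\<close>
lemma char_step:
  fixes h \<tau>2 \<epsilon> :: real and m :: "nat \<Rightarrow> complex"
  defines "m \<equiv> \<lambda>j::nat. (\<integral>\<omega>. iexp (h * (\<Sum>i<j. D i \<omega>)) \<partial>P :: complex)"
  assumes "\<epsilon> \<ge> 0" "h\<^sup>2 \<noteq> 0"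
  shows "cmod (m (Suc j) - (1 - h\<^sup>2 * \<tau>2 / 2) * m j)
    \<le> h\<^sup>2 / 2 * (\<integral>\<omega>. \<bar>real_cond_exp P (F j) (\<lambda>\<omega>. (D j \<omega>)\<^sup>2) \<omega> - \<tau>2\<bar> \<partial>P)
      + \<epsilon> * h\<^sup>2 * (\<integral>\<omega>. (D j \<omega>)\<^sup>2 \<partial>P)
      + h\<^sup>2 * (\<integral>\<omega>. (D j \<omega>)\<^sup>2 * indicator {\<omega>. \<epsilon> < \<bar>h * D j \<omega>\<bar>} \<omega> \<partial>P)"
proof -
  interpret Fj: sigma_finite_subalgebra P "F j" by (rule sigma_finite_F)
  define V where "V = real_cond_exp P (F j) (\<lambda>\<omega>. (D j \<omega>)\<^sup>2)"
  define U where "U = (\<lambda>\<omega>. iexp (h * (\<Sum>i<j. D i \<omega>)))"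
  define r where "r = (\<lambda>\<omega>. iexp (h * D j \<omega>) - (1 + \<i> * (h * D j \<omega>) - (h * D j \<omega>)\<^sup>2 / 2))"
  have UF: "U \<in> borel_measurable (F j)"
    unfolding U_def using partial_sum_measurable[of j] by measurable
  have [measurable]: "U \<in> borel_measurable P"
    by (rule measurable_from_subalg[OF subalgebra UF])
  have [measurable]: "r \<in> borel_measurable P" unfolding r_def by measurable
  have U1: "cmod (U \<omega>) = 1" for \<omega> by (simp add: U_def)
  have intV: "integrable P V"
    unfolding V_def by (rule Fj.real_cond_exp_int[OF square_integrable])
  have bd: "integrable P (\<lambda>\<omega>. U \<omega> * f \<omega>)" if "integrable P f" for f :: "'w \<Rightarrow> complex"
    by (rule Bochner_Integration.integrable_bound[OF that]) (use that in \<open>auto simp: norm_mult U1\<close>)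
  have iU: "integrable P U"
    by (rule integrable_const_bound[of _ 1]) (auto simp: U1)
  let ?D = "\<lambda>\<omega>. complex_of_real (D j \<omega>)"
  have iD: "integrable P ?D" "integrable P (\<lambda>\<omega>. complex_of_real ((D j \<omega>)\<^sup>2))"
    by (rule integrable_of_real[OF integrable_D], rule integrable_of_real[OF square_integrable])
  have ir: "integrable P r"
  proof -
    have "r = (\<lambda>\<omega>. iexp (h * D j \<omega>) - (1 + \<i> * h * ?D \<omega> - complex_of_real (h\<^sup>2 / 2) * complex_of_real ((D j \<omega>)\<^sup>2)))"
      by (auto simp: r_def power_mult_distrib)
    moreover have "integrable P (\<lambda>\<omega>. iexp (h * D j \<omega>))"
      by (rule integrable_const_bound[of _ 1]) auto
    ultimately show ?thesis using iD by simp
  qed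
  have "m (Suc j) = (\<integral>\<omega>. U \<omega> * iexp (h * D j \<omega>) \<partial>P)"
    unfolding m_def U_def by (simp add: exp_add[symmetric] ring_distribs)
  also have "\<dots> = (\<integral>\<omega>. U \<omega> + \<i> * h * (U \<omega> * ?D \<omega>) - complex_of_real (h\<^sup>2 / 2) * (U \<omega> * complex_of_real ((D j \<omega>)\<^sup>2)) + U \<omega> * r \<omega> \<partial>P)"
    by (intro Bochner_Integration.integral_cong refl) (simp add: r_def algebra_simps power_mult_distrib)
  also have "\<dots> = m j + \<i> * h * (\<integral>\<omega>. U \<omega> * ?D \<omega> \<partial>P)
      - complex_of_real (h\<^sup>2 / 2) * (\<integral>\<omega>. U \<omega> * complex_of_real ((D j \<omega>)\<^sup>2) \<partial>P) + (\<integral>\<omega>. U \<omega> * r \<omega> \<partial>P)"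
    using iU bd[OF iD(1)] bd[OF iD(2)] bd[OF ir] by (simp add: m_def U_def)
  also have "(\<integral>\<omega>. U \<omega> * ?D \<omega> \<partial>P) = 0"
  proof -
    have "(\<integral>\<omega>. U \<omega> * ?D \<omega> \<partial>P) = (\<integral>\<omega>. U \<omega> * complex_of_real (real_cond_exp P (F j) (D j) \<omega>) \<partial>P)"
      by (rule Fj.cond_exp_complex_intg[OF UF _ integrable_D]) (simp add: U1)
    also have "\<dots> = (\<integral>\<omega>. 0 \<partial>P)"
      using centred[of j] by (intro integral_cong_AE) auto
    finally show ?thesis by simp
  qed
  also have "(\<integral>\<omega>. U \<omega> * complex_of_real ((D j \<omega>)\<^sup>2) \<partial>P) = (\<integral>\<omega>. U \<omega> * complex_of_real (V \<omega>) \<partial>P)"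
    unfolding V_def by (rule Fj.cond_exp_complex_intg[OF UF _ square_integrable]) (simp add: U1)
  also have "\<dots> = \<tau>2 * m j + (\<integral>\<omega>. U \<omega> * complex_of_real (V \<omega> - \<tau>2) \<partial>P)"
  proof -
    have "integrable P (\<lambda>\<omega>. complex_of_real (V \<omega> - \<tau>2))"
      using intV by (intro integrable_of_real) auto
    from bd[OF this] have "(\<integral>\<omega>. \<tau>2 * U \<omega> + U \<omega> * complex_of_real (V \<omega> - \<tau>2) \<partial>P)
        = \<tau>2 * m j + (\<integral>\<omega>. U \<omega> * complex_of_real (V \<omega> - \<tau>2) \<partial>P)"
      using iU by (simp add: m_def U_def)
    then show ?thesis by (simp add: algebra_simps)
  qed
  finally have "m (Suc j) - (1 - h\<^sup>2 * \<tau>2 / 2) * m j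
      = (\<integral>\<omega>. U \<omega> * r \<omega> \<partial>P) - complex_of_real (h\<^sup>2 / 2) * (\<integral>\<omega>. U \<omega> * complex_of_real (V \<omega> - \<tau>2) \<partial>P)"
    by (simp add: algebra_simps)
  also have "cmod \<dots> \<le> cmod (\<integral>\<omega>. U \<omega> * r \<omega> \<partial>P) + h\<^sup>2 / 2 * cmod (\<integral>\<omega>. U \<omega> * complex_of_real (V \<omega> - \<tau>2) \<partial>P)"
    by (rule order_trans[OF norm_triangle_ineq4]) (simp add: norm_mult norm_divide norm_power)
  also have "h\<^sup>2 / 2 * cmod (\<integral>\<omega>. U \<omega> * complex_of_real (V \<omega> - \<tau>2) \<partial>P) \<le> h\<^sup>2 / 2 * (\<integral>\<omega>. \<bar>V \<omega> - \<tau>2\<bar> \<partial>P)"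
    by (intro mult_left_mono, rule order_trans[OF integral_norm_bound]) (simp_all add: norm_mult U1 del: of_real_diff)
  also have "cmod (\<integral>\<omega>. U \<omega> * r \<omega> \<partial>P) \<le> (\<integral>\<omega>. cmod (r \<omega>) \<partial>P)"
    by (rule order_trans[OF integral_norm_bound]) (simp add: norm_mult U1)
  also have "\<dots> \<le> (\<integral>\<omega>. \<epsilon> * h\<^sup>2 * (D j \<omega>)\<^sup>2 + h\<^sup>2 * ((D j \<omega>)\<^sup>2 * indicator {\<omega>. \<epsilon> < \<bar>h * D j \<omega>\<bar>} \<omega>) \<partial>P)"
  proof (rule integral_mono)
    show "integrable P (\<lambda>\<omega>. cmod (r \<omega>))" using ir by simp
    have "integrable P (\<lambda>\<omega>. (D j \<omega>)\<^sup>2 * indicator {\<omega>. \<epsilon> < \<bar>h * D j \<omega>\<bar>} \<omega>)"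
      by (rule Bochner_Integration.integrable_bound[OF square_integrable[of j]]) (auto split: split_indicator)
    then show "integrable P (\<lambda>\<omega>. \<epsilon> * h\<^sup>2 * (D j \<omega>)\<^sup>2 + h\<^sup>2 * ((D j \<omega>)\<^sup>2 * indicator {\<omega>. \<epsilon> < \<bar>h * D j \<omega>\<bar>} \<omega>))"
      using square_integrable by simp
    fix \<omega>
    define x where "x = h * D j \<omega>"
    have sum2: "(\<Sum>k\<le>2. (\<i> * x) ^ k / fact k) = 1 + \<i> * x - x\<^sup>2 / 2" for x :: real
      by (simp add: numeral_2_eq_2 power2_eq_square algebra_simps)
    have "cmod (r \<omega>) = cmod (iexp x - (\<Sum>k\<le>2. (\<i> * x) ^ k / fact k))"
      unfolding sum2 by (simp add: r_def x_def)
    then have "cmod (r \<omega>) \<le> \<bar>x\<bar> ^ 3 / 6" "cmod (r \<omega>) \<le> x\<^sup>2"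
      using iexp_approx1[of x 2] iexp_approx2[of x 2] by (simp_all add: fact_numeral eval_nat_numeral)
    moreover have "\<bar>x\<bar> ^ 3 / 6 \<le> \<epsilon> * x\<^sup>2" if "\<bar>x\<bar> \<le> \<epsilon>"
    proof -
      have "\<bar>x\<bar> ^ 3 = \<bar>x\<bar> * \<bar>x\<bar>\<^sup>2"
        by (simp only: power3_eq_cube power2_eq_square mult.assoc)
      then have "\<bar>x\<bar> ^ 3 = \<bar>x\<bar> * x\<^sup>2"
        by (simp only: power2_abs)
      moreover have "0 \<le> \<bar>x\<bar> * x\<^sup>2"
        by (rule mult_nonneg_nonneg) simp_all
      ultimately have "\<bar>x\<bar> ^ 3 / 6 \<le> \<bar>x\<bar> * x\<^sup>2" by linarith
      also have "\<dots> \<le> \<epsilon> * x\<^sup>2" using that by (intro mult_right_mono) auto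
      finally show ?thesis .
    qed
    moreover have "0 \<le> \<epsilon> * x\<^sup>2" using \<open>\<epsilon> \<ge> 0\<close> by simp
    ultimately have "cmod (r \<omega>) \<le> \<epsilon> * x\<^sup>2 + x\<^sup>2 * indicator {\<omega>. \<epsilon> < \<bar>h * D j \<omega>\<bar>} \<omega>"
      by (auto simp: x_def indicator_def not_less)
    then show "cmod (r \<omega>) \<le> \<epsilon> * h\<^sup>2 * (D j \<omega>)\<^sup>2 + h\<^sup>2 * ((D j \<omega>)\<^sup>2 * indicator {\<omega>. \<epsilon> < \<bar>h * D j \<omega>\<bar>} \<omega>)"
      by (simp add: x_def power_mult_distrib algebra_simps)
  qed
  also have "\<dots> = \<epsilon> * h\<^sup>2 * (\<integral>\<omega>. (D j \<omega>)\<^sup>2 \<partial>P)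
      + h\<^sup>2 * (\<integral>\<omega>. (D j \<omega>)\<^sup>2 * indicator {\<omega>. \<epsilon> < \<bar>h * D j \<omega>\<bar>} \<omega> \<partial>P)"
  proof -
    have "integrable P (\<lambda>\<omega>. (D j \<omega>)\<^sup>2 * indicator {\<omega>. \<epsilon> < \<bar>h * D j \<omega>\<bar>} \<omega>)"
      by (rule Bochner_Integration.integrable_bound[OF square_integrable[of j]]) (auto split: split_indicator)
    then show ?thesis using square_integrable by simp
  qed
  finally show ?thesis
    by (simp add: V_def algebra_simps)
qed

text \<open>A martingale central limit theorem, in terms of characteristic functions. The conditional variances
  converge in mean to a constant and the unconditional Lindeberg condition holds. By \<open>char_step\<close>, the
  characteristic function \<open>m K K\<close> of the normalized sum differs from \<open>(1 - t\<^sup>2 \<tau>2 / (2 K)) ^ K\<close> by at most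
  the sum of the \<open>K\<close> one-step errors, since each factor has modulus at most one.\<close>
theorem char_partial_sum_tendsto:
  fixes t \<tau>2 :: real
  defines "v \<equiv> \<lambda>j. \<integral>\<omega>. \<bar>real_cond_exp P (F j) (\<lambda>\<omega>. (D j \<omega>)\<^sup>2) \<omega> - \<tau>2\<bar> \<partial>P"
    and "l \<equiv> \<lambda>\<epsilon> K j. \<integral>\<omega>. (D j \<omega>)\<^sup>2 * indicator {\<omega>. \<epsilon> * sqrt (real K) < \<bar>D j \<omega>\<bar>} \<omega> \<partial>P"
  assumes "\<tau>2 \<ge> 0" and v: "v \<longlonglongrightarrow> 0"
    and lindeberg: "\<And>\<epsilon>. \<epsilon> > 0 \<Longrightarrow> (\<lambda>K. (1 / real K) * (\<Sum>j<K. l \<epsilon> K j)) \<longlonglongrightarrow> 0"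
  shows "(\<lambda>K. \<integral>\<omega>. iexp (t / sqrt (real K) * (\<Sum>i<K. D i \<omega>)) \<partial>P) \<longlonglongrightarrow> complex_of_real (exp (- (t\<^sup>2 * \<tau>2 / 2)))"
proof (cases "t = 0")
  case True
  then show ?thesis by (simp add: prob_space)
next
  case False
  define m where "m = (\<lambda>K k. (\<integral>\<omega>. iexp (t / sqrt (real K) * (\<Sum>i<k. D i \<omega>)) \<partial>P) :: complex)"
  define a where "a = (\<lambda>K::nat. t\<^sup>2 * \<tau>2 / (2 * real K))"
  define d where "d = (\<lambda>j. \<integral>\<omega>. (D j \<omega>)\<^sup>2 \<partial>P)"
  define A where "A = (\<lambda>K. (1 / real K) * (\<Sum>j<K. v j))"
  define L where "L = (\<lambda>\<epsilon> K. (1 / real K) * (\<Sum>j<K. l \<epsilon> K j))"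
  have A: "A \<longlonglongrightarrow> 0"
    using cesaro_mean_tendsto[OF v] by (simp add: A_def)
  have d: "d j \<le> \<tau>2 + v j" for j
  proof -
    interpret Fj: sigma_finite_subalgebra P "F j" by (rule sigma_finite_F)
    note V = Fj.real_cond_exp_int[OF square_integrable[of j]]
    have "d j - \<tau>2 = (\<integral>\<omega>. real_cond_exp P (F j) (\<lambda>\<omega>. (D j \<omega>)\<^sup>2) \<omega> - \<tau>2 \<partial>P)"
      using V by (simp add: d_def prob_space)
    also have "\<dots> \<le> v j"
      unfolding v_def by (rule integral_mono) (use V in auto)
    finally show ?thesis by simp
  qed
  have bound: "cmod (m K K - (1 - a K) ^ K) \<le> t\<^sup>2 / 2 * A K + \<bar>t\<bar> ^ 3 * \<epsilon> * (\<tau>2 + A K) + t\<^sup>2 * L \<epsilon> K"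
    if K: "K > 0" "a K \<le> 1" and "\<epsilon> > 0" for K \<epsilon>
  proof -
    let ?h = "t / sqrt (real K)"
    have h2: "?h\<^sup>2 = t\<^sup>2 / real K" by (simp add: power_divide)
    have "a K \<ge> 0" using \<open>\<tau>2 \<ge> 0\<close> by (simp add: a_def)
    define \<delta> where "\<delta> = (\<lambda>j. t\<^sup>2 / real K * (v j / 2 + \<bar>t\<bar> * \<epsilon> * d j + l \<epsilon> K j))"
    have step: "cmod (m K (Suc j) - (1 - a K) * m K j) \<le> \<delta> j" for j
    proof -
      have I: "{\<omega>. \<bar>t\<bar> * \<epsilon> < \<bar>?h * D j \<omega>\<bar>} = {\<omega>. \<epsilon> * sqrt (real K) < \<bar>D j \<omega>\<bar>}"
        using False K by (auto simp: abs_mult field_simps)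
      have aK: "?h\<^sup>2 * \<tau>2 / 2 = a K" unfolding h2 by (simp add: a_def)
      have "0 \<le> \<bar>t\<bar> * \<epsilon>" "?h\<^sup>2 \<noteq> 0" using \<open>\<epsilon> > 0\<close> False K by auto
      from char_step[OF this, of j \<tau>2]
      have "cmod (m K (Suc j) - (1 - a K) * m K j) \<le> ?h\<^sup>2 / 2 * v j + \<bar>t\<bar> * \<epsilon> * ?h\<^sup>2 * d j + ?h\<^sup>2 * l \<epsilon> K j"
        unfolding I aK m_def v_def d_def l_def .
      also have "\<dots> = \<delta> j"
        unfolding h2 \<delta>_def using K by (simp add: field_simps)
      finally show ?thesis .
    qed
    have "cmod (m K k - (1 - a K) ^ k) \<le> (\<Sum>j<k. \<delta> j)" for k
    proof (induction k)
      case 0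
      then show ?case by (simp add: m_def prob_space)
    next
      case (Suc k)
      have "m K (Suc k) - (1 - a K) ^ Suc k
          = (m K (Suc k) - (1 - a K) * m K k) + complex_of_real (1 - a K) * (m K k - (1 - a K) ^ k)"
        by (simp add: algebra_simps)
      also have "cmod \<dots> \<le> \<delta> k + cmod (complex_of_real (1 - a K)) * cmod (m K k - (1 - a K) ^ k)"
        using step[of k] by (intro order_trans[OF norm_triangle_ineq] add_mono) (simp_all add: norm_mult)
      also have "cmod (complex_of_real (1 - a K)) \<le> 1"
        unfolding norm_of_real using \<open>a K \<ge> 0\<close> \<open>a K \<le> 1\<close> by simp
      finally show ?case
        using Suc.IH by (simp add: mult_right_mono)
    qed
    also have "(\<Sum>j<K. \<delta> j) \<le> (\<Sum>j<K. t\<^sup>2 / real K * (v j / 2 + \<bar>t\<bar> * \<epsilon> * (\<tau>2 + v j) + l \<epsilon> K j))"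
      unfolding \<delta>_def using d \<open>\<epsilon> > 0\<close> by (intro sum_mono mult_left_mono add_mono) auto
    also have "\<dots> = t\<^sup>2 / real K * ((\<Sum>j<K. v j) / 2 + \<bar>t\<bar> * \<epsilon> * (real K * \<tau>2 + (\<Sum>j<K. v j)) + (\<Sum>j<K. l \<epsilon> K j))"
      by (simp add: sum_distrib_left[symmetric] sum.distrib sum_divide_distrib[symmetric])
    also have "\<dots> = t\<^sup>2 / 2 * A K + (\<bar>t\<bar> * t\<^sup>2) * \<epsilon> * (\<tau>2 + A K) + t\<^sup>2 * L \<epsilon> K"
      using K by (simp add: A_def L_def field_simps)
    also have "\<bar>t\<bar> * t\<^sup>2 = \<bar>t\<bar> ^ 3"
      by (simp add: power3_eq_cube power2_eq_square)
    finally show ?thesis .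
  qed
  have "(\<lambda>K. m K K - complex_of_real ((1 - a K) ^ K)) \<longlonglongrightarrow> 0"
  proof (rule tendstoI)
    fix r :: real assume "r > 0"
    define x where "x = \<bar>t\<bar> ^ 3 * \<tau>2"
    have "x \<ge> 0" using \<open>\<tau>2 \<ge> 0\<close> by (simp add: x_def)
    \<comment> \<open>the part of the error that does not vanish with \<open>K\<close> is \<open>x * \<epsilon>\<close>\<close>
    define \<epsilon> where "\<epsilon> = r / 2 / (x + 1)"
    have "\<epsilon> > 0" using \<open>r > 0\<close> \<open>x \<ge> 0\<close> by (simp add: \<epsilon>_def)
    have "x * \<epsilon> \<le> (x + 1) * \<epsilon>" using \<open>\<epsilon> > 0\<close> by (intro mult_right_mono) auto
    also have "\<dots> = r / 2"
      unfolding \<epsilon>_def by (rule nonzero_mult_div_cancel_left[of "x + 1", unfolded times_divide_eq_right[symmetric]]) (use \<open>x \<ge> 0\<close> in linarith)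
    also have "\<dots> < r" using \<open>r > 0\<close> by simp
    finally have "x * \<epsilon> < r" .
    have "(\<lambda>K. t\<^sup>2 / 2 * A K + \<bar>t\<bar> ^ 3 * \<epsilon> * (\<tau>2 + A K) + t\<^sup>2 * L \<epsilon> K)
        \<longlonglongrightarrow> t\<^sup>2 / 2 * 0 + \<bar>t\<bar> ^ 3 * \<epsilon> * (\<tau>2 + 0) + t\<^sup>2 * 0"
      using lindeberg[OF \<open>\<epsilon> > 0\<close>] unfolding L_def by (intro tendsto_intros A)
    then have "\<forall>\<^sub>F K in sequentially. t\<^sup>2 / 2 * A K + \<bar>t\<bar> ^ 3 * \<epsilon> * (\<tau>2 + A K) + t\<^sup>2 * L \<epsilon> K < r"
    proof (rule order_tendstoD(2))
      show "t\<^sup>2 / 2 * 0 + \<bar>t\<bar> ^ 3 * \<epsilon> * (\<tau>2 + 0) + t\<^sup>2 * 0 < r"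
        using \<open>x * \<epsilon> < r\<close> by (simp add: x_def mult.commute mult.left_commute)
    qed
    moreover have "\<forall>\<^sub>F K in sequentially. a K \<le> 1"
      unfolding a_def by real_asymp
    ultimately show "\<forall>\<^sub>F K in sequentially. dist (m K K - complex_of_real ((1 - a K) ^ K)) 0 < r"
      using eventually_gt_at_top[of 0]
    proof eventually_elim
      case (elim K)
      from bound[OF elim(3,2) \<open>\<epsilon> > 0\<close>] elim(1)
      have "cmod (m K K - (1 - a K) ^ K) < r" by (rule le_less_trans)
      then show ?case by (simp add: dist_norm)
    qed
  qed
  moreover have "(\<lambda>K. complex_of_real ((1 - a K) ^ K)) \<longlonglongrightarrow> complex_of_real (exp (- (t\<^sup>2 * \<tau>2 / 2)))"
  proof (rule tendsto_of_real)
    show "(\<lambda>K. (1 - a K) ^ K) \<longlonglongrightarrow> exp (- (t\<^sup>2 * \<tau>2 / 2))"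
      using tendsto_exp_limit_sequentially[of "- (t\<^sup>2 * \<tau>2 / 2)"] by (simp add: a_def)
  qed
  ultimately have "(\<lambda>K. (m K K - complex_of_real ((1 - a K) ^ K)) + complex_of_real ((1 - a K) ^ K))
      \<longlonglongrightarrow> 0 + complex_of_real (exp (- (t\<^sup>2 * \<tau>2 / 2)))"
    by (rule tendsto_add)
  then show ?thesis by (simp add: m_def)
qed

end


section \<open>D-optimal saturated designs\<close>

text \<open>The rank one matrix \<open>v v\<^sup>T\<close>.\<close>
definition outer :: "real^'p \<Rightarrow> real^'p^'p" where
  "outer v = (\<chi> i j. v $ i * v $ j)"

lemma sum_outer_eq: "(\<Sum>j\<in>UNIV. outer (G $ j)) = transpose G ** G" for G :: "real^'p^'p"
  by (simp add: vec_eq_iff outer_def matrix_matrix_mult_def transpose_def)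

lemma sq_det_eq: "sq_det f \<theta> z = (det (\<chi> j. f \<theta> (z j)))\<^sup>2"
proof -
  have "(\<chi> i j. f \<theta> (z j) $ i) = transpose (\<chi> j. f \<theta> (z j))"
    by (simp add: transpose_def)
  then show ?thesis by (simp add: sq_det_def det_transpose)
qed

lemma det_weighted_sum_outer:
  fixes G :: "real^'p^'p"
  shows "det (\<Sum>j\<in>UNIV. w j *\<^sub>R outer (G $ j)) = (\<Prod>j\<in>UNIV. w j) * (det G)\<^sup>2"
proof -
  have "(\<Sum>j\<in>UNIV. w j *\<^sub>R outer (G $ j)) = transpose G ** (\<chi> j. w j *s G $ j)"
    by (simp add: vec_eq_iff outer_def matrix_matrix_mult_def transpose_def mult_ac)
  then show ?thesis
    by (simp add: det_mul det_transpose det_rows_mul power2_eq_square)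
qed

lemma prod_le_of_sum_eq_1:
  fixes w :: "'a \<Rightarrow> real"
  assumes "finite S" "\<And>i. i \<in> S \<Longrightarrow> w i \<ge> 0" "(\<Sum>i\<in>S. w i) = 1"
  shows "(\<Prod>i\<in>S. w i) \<le> (1 / card S) ^ card S"
proof -
  have "S \<noteq> {}" using assms(3) by auto
  then have c: "card S > 0" using assms(1) by (simp add: card_gt_0_iff)
  have nn: "(\<Prod>i\<in>S. w i) \<ge> 0" using assms(2) by (simp add: prod_nonneg)
  have "(\<Prod>i\<in>S. w i) powr (1 / card S) \<le> (\<Sum>i\<in>S. w i / card S)"
    using arith_geom_mean[OF assms(1) \<open>S \<noteq> {}\<close> assms(2)] by simp
  also have "\<dots> = 1 / card S"
    using assms(3) by (simp add: sum_divide_distrib[symmetric])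
  finally have "((\<Prod>i\<in>S. w i) powr (1 / card S)) ^ card S \<le> (1 / card S) ^ card S"
    by (intro power_mono) auto
  also have "((\<Prod>i\<in>S. w i) powr (1 / card S)) ^ card S = (\<Prod>i\<in>S. w i)"
    using c nn by (cases "(\<Prod>i\<in>S. w i) = 0") (auto simp: powr_powr powr_realpow[symmetric] powr_power)
  finally show ?thesis .
qed

lemma info_matrix_bij:
  fixes x :: "'p::finite \<Rightarrow> 'x"
  assumes "bij_betw x UNIV (set_pmf \<eta>)"
  shows "info_matrix f \<eta> \<theta> = (\<Sum>j\<in>UNIV. pmf \<eta> (x j) *\<^sub>R outer (f \<theta> (x j)))"
  unfolding info_matrix_def outer_def
  by (rule sum.reindex_bij_betw[OF assms, symmetric])

text \<open>The determinant of the information matrix of a saturated design is the product of its weights times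
  the squared determinant of the regression vectors at its support points. By the inequality of the
  arithmetic and geometric means the uniform weights are best, so the uniform design on points that
  maximize the squared determinant is D-optimal among the saturated designs.\<close>
lemma
  fixes f :: "real^'p \<Rightarrow> 'x \<Rightarrow> real^'p" and \<X> :: "'x set"
  assumes max: "is_arg_max (sq_det f \<theta>) (\<lambda>z. \<forall>j. z j \<in> \<X>) z" and pos: "sq_det f \<theta> z > 0"
  defines "\<eta> \<equiv> pmf_of_set (range z)"
  shows D_optimal_uniform: "D_optimal_saturated \<X> f \<theta> \<eta>"
    and info_matrix_uniform: "info_matrix f \<eta> \<theta> = (1 / CARD('p)) *\<^sub>R (\<Sum>j\<in>UNIV. outer (f \<theta> (z j)))"
proof -
  have zX: "z j \<in> \<X>" and zmax: "\<And>y. (\<forall>j. y j \<in> \<X>) \<Longrightarrow> sq_det f \<theta> y \<le> sq_det f \<theta> z" for j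
    using max by (auto simp: is_arg_max_linorder)
  have inj: "inj z"
  proof (rule injI, rule ccontr)
    fix i j assume "z i = z j" "i \<noteq> j"
    then have "det (\<chi> j. f \<theta> (z j)) = 0"
      by (intro det_identical_rows[of i j]) (auto simp: row_def)
    with pos show False by (simp add: sq_det_eq)
  qed
  have set: "set_pmf \<eta> = range z" by (simp add: \<eta>_def)
  have card: "card (range z) = CARD('p)" using inj by (simp add: card_image)
  have "bij_betw z UNIV (set_pmf \<eta>)" using inj by (simp add: bij_betw_def set)
  from info_matrix_bij[OF this]
  show info: "info_matrix f \<eta> \<theta> = (1 / CARD('p)) *\<^sub>R (\<Sum>j\<in>UNIV. outer (f \<theta> (z j)))"
    by (simp add: \<eta>_def card scaleR_sum_right)
  show "D_optimal_saturated \<X> f \<theta> \<eta>"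
    unfolding D_optimal_saturated_def is_arg_max_linorder
  proof (intro conjI allI impI)
    show "saturated_design TYPE('p) \<X> \<eta>"
      using zX by (auto simp: saturated_design_def is_design_def set card)
    fix \<zeta> assume "saturated_design TYPE('p) \<X> \<zeta>"
    then have \<zeta>: "finite (set_pmf \<zeta>)" "set_pmf \<zeta> \<subseteq> \<X>" "card (set_pmf \<zeta>) = CARD('p)"
      by (auto simp: saturated_design_def is_design_def)
    then obtain x :: "'p \<Rightarrow> 'x" where x: "bij_betw x UNIV (set_pmf \<zeta>)"
      using finite_same_card_bij[of "UNIV :: 'p set" "set_pmf \<zeta>"] by auto
    have "(\<Sum>j\<in>UNIV. pmf \<zeta> (x j)) = (\<Sum>a\<in>set_pmf \<zeta>. pmf \<zeta> a)"
      by (rule sum.reindex_bij_betw[OF x])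
    also have "\<dots> = 1" by (rule sum_pmf_eq_1) (use \<zeta> in auto)
    finally have "(\<Prod>j\<in>UNIV. pmf \<zeta> (x j)) \<le> (1 / CARD('p)) ^ CARD('p)"
      by (intro prod_le_of_sum_eq_1) auto
    moreover have "sq_det f \<theta> x \<le> sq_det f \<theta> z"
      using x \<zeta>(2) by (intro zmax) (auto simp: bij_betw_def)
    moreover have "det (info_matrix f \<zeta> \<theta>) = (\<Prod>j\<in>UNIV. pmf \<zeta> (x j)) * sq_det f \<theta> x"
      using det_weighted_sum_outer[of "\<lambda>j. pmf \<zeta> (x j)" "\<chi> j. f \<theta> (x j)"]
      by (simp add: info_matrix_bij[OF x] sq_det_eq)
    moreover have "det (info_matrix f \<eta> \<theta>) = (1 / CARD('p)) ^ CARD('p) * sq_det f \<theta> z"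
      using det_weighted_sum_outer[of "\<lambda>j::'p. 1 / CARD('p)" "\<chi> j. f \<theta> (z j)"]
      by (simp add: info sq_det_eq scaleR_sum_right)
    ultimately show "det (info_matrix f \<zeta> \<theta>) \<le> det (info_matrix f \<eta> \<theta>)"
      by (auto intro!: mult_mono simp: sq_det_def)
  qed
qed

lemma D_optimal_saturated_info_eq:
  fixes f :: "real^'p \<Rightarrow> 'x \<Rightarrow> real^'p" and \<X> :: "'x set"
  assumes max: "is_arg_max (sq_det f \<theta>) (\<lambda>z. \<forall>j. z j \<in> \<X>) z" and pos: "sq_det f \<theta> z > 0"
    and SD: "\<And>\<eta> \<eta>'. D_optimal_saturated \<X> f \<theta> \<eta> \<Longrightarrow> D_optimal_saturated \<X> f \<theta> \<eta>' \<Longrightarrow>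
      info_matrix f \<eta> \<theta> = info_matrix f \<eta>' \<theta>"
  shows "D_optimal_saturated_info \<X> f \<theta> = (1 / CARD('p)) *\<^sub>R (\<Sum>j\<in>UNIV. outer (f \<theta> (z j)))"
  unfolding D_optimal_saturated_info_def info_matrix_uniform[OF max pos, symmetric]
proof (rule the_equality)
  show "\<exists>\<eta>. D_optimal_saturated \<X> f \<theta> \<eta> \<and> info_matrix f (pmf_of_set (range z)) \<theta> = info_matrix f \<eta> \<theta>"
    using D_optimal_uniform[OF max pos] by blast
  show "M = info_matrix f (pmf_of_set (range z)) \<theta>"
    if "\<exists>\<eta>. D_optimal_saturated \<X> f \<theta> \<eta> \<and> M = info_matrix f \<eta> \<theta>" for M
    using that SD[OF _ D_optimal_uniform[OF max pos]] by blast
qed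

lemma exists_sq_det_pos:
  fixes f :: "real^'p \<Rightarrow> 'x \<Rightarrow> real^'p"
  assumes "span (f \<theta> ` \<X>) = UNIV"
  obtains z where "\<And>j. z j \<in> \<X>" "sq_det f \<theta> z > 0"
proof -
  obtain B where B: "B \<subseteq> f \<theta> ` \<X>" "independent B" "f \<theta> ` \<X> \<subseteq> span B"
    by (rule maximal_independent_subset)
  then have spB: "span B = UNIV"
    using assms by (metis span_mono span_span top.extremum_uniqueI)
  have "card B = CARD('p)"
    using basis_card_eq_dim[of B UNIV] B(2) spB by (simp add: dim_UNIV)
  moreover have "finite B" using B(2) by (rule independent_imp_finite)
  ultimately obtain b :: "'p \<Rightarrow> real^'p" where b: "bij_betw b UNIV B"
    using finite_same_card_bij[of "UNIV :: 'p set" B] by auto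
  then have "b j \<in> f \<theta> ` \<X>" for j
    using B(1) by (auto simp: bij_betw_def)
  then have "\<forall>j. \<exists>x. x \<in> \<X> \<and> f \<theta> x = b j"
    unfolding image_iff by metis
  then obtain z where z: "\<And>j. z j \<in> \<X>" "\<And>j. f \<theta> (z j) = b j" by metis
  have "rows (\<chi> j. b j) = B"
    using b by (auto simp: rows_def row_def bij_betw_def)
  then have "invertible (\<chi> j. b j)"
    using spB by (metis matrix_left_invertible_span_rows invertible_left_inverse)
  then have "sq_det f \<theta> z > 0"
    by (simp add: sq_det_eq z invertible_det_nz)
  with z(1) that show ?thesis by blast
qed

lemma compact_rows:
  fixes S :: "(real^'p) set"
  assumes "compact S"
  shows "compact {G :: real^'p^'p. \<forall>j. G $ j \<in> S}"
proof -
  have "{G :: real^'p^'p. \<forall>j. G $ j \<in> S} = (\<Inter>j. (\<lambda>G. G $ j) -` S)" by auto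
  moreover have "closed ((\<lambda>G :: real^'p^'p. G $ j) -` S)" for j
    using compact_imp_closed[OF assms] by (intro continuous_closed_vimage) (auto intro!: continuous_intros)
  ultimately have "closed {G :: real^'p^'p. \<forall>j. G $ j \<in> S}" by (simp add: closed_INT)
  moreover obtain b where b: "\<And>x. x \<in> S \<Longrightarrow> norm x \<le> b"
    using compact_imp_bounded[OF assms] by (auto simp: bounded_iff)
  have "norm G \<le> (\<Sum>j\<in>(UNIV :: 'p set). b)" if "\<forall>j. G $ j \<in> S" for G :: "real^'p^'p"
  proof -
    have "norm G \<le> (\<Sum>j\<in>UNIV. norm (G $ j))"
      by (subst norm_vec_def, rule L2_set_le_sum) simp
    also have "\<dots> \<le> (\<Sum>j\<in>(UNIV :: 'p set). b)"
      using that b by (intro sum_mono) auto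
    finally show ?thesis .
  qed
  then have "bounded {G :: real^'p^'p. \<forall>j. G $ j \<in> S}"
    unfolding bounded_iff by blast
  ultimately show ?thesis by (simp add: compact_eq_bounded_closed)
qed

lemma tendsto_det:
  fixes G :: "'b \<Rightarrow> real^'p^'p"
  assumes "(G \<longlongrightarrow> L) F"
  shows "((\<lambda>k. det (G k)) \<longlongrightarrow> det L) F"
  unfolding det_def by (intro tendsto_intros assms)

lemma tendsto_outer:
  assumes "(v \<longlongrightarrow> l) F"
  shows "((\<lambda>k. outer (v k)) \<longlongrightarrow> outer l) F"
  unfolding outer_def by (intro tendsto_vec_lambda tendsto_intros assms)

lemma exists_D_optimal_points:
  fixes f :: "real^'p \<Rightarrow> 'x::metric_space \<Rightarrow> real^'p"
  assumes "compact \<X>" "continuous_on \<X> (f \<theta>)" "span (f \<theta> ` \<X>) = UNIV"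
  obtains z where "is_arg_max (sq_det f \<theta>) (\<lambda>z. \<forall>j. z j \<in> \<X>) z" "sq_det f \<theta> z > 0"
proof -
  let ?K = "{G :: real^'p^'p. \<forall>j. G $ j \<in> f \<theta> ` \<X>}"
  obtain y where y: "\<And>j. y j \<in> \<X>" "sq_det f \<theta> y > 0"
    using exists_sq_det_pos[of f \<theta> \<X>] assms(3) by blast
  have "compact ?K"
    by (intro compact_rows compact_continuous_image assms)
  moreover have "(\<chi> j. f \<theta> (y j)) \<in> ?K" using y by auto
  moreover have "continuous_on ?K (\<lambda>G. (det G)\<^sup>2)"
    unfolding continuous_on_def by (intro ballI tendsto_power tendsto_det tendsto_ident_at)
  ultimately obtain G where G: "G \<in> ?K" "\<And>H. H \<in> ?K \<Longrightarrow> (det H)\<^sup>2 \<le> (det G)\<^sup>2"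
    using continuous_attains_sup[of ?K "\<lambda>G. (det G)\<^sup>2"] by blast
  then have "\<forall>j. G $ j \<in> f \<theta> ` \<X>" by simp
  then have "\<forall>j. \<exists>x. x \<in> \<X> \<and> f \<theta> x = G $ j" unfolding image_iff by metis
  then obtain z where z: "\<And>j. z j \<in> \<X>" "\<And>j. f \<theta> (z j) = G $ j" by metis
  have "sq_det f \<theta> x \<le> sq_det f \<theta> z" if "\<forall>j. x j \<in> \<X>" for x
    using G(2)[of "\<chi> j. f \<theta> (x j)"] that by (simp add: sq_det_eq z)
  with z(1) have "is_arg_max (sq_det f \<theta>) (\<lambda>z. \<forall>j. z j \<in> \<X>) z"
    by (auto simp: is_arg_max_linorder)
  moreover from this y have "sq_det f \<theta> z > 0"
    by (auto simp: is_arg_max_linorder intro: less_le_trans)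
  ultimately show ?thesis by (rule that)
qed

lemma uniform_limit_in_parameter:
  fixes f :: "'t::metric_space \<Rightarrow> 'x::metric_space \<Rightarrow> 'c::metric_space"
  assumes "compact \<X>" "compact \<Theta>" "continuous_on (\<X> \<times> \<Theta>) (\<lambda>(x, \<theta>). f \<theta> x)" "\<theta>\<^sub>0 \<in> \<Theta>" "\<epsilon> > 0"
  obtains \<delta> where "\<delta> > 0" "\<And>x \<theta>. x \<in> \<X> \<Longrightarrow> \<theta> \<in> \<Theta> \<Longrightarrow> dist \<theta> \<theta>\<^sub>0 < \<delta> \<Longrightarrow> dist (f \<theta> x) (f \<theta>\<^sub>0 x) < \<epsilon>"
proof -
  have "uniformly_continuous_on (\<X> \<times> \<Theta>) (\<lambda>(x, \<theta>). f \<theta> x)"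
    by (intro compact_uniformly_continuous assms compact_Times)
  then obtain \<delta> where "\<delta> > 0" and \<delta>: "\<And>u v. u \<in> \<X> \<times> \<Theta> \<Longrightarrow> v \<in> \<X> \<times> \<Theta> \<Longrightarrow> dist v u < \<delta> \<Longrightarrow>
      dist (case v of (x, \<theta>) \<Rightarrow> f \<theta> x) (case u of (x, \<theta>) \<Rightarrow> f \<theta> x) < \<epsilon>"
    using \<open>\<epsilon> > 0\<close> unfolding uniformly_continuous_on_def by metis
  show ?thesis
  proof (rule that[OF \<open>\<delta> > 0\<close>])
    fix x \<theta> assume "x \<in> \<X>" "\<theta> \<in> \<Theta>" "dist \<theta> \<theta>\<^sub>0 < \<delta>"
    then show "dist (f \<theta> x) (f \<theta>\<^sub>0 x) < \<epsilon>"
      using \<delta>[of "(x, \<theta>\<^sub>0)" "(x, \<theta>)"] \<open>\<theta>\<^sub>0 \<in> \<Theta>\<close> by (simp add: dist_Pair_Pair)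
  qed
qed

text \<open>The information matrices of the adaptive blocks converge. Otherwise, along a subsequence, the
  matrices of regression vectors at \<open>\<theta>\<^sub>0\<close> converge, by compactness, while the information stays away from
  the claimed limit. As the estimates converge to \<open>\<theta>\<^sub>0\<close>, uniformly in the design point the regression
  vectors at the estimates approach those at \<open>\<theta>\<^sub>0\<close>, so the limit matrix comes from points that maximize
  the squared determinant at \<open>\<theta>\<^sub>0\<close>, and all of these have the same information.\<close>
theorem information_of_adaptive_blocks:
  fixes f :: "real^'p \<Rightarrow> 'x::metric_space \<Rightarrow> real^'p"
  assumes X: "compact \<X>" and T: "compact \<Theta>" and cont: "continuous_on (\<X> \<times> \<Theta>) (\<lambda>(x, \<theta>). f \<theta> x)"
    and span: "span (f \<theta>\<^sub>0 ` \<X>) = UNIV" and "\<theta>\<^sub>0 \<in> \<Theta>"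
    and SD: "\<And>\<eta> \<eta>'. D_optimal_saturated \<X> f \<theta>\<^sub>0 \<eta> \<Longrightarrow> D_optimal_saturated \<X> f \<theta>\<^sub>0 \<eta>' \<Longrightarrow>
      info_matrix f \<eta> \<theta>\<^sub>0 = info_matrix f \<eta>' \<theta>\<^sub>0"
    and est: "\<And>k. est k \<in> \<Theta>" "est \<longlonglongrightarrow> \<theta>\<^sub>0"
    and z: "\<And>k. is_arg_max (sq_det f (est k)) (\<lambda>z. \<forall>j. z j \<in> \<X>) (z k)"
  shows "(\<lambda>k. \<Sum>j\<in>UNIV. outer (f \<theta>\<^sub>0 (z k j))) \<longlonglongrightarrow> real CARD('p) *\<^sub>R D_optimal_saturated_info \<X> f \<theta>\<^sub>0"
proof (rule tendstoI, rule ccontr)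
  let ?M = "real CARD('p) *\<^sub>R D_optimal_saturated_info \<X> f \<theta>\<^sub>0"
  let ?K = "{G :: real^'p^'p. \<forall>j. G $ j \<in> f \<theta>\<^sub>0 ` \<X>}"
  \<comment> \<open>the rows of \<open>G k\<close> and \<open>G' k\<close> are the regression vectors at \<open>\<theta>\<^sub>0\<close> and at \<open>est k\<close>\<close>
  define G where "G = (\<lambda>k. (\<chi> j. f \<theta>\<^sub>0 (z k j)) :: real^'p^'p)"
  define G' where "G' = (\<lambda>k. (\<chi> j. f (est k) (z k j)) :: real^'p^'p)"
  fix \<epsilon> :: real assume "\<epsilon> > 0"
    and "\<not> (\<forall>\<^sub>F k in sequentially. dist (\<Sum>j\<in>UNIV. outer (f \<theta>\<^sub>0 (z k j))) ?M < \<epsilon>)"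
  from not_eventually_sequentiallyD[OF this(2)]
  obtain r :: "nat \<Rightarrow> nat" where r: "strict_mono r"
    and far: "\<And>k. \<epsilon> \<le> dist (\<Sum>j\<in>UNIV. outer (f \<theta>\<^sub>0 (z (r k) j))) ?M"
    by (auto simp: not_less)
  have zX: "z k j \<in> \<X>" and zmax: "\<And>y. (\<forall>j. y j \<in> \<X>) \<Longrightarrow> sq_det f (est k) y \<le> sq_det f (est k) (z k)" for k j
    using z by (auto simp: is_arg_max_linorder)
  have unif: "\<forall>\<^sub>F k in sequentially. \<forall>x\<in>\<X>. dist (f (est k) x) (f \<theta>\<^sub>0 x) < e" if "e > 0" for e
  proof -
    obtain \<delta> where "\<delta> > 0" and \<delta>: "\<And>x \<theta>. x \<in> \<X> \<Longrightarrow> \<theta> \<in> \<Theta> \<Longrightarrow> dist \<theta> \<theta>\<^sub>0 < \<delta> \<Longrightarrow> dist (f \<theta> x) (f \<theta>\<^sub>0 x) < e"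
      using uniform_limit_in_parameter[OF X T cont \<open>\<theta>\<^sub>0 \<in> \<Theta>\<close> \<open>e > 0\<close>] by blast
    have "\<forall>\<^sub>F k in sequentially. dist (est k) \<theta>\<^sub>0 < \<delta>"
      using est(2) \<open>\<delta> > 0\<close> by (rule tendstoD)
    then show ?thesis
      by eventually_elim (use \<delta> est(1) in blast)
  qed
  have pt: "(\<lambda>k. f (est k) (y k) - f \<theta>\<^sub>0 (y k)) \<longlonglongrightarrow> 0" if "\<And>k. y k \<in> \<X>" for y
  proof (rule tendstoI)
    fix e :: real assume "e > 0"
    from unif[OF this] show "\<forall>\<^sub>F k in sequentially. dist (f (est k) (y k) - f \<theta>\<^sub>0 (y k)) 0 < e"
      by eventually_elim (use that in \<open>auto simp: dist_norm\<close>)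
  qed
  have diff: "(\<lambda>k. G' k - G k) \<longlonglongrightarrow> 0"
  proof (rule vec_tendstoI)
    fix i
    show "(\<lambda>k. (G' k - G k) $ i) \<longlonglongrightarrow> 0 $ i"
      using pt[of "\<lambda>k. z k i", OF zX] by (simp add: G_def G'_def)
  qed
  have "compact ?K"
    using cont \<open>\<theta>\<^sub>0 \<in> \<Theta>\<close>
    by (intro compact_rows compact_continuous_image X continuous_on_compose2[OF cont, of _ "\<lambda>x. (x, \<theta>\<^sub>0)", simplified])
       (auto intro!: continuous_intros)
  moreover have "\<forall>k. (G \<circ> r) k \<in> ?K" using zX by (auto simp: G_def)
  ultimately obtain l s where l: "l \<in> ?K" and s: "strict_mono (s :: nat \<Rightarrow> nat)" and lim: "((G \<circ> r) \<circ> s) \<longlonglongrightarrow> l"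
    unfolding compact_def by blast
  define q where "q = r \<circ> s"
  have q: "strict_mono q" unfolding q_def using r s by (rule strict_mono_o)
  have Gq: "(\<lambda>k. G (q k)) \<longlonglongrightarrow> l"
    using lim by (simp add: q_def comp_def)
  have "(\<lambda>k. (G' (q k) - G (q k)) + G (q k)) \<longlonglongrightarrow> 0 + l"
    by (intro tendsto_add Gq LIMSEQ_subseq_LIMSEQ[OF diff q, unfolded comp_def])
  then have G'q: "(\<lambda>k. G' (q k)) \<longlonglongrightarrow> l" by simp
  from l have "\<forall>j. l $ j \<in> f \<theta>\<^sub>0 ` \<X>" by simp
  then have "\<forall>j. \<exists>x. x \<in> \<X> \<and> f \<theta>\<^sub>0 x = l $ j" unfolding image_iff by metis
  then obtain y where y: "\<And>j. y j \<in> \<X>" "\<And>j. f \<theta>\<^sub>0 (y j) = l $ j" by metis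
  have "sq_det f \<theta>\<^sub>0 x \<le> sq_det f \<theta>\<^sub>0 y" if x: "\<forall>j. x j \<in> \<X>" for x
  proof (rule LIMSEQ_le)
    have "(\<lambda>k. (det (G' (q k)))\<^sup>2) \<longlonglongrightarrow> (det l)\<^sup>2"
      by (intro tendsto_power tendsto_det G'q)
    then show "(\<lambda>k. (det (G' (q k)))\<^sup>2) \<longlonglongrightarrow> sq_det f \<theta>\<^sub>0 y"
      by (simp add: sq_det_eq y)
    have "(\<lambda>k. (f (est k) (x j) - f \<theta>\<^sub>0 (x j)) + f \<theta>\<^sub>0 (x j)) \<longlonglongrightarrow> 0 + f \<theta>\<^sub>0 (x j)" for j
      by (intro tendsto_add pt tendsto_const) (use x in auto)
    then have "(\<lambda>k. \<chi> j. f (est k) (x j)) \<longlonglongrightarrow> (\<chi> j. f \<theta>\<^sub>0 (x j))"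
      by (intro tendsto_vec_lambda) simp
    from tendsto_power[OF tendsto_det[OF this], of 2]
    have "(\<lambda>k. sq_det f (est k) x) \<longlonglongrightarrow> sq_det f \<theta>\<^sub>0 x"
      by (simp add: sq_det_eq)
    from LIMSEQ_subseq_LIMSEQ[OF this q]
    show "(\<lambda>k. sq_det f (est (q k)) x) \<longlonglongrightarrow> sq_det f \<theta>\<^sub>0 x" by (simp add: comp_def)
    show "\<exists>N. \<forall>k\<ge>N. sq_det f (est (q k)) x \<le> (det (G' (q k)))\<^sup>2"
      using zmax[OF x] by (auto simp: sq_det_eq G'_def)
  qed
  then have max: "is_arg_max (sq_det f \<theta>\<^sub>0) (\<lambda>z. \<forall>j. z j \<in> \<X>) y"
    using y(1) by (auto simp: is_arg_max_linorder)
  moreover have "sq_det f \<theta>\<^sub>0 y > 0"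
  proof -
    obtain x where "\<And>j. x j \<in> \<X>" "sq_det f \<theta>\<^sub>0 x > 0"
      using exists_sq_det_pos[of f \<theta>\<^sub>0 \<X>] span by blast
    with max show ?thesis
      by (auto simp: is_arg_max_linorder intro: less_le_trans)
  qed
  ultimately have M: "?M = (\<Sum>j\<in>UNIV. outer (l $ j))"
    using D_optimal_saturated_info_eq[OF _ _ SD, where z = y] by (simp add: y)
  have "(\<lambda>k. \<Sum>j\<in>UNIV. outer (G (q k) $ j)) \<longlonglongrightarrow> (\<Sum>j\<in>UNIV. outer (l $ j))"
    by (intro tendsto_sum tendsto_outer tendsto_vec_nth Gq)
  then have "\<forall>\<^sub>F k in sequentially. dist (\<Sum>j\<in>UNIV. outer (G (q k) $ j)) ?M < \<epsilon>"
    unfolding M using \<open>\<epsilon> > 0\<close> by (rule tendstoD)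
  then obtain k where "dist (\<Sum>j\<in>UNIV. outer (G (q k) $ j)) ?M < \<epsilon>"
    by (auto simp: eventually_sequentially)
  with far[of "s k"] show False by (simp add: G_def q_def)
qed


section \<open>Linearization of the least squares equation\<close>

lemma norm_matrix_vector_mult_le:
  fixes A :: "real^'n^'m"
  shows "norm (A *v x) \<le> norm A * norm x"
proof -
  have "norm (A *v x) = L2_set (\<lambda>i. \<bar>(A $ i) \<bullet> x\<bar>) UNIV"
    by (subst norm_vec_def) (simp add: matrix_vector_mul_component)
  also have "\<dots> \<le> L2_set (\<lambda>i. norm (A $ i) * norm x) UNIV"
    by (intro L2_set_mono Cauchy_Schwarz_ineq2) simp
  also have "\<dots> = norm A * norm x"
    by (subst (2) norm_vec_def) (simp add: L2_set_left_distrib)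
  finally show ?thesis .
qed

text \<open>A first order expansion at \<open>\<theta>\<^sub>0\<close> with a remainder that is uniform in \<open>x\<close>. The derivative is represented
  by \<open>\<phi>' x \<theta>\<close>, and \<open>ap\<close> applies a representation to a direction: the inner product with a gradient, or
  the product of a Hessian matrix with a vector.\<close>
lemma uniform_first_order_expansion:
  fixes \<phi> :: "'x::metric_space \<Rightarrow> 't::euclidean_space \<Rightarrow> 'c::real_normed_vector"
    and \<phi>' :: "'x \<Rightarrow> 't \<Rightarrow> 'b::real_normed_vector"
    and ap :: "'b \<Rightarrow> 't \<Rightarrow> 'c"
  assumes "compact \<X>" "open U" "\<theta>\<^sub>0 \<in> U"
    and deriv: "\<And>x \<theta>. x \<in> \<X> \<Longrightarrow> \<theta> \<in> U \<Longrightarrow> (\<phi> x has_derivative ap (\<phi>' x \<theta>)) (at \<theta>)"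
    and cont: "continuous_on (\<X> \<times> U) (\<lambda>(x, \<theta>). \<phi>' x \<theta>)"
    and ap: "\<And>u v h. norm (ap u h - ap v h) \<le> norm (u - v) * norm h"
    and "\<eta> > 0"
  obtains \<delta> where "\<delta> > 0" "ball \<theta>\<^sub>0 \<delta> \<subseteq> U"
    "\<And>x h. x \<in> \<X> \<Longrightarrow> norm h < \<delta> \<Longrightarrow> norm (\<phi>' x (\<theta>\<^sub>0 + h) - \<phi>' x \<theta>\<^sub>0) \<le> \<eta>"
    "\<And>x h. x \<in> \<X> \<Longrightarrow> norm h < \<delta> \<Longrightarrow> norm (\<phi> x (\<theta>\<^sub>0 + h) - \<phi> x \<theta>\<^sub>0 - ap (\<phi>' x \<theta>\<^sub>0) h) \<le> \<eta> * norm h"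
proof -
  obtain r where "r > 0" and r: "cball \<theta>\<^sub>0 r \<subseteq> U"
    using open_contains_cball[of U] assms(2,3) by blast
  have "continuous_on (\<X> \<times> cball \<theta>\<^sub>0 r) (\<lambda>(x, \<theta>). \<phi>' x \<theta>)"
    using r by (intro continuous_on_subset[OF cont]) auto
  then obtain \<delta>' where "\<delta>' > 0"
    and \<delta>': "\<And>x \<theta>. x \<in> \<X> \<Longrightarrow> \<theta> \<in> cball \<theta>\<^sub>0 r \<Longrightarrow> dist \<theta> \<theta>\<^sub>0 < \<delta>' \<Longrightarrow> dist (\<phi>' x \<theta>) (\<phi>' x \<theta>\<^sub>0) < \<eta>"
    using uniform_limit_in_parameter[of \<X> "cball \<theta>\<^sub>0 r" "\<lambda>\<theta> x. \<phi>' x \<theta>" \<theta>\<^sub>0 \<eta>] \<open>compact \<X>\<close> \<open>r > 0\<close> \<open>\<eta> > 0\<close> by auto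
  define \<delta> where "\<delta> = min r \<delta>'"
  have near: "norm (\<phi>' x \<theta> - \<phi>' x \<theta>\<^sub>0) \<le> \<eta>" if "x \<in> \<X>" "\<theta> \<in> ball \<theta>\<^sub>0 \<delta>" for x \<theta>
    using \<delta>'[of x \<theta>] that by (auto simp: \<delta>_def dist_norm norm_minus_commute less_imp_le)
  show ?thesis
  proof (rule that[of \<delta>])
    show "\<delta> > 0" using \<open>r > 0\<close> \<open>\<delta>' > 0\<close> by (simp add: \<delta>_def)
    show sub: "ball \<theta>\<^sub>0 \<delta> \<subseteq> U" using r by (auto simp: \<delta>_def)
    fix x and h :: 't assume x: "x \<in> \<X>" and h: "norm h < \<delta>"
    then show "norm (\<phi>' x (\<theta>\<^sub>0 + h) - \<phi>' x \<theta>\<^sub>0) \<le> \<eta>"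
      by (intro near) (auto simp: dist_norm)
    have "norm (\<phi> x (\<theta>\<^sub>0 + h) - \<phi> x \<theta>\<^sub>0 - ap (\<phi>' x \<theta>\<^sub>0) (\<theta>\<^sub>0 + h - \<theta>\<^sub>0)) \<le> norm (\<theta>\<^sub>0 + h - \<theta>\<^sub>0) * \<eta>"
    proof (rule differentiable_bound_linearization[where S = "ball \<theta>\<^sub>0 \<delta>"])
      fix t :: real assume "t \<in> {0..1}"
      then have "\<bar>t\<bar> * norm h \<le> norm h" by (intro mult_left_le_one_le) auto
      then show "\<theta>\<^sub>0 + t *\<^sub>R (\<theta>\<^sub>0 + h - \<theta>\<^sub>0) \<in> ball \<theta>\<^sub>0 \<delta>"
        using h by (simp add: dist_norm)
    next
      fix \<theta> assume \<theta>: "\<theta> \<in> ball \<theta>\<^sub>0 \<delta>"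
      then show "(\<phi> x has_derivative ap (\<phi>' x \<theta>)) (at \<theta> within ball \<theta>\<^sub>0 \<delta>)"
        using sub by (intro has_derivative_at_withinI[OF deriv[OF x]]) blast
      show "onorm (ap (\<phi>' x \<theta>) - ap (\<phi>' x \<theta>\<^sub>0)) \<le> \<eta>"
      proof (rule onorm_bound)
        fix k :: 't
        have "norm ((ap (\<phi>' x \<theta>) - ap (\<phi>' x \<theta>\<^sub>0)) k) \<le> norm (\<phi>' x \<theta> - \<phi>' x \<theta>\<^sub>0) * norm k"
          using ap[of "\<phi>' x \<theta>" k "\<phi>' x \<theta>\<^sub>0"] by (simp only: fun_diff_def)
        also have "\<dots> \<le> \<eta> * norm k"
          by (intro mult_right_mono near x \<theta>) simp
        finally show "norm ((ap (\<phi>' x \<theta>) - ap (\<phi>' x \<theta>\<^sub>0)) k) \<le> \<eta> * norm k" .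
      qed (use \<open>\<eta> > 0\<close> in simp)
    next
      show "\<theta>\<^sub>0 \<in> ball \<theta>\<^sub>0 \<delta>" using \<open>\<delta> > 0\<close> by simp
    qed
    then show "norm (\<phi> x (\<theta>\<^sub>0 + h) - \<phi> x \<theta>\<^sub>0 - ap (\<phi>' x \<theta>\<^sub>0) h) \<le> \<eta> * norm h"
      by (simp add: mult.commute)
  qed
qed

lemma least_squares_normal_equation:
  fixes \<mu> :: "'x \<Rightarrow> real^'p \<Rightarrow> real" and y :: "'i \<Rightarrow> real"
  assumes "finite I" "\<theta> \<in> interior \<Theta>"
    and min: "\<And>t. t \<in> \<Theta> \<Longrightarrow> (\<Sum>i\<in>I. (y i - \<mu> (x i) \<theta>)\<^sup>2) \<le> (\<Sum>i\<in>I. (y i - \<mu> (x i) t)\<^sup>2)"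
    and grad: "\<And>i. i \<in> I \<Longrightarrow> GDERIV (\<mu> (x i)) \<theta> :> grad (x i) \<theta>"
  shows "(\<Sum>i\<in>I. (y i - \<mu> (x i) \<theta>) *\<^sub>R grad (x i) \<theta>) = 0"
proof -
  let ?s = "\<Sum>i\<in>I. (y i - \<mu> (x i) \<theta>) *\<^sub>R grad (x i) \<theta>"
  have d: "(\<mu> (x i) has_derivative (\<lambda>h. h \<bullet> grad (x i) \<theta>)) (at \<theta>)" if "i \<in> I" for i
    using grad[OF that] by (simp add: gderiv_def)
  have "((\<lambda>t. \<Sum>i\<in>I. (y i - \<mu> (x i) t)\<^sup>2) has_derivative
      (\<lambda>h. \<Sum>i\<in>I. 2 * (y i - \<mu> (x i) \<theta>) * (- (h \<bullet> grad (x i) \<theta>)))) (at \<theta>)"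
    by (auto intro!: derivative_eq_intros d simp: algebra_simps)
  moreover have "(\<lambda>h. \<Sum>i\<in>I. 2 * (y i - \<mu> (x i) \<theta>) * (- (h \<bullet> grad (x i) \<theta>))) = (\<lambda>h. - 2 * (h \<bullet> ?s))"
    unfolding inner_sum_right sum_distrib_left
    by (intro ext sum.cong refl) (simp add: algebra_simps)
  ultimately have "((\<lambda>t. \<Sum>i\<in>I. (y i - \<mu> (x i) t)\<^sup>2) has_derivative (\<lambda>h. - 2 * (h \<bullet> ?s))) (at \<theta>)"
    by simp
  then have "(\<lambda>h. - 2 * (h \<bullet> ?s)) = (\<lambda>v. 0)"
    using min interior_subset[of \<Theta>]
    by (intro differential_zero_maxmin[OF \<open>\<theta> \<in> interior \<Theta>\<close> open_interior]) blast+
  then have "- 2 * (?s \<bullet> ?s) = 0" by (rule fun_cong)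
  then show ?thesis by simp
qed

lemma sum_outer_mult: "(\<Sum>i\<in>I. outer (g i)) *v h = (\<Sum>i\<in>I. (g i \<bullet> h) *\<^sub>R g i)"
proof -
  have "outer v *v h = (v \<bullet> h) *\<^sub>R v" for v :: "real^'a"
    by (simp add: vec_eq_iff outer_def matrix_vector_mult_def inner_vec_def sum_distrib_left mult_ac)
  then show ?thesis
    by (induction I rule: infinite_finite_induct) (simp_all add: matrix_vector_mult_add_rdistrib)
qed

text \<open>The normal equation at \<open>\<theta>\<^sub>0 + h\<close>, linearized in \<open>h\<close>. The terms on the right-hand side come from the
  Hessian of the mean response, from the remainder in the expansion of its gradient, and from replacing
  both the increments of the mean and the gradients by their values at \<open>\<theta>\<^sub>0\<close>.\<close>
lemma score_linearization:
  fixes \<mu> :: "'x \<Rightarrow> real^'p \<Rightarrow> real" and e :: "'i \<Rightarrow> real"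
  assumes "finite I" and x: "\<And>i. i \<in> I \<Longrightarrow> x i \<in> \<X>"
    and normal: "(\<Sum>i\<in>I. (\<mu> (x i) \<theta>\<^sub>0 + e i - \<mu> (x i) (\<theta>\<^sub>0 + h)) *\<^sub>R grad (x i) (\<theta>\<^sub>0 + h)) = 0"
    and C: "\<And>u. u \<in> \<X> \<Longrightarrow> norm (grad u \<theta>\<^sub>0) \<le> C"
    and near: "\<And>u. u \<in> \<X> \<Longrightarrow> norm (grad u (\<theta>\<^sub>0 + h) - grad u \<theta>\<^sub>0) \<le> \<eta>"
    and mu: "\<And>u. u \<in> \<X> \<Longrightarrow> \<bar>\<mu> u (\<theta>\<^sub>0 + h) - \<mu> u \<theta>\<^sub>0 - grad u \<theta>\<^sub>0 \<bullet> h\<bar> \<le> \<eta> * norm h"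
    and gr: "\<And>u. u \<in> \<X> \<Longrightarrow> norm (grad u (\<theta>\<^sub>0 + h) - grad u \<theta>\<^sub>0 - hess u \<theta>\<^sub>0 *v h) \<le> \<eta> * norm h"
    and "\<eta> \<ge> 0" "C \<ge> 0"
  shows "norm ((\<Sum>i\<in>I. e i *\<^sub>R grad (x i) \<theta>\<^sub>0) - (\<Sum>i\<in>I. outer (grad (x i) \<theta>\<^sub>0)) *v h)
    \<le> (norm (\<Sum>i\<in>I. e i *\<^sub>R hess (x i) \<theta>\<^sub>0) + \<eta> * (\<Sum>i\<in>I. \<bar>e i\<bar>) + real (card I) * (\<eta> * (2 * C + \<eta>))) * norm h"
proof -
  define g where "g = (\<lambda>i. grad (x i) \<theta>\<^sub>0)"
  define g' where "g' = (\<lambda>i. grad (x i) (\<theta>\<^sub>0 + h))"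
  define r where "r = (\<lambda>i. g' i - g i - hess (x i) \<theta>\<^sub>0 *v h)"
  define s where "s = (\<lambda>i. \<mu> (x i) (\<theta>\<^sub>0 + h) - \<mu> (x i) \<theta>\<^sub>0 - g i \<bullet> h)"
  define q where "q = (\<lambda>i. s i *\<^sub>R g' i + (g i \<bullet> h) *\<^sub>R (g' i - g i))"
  have summand: "e i *\<^sub>R g i - (g i \<bullet> h) *\<^sub>R g i = (\<mu> (x i) \<theta>\<^sub>0 + e i - \<mu> (x i) (\<theta>\<^sub>0 + h)) *\<^sub>R g' i
      - e i *\<^sub>R (hess (x i) \<theta>\<^sub>0 *v h) - e i *\<^sub>R r i + q i" for i
  proof -
    have "\<mu> (x i) \<theta>\<^sub>0 + e i - \<mu> (x i) (\<theta>\<^sub>0 + h) = e i - s i - g i \<bullet> h" by (simp add: s_def)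
    then show ?thesis
      by (simp only: r_def q_def) (simp add: algebra_simps)
  qed
  have hs: "(\<Sum>i\<in>I. e i *\<^sub>R (hess (x i) \<theta>\<^sub>0 *v h)) = (\<Sum>i\<in>I. e i *\<^sub>R hess (x i) \<theta>\<^sub>0) *v h"
    using \<open>finite I\<close> by (induction I rule: finite_induct)
      (simp_all add: matrix_vector_mult_add_rdistrib scaleR_matrix_vector_assoc)
  have "(\<Sum>i\<in>I. e i *\<^sub>R g i) - (\<Sum>i\<in>I. outer (g i)) *v h = (\<Sum>i\<in>I. e i *\<^sub>R g i - (g i \<bullet> h) *\<^sub>R g i)"
    by (simp add: sum_outer_mult sum_subtractf)
  also have "\<dots> = - ((\<Sum>i\<in>I. e i *\<^sub>R hess (x i) \<theta>\<^sub>0) *v h) - (\<Sum>i\<in>I. e i *\<^sub>R r i) + (\<Sum>i\<in>I. q i)"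
    unfolding summand using normal by (simp add: sum.distrib sum_subtractf hs g'_def)
  also have "norm \<dots> \<le> norm ((\<Sum>i\<in>I. e i *\<^sub>R hess (x i) \<theta>\<^sub>0) *v h) + norm (\<Sum>i\<in>I. e i *\<^sub>R r i) + norm (\<Sum>i\<in>I. q i)"
    by (intro order_trans[OF norm_triangle_ineq] add_mono order_trans[OF norm_triangle_ineq4]) auto
  also have "norm ((\<Sum>i\<in>I. e i *\<^sub>R hess (x i) \<theta>\<^sub>0) *v h) \<le> norm (\<Sum>i\<in>I. e i *\<^sub>R hess (x i) \<theta>\<^sub>0) * norm h"
    by (rule norm_matrix_vector_mult_le)
  also have "norm (\<Sum>i\<in>I. e i *\<^sub>R r i) \<le> (\<Sum>i\<in>I. \<bar>e i\<bar> * (\<eta> * norm h))"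
    using gr x by (intro sum_norm_le) (auto simp: r_def g_def g'_def intro!: mult_left_mono)
  also have "\<dots> = \<eta> * (\<Sum>i\<in>I. \<bar>e i\<bar>) * norm h"
    by (simp add: sum_distrib_left sum_distrib_right mult_ac)
  also have "norm (\<Sum>i\<in>I. q i) \<le> (\<Sum>i\<in>I. \<eta> * (2 * C + \<eta>) * norm h)"
  proof (rule sum_norm_le)
    fix i assume i: "i \<in> I"
    have g'C: "norm (g' i) \<le> C + \<eta>"
      using norm_triangle_ineq[of "g i" "g' i - g i"] C[OF x[OF i]] near[OF x[OF i]]
      by (simp add: g_def g'_def)
    have "norm (q i) \<le> \<bar>s i\<bar> * norm (g' i) + \<bar>g i \<bullet> h\<bar> * norm (g' i - g i)"
      unfolding q_def by (rule order_trans[OF norm_triangle_ineq]) simp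
    also have "\<dots> \<le> (\<eta> * norm h) * (C + \<eta>) + (C * norm h) * \<eta>"
    proof (intro add_mono mult_mono)
      show "\<bar>g i \<bullet> h\<bar> \<le> C * norm h"
        using C[OF x[OF i]] by (intro order_trans[OF Cauchy_Schwarz_ineq2] mult_right_mono) (auto simp: g_def)
    qed (use mu[OF x[OF i]] near[OF x[OF i]] g'C \<open>\<eta> \<ge> 0\<close> \<open>C \<ge> 0\<close> in \<open>auto simp: s_def g_def g'_def\<close>)
    also have "\<dots> = \<eta> * (2 * C + \<eta>) * norm h" by (simp add: algebra_simps)
    finally show "norm (q i) \<le> \<eta> * (2 * C + \<eta>) * norm h" .
  qed
  also have "\<dots> = real (card I) * (\<eta> * (2 * C + \<eta>)) * norm h" by simp
  finally show ?thesis
    by (simp add: g_def distrib_right)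
qed

text \<open>An approximate solution of \<open>M z = N\<close> is close to the exact one, even if the residual is only small
  relative to \<open>z\<close>: for small \<open>\<rho>\<close> the size of \<open>z\<close> is controlled by that of \<open>N\<close>.\<close>
lemma approx_linear_solution:
  fixes M Mi :: "real^'p^'p" and z N :: "real^'p"
  assumes inv: "Mi ** M = mat 1"
    and resid: "norm (N - M *v z) \<le> \<rho> * norm z"
    and \<rho>: "norm Mi * \<rho> \<le> 1 / 2"
  shows "norm (z - Mi *v N) \<le> 2 * (norm Mi)\<^sup>2 * \<rho> * norm N"
proof (cases "z = 0")
  case True
  with resid show ?thesis by simp
next
  case False
  have "\<rho> \<ge> 0"
    using order_trans[OF norm_ge_zero resid] False by (simp add: zero_le_mult_iff)
  have "z - Mi *v N = - (Mi *v (N - M *v z))"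
    by (simp add: matrix_vector_mult_diff_distrib matrix_vector_mul_assoc inv)
  then have "norm (z - Mi *v N) \<le> norm Mi * norm (N - M *v z)"
    by (metis norm_minus_cancel norm_matrix_vector_mult_le)
  also have "\<dots> \<le> norm Mi * (\<rho> * norm z)"
    by (intro mult_left_mono resid) simp
  finally have d: "norm (z - Mi *v N) \<le> norm Mi * \<rho> * norm z" by (simp add: mult_ac)
  have "norm Mi * \<rho> * norm z \<le> 1 / 2 * norm z"
    by (intro mult_right_mono \<rho>) simp
  moreover have "norm z \<le> norm (z - Mi *v N) + norm Mi * norm N"
    using norm_triangle_sub[of z "Mi *v N"] norm_matrix_vector_mult_le[of Mi N] by simp
  ultimately have "norm z \<le> 2 * (norm Mi * norm N)" using d by simp
  then have "norm Mi * \<rho> * norm z \<le> norm Mi * \<rho> * (2 * (norm Mi * norm N))"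
    using \<open>\<rho> \<ge> 0\<close> by (intro mult_left_mono) auto
  with d show ?thesis by (simp add: power2_eq_square mult_ac)
qed


section \<open>Weighted sums of block errors\<close>

lemma (in sigma_finite_subalgebra) real_cond_exp_sum_on:
  fixes f :: "'b \<Rightarrow> 'a \<Rightarrow> real"
  assumes "\<And>i. i \<in> I \<Longrightarrow> integrable M (f i)"
  shows "AE x in M. real_cond_exp M F (\<lambda>x. \<Sum>i\<in>I. f i x) x = (\<Sum>i\<in>I. real_cond_exp M F (f i) x)"
proof -
  define g where "g = (\<lambda>i. if i \<in> I then f i else (\<lambda>_. 0))"
  have "integrable M (g i)" for i using assms by (simp add: g_def)
  then have "AE x in M. real_cond_exp M F (\<lambda>x. \<Sum>i\<in>I. g i x) x = (\<Sum>i\<in>I. real_cond_exp M F (g i) x)"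
    by (rule real_cond_exp_sum)
  then show ?thesis by (simp add: g_def cong: sum.cong)
qed

text \<open>Errors \<open>e i\<close> that arrive in blocks \<open>Bl j\<close> of at most \<open>m\<close> indices. The block \<open>Bl j\<close> is revealed between
  times \<open>j\<close> and \<open>Suc j\<close>. Almost surely, the conditional second moments of all but finitely many blocks
  are at most \<open>c\<close>.\<close>
locale block_errors = prob_space P for P :: "'w measure" +
  fixes F :: "nat \<Rightarrow> 'w measure" and e :: "nat \<Rightarrow> 'w \<Rightarrow> real" and Bl :: "nat \<Rightarrow> nat set"
    and m :: nat and c :: real
  assumes subalgebra: "\<And>j. subalgebra P (F j)"
    and filtration: "\<And>j. sets (F j) \<subseteq> sets (F (Suc j))"
    and finite_block: "\<And>j. finite (Bl j)" and card_block: "\<And>j. card (Bl j) \<le> m"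
    and e_adapted: "\<And>i j. i \<in> Bl j \<Longrightarrow> e i \<in> borel_measurable (F (Suc j))"
    and e_square: "\<And>i j. i \<in> Bl j \<Longrightarrow> integrable P (\<lambda>\<omega>. (e i \<omega>)\<^sup>2)"
    and e_centred: "\<And>i j. i \<in> Bl j \<Longrightarrow> AE \<omega> in P. real_cond_exp P (F j) (e i) \<omega> = 0"
    and c_nonneg: "c \<ge> 0"
    and eventually_small: "AE \<omega> in P. \<forall>\<^sub>F j in sequentially.
      real_cond_exp P (F j) (\<lambda>\<omega>. \<Sum>i\<in>Bl j. (e i \<omega>)\<^sup>2) \<omega> \<le> c"
begin

text \<open>The squared norm of a block of errors, and its conditional expectation given the past.\<close>
definition Q :: "nat \<Rightarrow> 'w \<Rightarrow> real" where
  "Q j \<omega> = (\<Sum>i\<in>Bl j. (e i \<omega>)\<^sup>2)"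

definition W :: "nat \<Rightarrow> 'w \<Rightarrow> real" where
  "W j = real_cond_exp P (F j) (Q j)"

text \<open>The indicator of a bounded conditional second moment. It is known before the block is revealed, so
  multiplying a block by it preserves the martingale property; it makes the conditional second moments
  bounded, which turns almost sure convergence into convergence in mean.\<close>
definition trunc :: "nat \<Rightarrow> 'w \<Rightarrow> real" where
  "trunc j \<omega> = (if W j \<omega> \<le> c then 1 else 0)"

text \<open>Weights that are known before the block that they multiply, and bounded by \<open>C\<close>.\<close>
definition predictable :: "(nat \<Rightarrow> 'w \<Rightarrow> real) \<Rightarrow> real \<Rightarrow> bool" where
  "predictable a C \<longleftrightarrow> (\<forall>j. \<forall>i\<in>Bl j. a i \<in> borel_measurable (F j) \<and> (\<forall>\<omega>\<in>space P. \<bar>a i \<omega>\<bar> \<le> C))"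

text \<open>The truncated weighted sum of a block of errors.\<close>
definition D :: "(nat \<Rightarrow> 'w \<Rightarrow> real) \<Rightarrow> nat \<Rightarrow> 'w \<Rightarrow> real" where
  "D a j \<omega> = trunc j \<omega> * (\<Sum>i\<in>Bl j. a i \<omega> * e i \<omega>)"

lemma sigma_finite_F: "sigma_finite_subalgebra P (F j)"
  by (intro finite_measure_subalgebra_is_sigma_finite finite_measure_subalgebra.intro
    finite_measure_subalgebra_axioms.intro subalgebra) unfold_locales

lemma F_measurable_P: "f \<in> borel_measurable (F j) \<Longrightarrow> f \<in> borel_measurable P"
  by (rule measurable_from_subalg[OF subalgebra])

lemma F_measurable_Suc: "f \<in> borel_measurable (F j) \<Longrightarrow> f \<in> borel_measurable (F (Suc j))"
  using filtration[of j] subalgebra[of j] subalgebra[of "Suc j"]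
  by (auto simp: measurable_def subalgebra_def)

lemma e_measurable: "i \<in> Bl j \<Longrightarrow> e i \<in> borel_measurable P"
  by (rule F_measurable_P[OF e_adapted])

lemma e_integrable: "i \<in> Bl j \<Longrightarrow> integrable P (e i)"
  by (rule integrable_of_square_integrable[OF e_measurable e_square])

lemma e_prod_integrable: "i \<in> Bl j \<Longrightarrow> l \<in> Bl j \<Longrightarrow> integrable P (\<lambda>\<omega>. e i \<omega> * e l \<omega>)"
  by (rule integrable_mult_of_square_integrable[OF e_measurable e_measurable e_square e_square])

lemma W_measurable: "W j \<in> borel_measurable (F j)"
  by (simp add: W_def)

lemma trunc_measurable: "trunc j \<in> borel_measurable (F j)"
  unfolding trunc_def using W_measurable[of j] by measurable

lemma trunc_measurable_P [measurable]: "trunc j \<in> borel_measurable P"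
  by (rule F_measurable_P[OF trunc_measurable])

lemma trunc_01: "0 \<le> trunc j \<omega>" "trunc j \<omega> \<le> 1" "(trunc j \<omega>)\<^sup>2 = trunc j \<omega>"
  by (simp_all add: trunc_def)

lemma Q_integrable: "integrable P (Q j)"
  unfolding Q_def using e_square by (intro Bochner_Integration.integrable_sum) auto

lemma Q_measurable [measurable]: "Q j \<in> borel_measurable P"
  using Q_integrable by auto

lemma Q_nonneg: "Q j \<omega> \<ge> 0"
  by (simp add: Q_def sum_nonneg)

lemma trunc_mult_integrable:
  "integrable P f \<Longrightarrow> integrable P (\<lambda>\<omega>. trunc j \<omega> * f \<omega>)"
  by (rule Bochner_Integration.integrable_bound[of _ f])
     (auto simp: abs_mult trunc_01 intro!: mult_left_le_one_le)

lemma trunc_Q_integral: "(\<integral>\<omega>. trunc j \<omega> * Q j \<omega> \<partial>P) \<le> c"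
proof -
  interpret Fj: sigma_finite_subalgebra P "F j" by (rule sigma_finite_F)
  note i = trunc_mult_integrable[OF Q_integrable, of j j]
  have "(\<integral>\<omega>. trunc j \<omega> * Q j \<omega> \<partial>P) = (\<integral>\<omega>. trunc j \<omega> * W j \<omega> \<partial>P)"
    unfolding W_def by (rule Fj.real_cond_exp_intg(2)[OF i trunc_measurable, symmetric]) simp
  also have "\<dots> \<le> (\<integral>\<omega>. c \<partial>P)"
    using c_nonneg Fj.real_cond_exp_intg(1)[OF i trunc_measurable Q_measurable]
    by (intro integral_mono) (auto simp: trunc_def W_def)
  finally show ?thesis by (simp add: prob_space)
qed

text \<open>Almost surely only finitely many blocks are affected by the truncation.\<close>
lemma trunc_sums_bounded:
  "AE \<omega> in P. \<forall>x :: nat \<Rightarrow> 'b::real_normed_vector. \<exists>b. \<forall>K. norm (\<Sum>j<K. (1 - trunc j \<omega>) *\<^sub>R x j) \<le> b"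
  using eventually_small
proof eventually_elim
  case (elim \<omega>)
  then obtain J where "\<forall>j\<ge>J. real_cond_exp P (F j) (\<lambda>\<omega>. \<Sum>i\<in>Bl j. (e i \<omega>)\<^sup>2) \<omega> \<le> c"
    by (auto simp: eventually_sequentially)
  then have J: "trunc j \<omega> = 1" if "j \<ge> J" for j
    using that by (simp add: trunc_def W_def Q_def[abs_def])
  show ?case
  proof (intro allI exI)
    fix x :: "nat \<Rightarrow> 'b" and K
    have "(\<Sum>j<K. (1 - trunc j \<omega>) *\<^sub>R x j) = (\<Sum>j\<in>{..<K} \<inter> {..<J}. (1 - trunc j \<omega>) *\<^sub>R x j)"
      by (intro sum.mono_neutral_right) (auto, meson J not_less)
    also have "norm \<dots> \<le> (\<Sum>j\<in>{..<K} \<inter> {..<J}. norm (x j))"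
      by (rule sum_norm_le) (auto simp: trunc_def)
    also have "\<dots> \<le> (\<Sum>j<J. norm (x j))"
      by (rule sum_mono2) auto
    finally show "norm (\<Sum>j<K. (1 - trunc j \<omega>) *\<^sub>R x j) \<le> (\<Sum>j<J. norm (x j))" .
  qed
qed

context
  fixes a :: "nat \<Rightarrow> 'w \<Rightarrow> real" and C :: real
  assumes a: "predictable a C"
begin

lemma a_measurable: "i \<in> Bl j \<Longrightarrow> a i \<in> borel_measurable (F j)"
  and a_bound: "i \<in> Bl j \<Longrightarrow> \<omega> \<in> space P \<Longrightarrow> \<bar>a i \<omega>\<bar> \<le> C"
  using a by (auto simp: predictable_def)

lemma D_square_le:
  assumes "\<omega> \<in> space P"
  shows "(D a j \<omega>)\<^sup>2 \<le> C\<^sup>2 * real m * (trunc j \<omega> * Q j \<omega>)"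
proof -
  have "(\<Sum>i\<in>Bl j. a i \<omega> * e i \<omega>)\<^sup>2 \<le> (\<Sum>i\<in>Bl j. (a i \<omega>)\<^sup>2) * Q j \<omega>"
    unfolding Q_def by (rule Cauchy_Schwarz_ineq_sum)
  also have "\<dots> \<le> (C\<^sup>2 * real m) * Q j \<omega>"
  proof (rule mult_right_mono[OF _ Q_nonneg])
    have "(\<Sum>i\<in>Bl j. (a i \<omega>)\<^sup>2) \<le> (\<Sum>i\<in>Bl j. C\<^sup>2)"
    proof (rule sum_mono)
      fix i assume "i \<in> Bl j"
      then have "\<bar>a i \<omega>\<bar> \<le> \<bar>C\<bar>" using a_bound[of i j \<omega>] assms by simp
      then show "(a i \<omega>)\<^sup>2 \<le> C\<^sup>2" by (simp add: abs_le_square_iff)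
    qed
    also have "\<dots> \<le> C\<^sup>2 * real m" using card_block[of j] by (simp add: mult.commute[of "C\<^sup>2"] mult_right_mono)
    finally show "(\<Sum>i\<in>Bl j. (a i \<omega>)\<^sup>2) \<le> C\<^sup>2 * real m" .
  qed
  finally have "trunc j \<omega> * (\<Sum>i\<in>Bl j. a i \<omega> * e i \<omega>)\<^sup>2 \<le> trunc j \<omega> * ((C\<^sup>2 * real m) * Q j \<omega>)"
    by (intro mult_left_mono trunc_01)
  then show ?thesis by (simp add: D_def power_mult_distrib trunc_01 mult_ac)
qed

lemma D_adapted: "D a j \<in> borel_measurable (F (Suc j))"
  unfolding D_def
  by (intro borel_measurable_times borel_measurable_sum F_measurable_Suc[OF trunc_measurable]
    F_measurable_Suc[OF a_measurable] e_adapted)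

lemma D_measurable [measurable]: "D a j \<in> borel_measurable P"
  by (rule F_measurable_P[OF D_adapted])

lemma D_square_integrable: "integrable P (\<lambda>\<omega>. (D a j \<omega>)\<^sup>2)"
proof (rule Bochner_Integration.integrable_bound)
  show "integrable P (\<lambda>\<omega>. C\<^sup>2 * real m * (trunc j \<omega> * Q j \<omega>))"
    using trunc_mult_integrable[OF Q_integrable, of j j] by simp
  show "AE \<omega> in P. norm ((D a j \<omega>)\<^sup>2) \<le> norm (C\<^sup>2 * real m * (trunc j \<omega> * Q j \<omega>))"
    using D_square_le by (auto intro!: AE_I2 order_trans[OF _ abs_ge_self])
qed simp

lemma D_second_moment: "(\<integral>\<omega>. (D a j \<omega>)\<^sup>2 \<partial>P) \<le> C\<^sup>2 * real m * c"
proof -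
  have i: "integrable P (\<lambda>\<omega>. C\<^sup>2 * real m * (trunc j \<omega> * Q j \<omega>))"
    using trunc_mult_integrable[OF Q_integrable, of j j] by simp
  have "(\<integral>\<omega>. (D a j \<omega>)\<^sup>2 \<partial>P) \<le> (\<integral>\<omega>. C\<^sup>2 * real m * (trunc j \<omega> * Q j \<omega>) \<partial>P)"
    by (rule integral_mono[OF D_square_integrable i D_square_le])
  also have "\<dots> = C\<^sup>2 * real m * (\<integral>\<omega>. trunc j \<omega> * Q j \<omega> \<partial>P)" by simp
  also have "\<dots> \<le> C\<^sup>2 * real m * c"
    by (intro mult_left_mono trunc_Q_integral) simp
  finally show ?thesis .
qed

lemma weight_measurable: "i \<in> Bl j \<Longrightarrow> (\<lambda>\<omega>. trunc j \<omega> * a i \<omega>) \<in> borel_measurable (F j)"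
  using trunc_measurable a_measurable by measurable

lemma bounded_weight_integrable:
  fixes f w :: "'w \<Rightarrow> real"
  assumes "integrable P f" and w: "w \<in> borel_measurable (F j)" "\<And>\<omega>. \<omega> \<in> space P \<Longrightarrow> \<bar>w \<omega>\<bar> \<le> b"
  shows "integrable P (\<lambda>\<omega>. w \<omega> * f \<omega>)"
proof (rule Bochner_Integration.integrable_bound)
  show "integrable P (\<lambda>\<omega>. b * f \<omega>)" using assms(1) by simp
  have [measurable]: "w \<in> borel_measurable P" "f \<in> borel_measurable P"
    using F_measurable_P[OF w(1)] assms(1) by auto
  show "(\<lambda>\<omega>. w \<omega> * f \<omega>) \<in> borel_measurable P" by measurable
  show "AE \<omega> in P. norm (w \<omega> * f \<omega>) \<le> norm (b * f \<omega>)"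
    using order_trans[OF w(2) abs_ge_self] by (auto simp: abs_mult intro!: AE_I2 mult_right_mono)
qed

lemma abs_trunc_mult_le: "\<bar>x\<bar> \<le> b \<Longrightarrow> \<bar>trunc j \<omega> * x\<bar> \<le> b"
  by (auto simp: trunc_def)

lemma D_centred: "AE \<omega> in P. real_cond_exp P (F j) (D a j) \<omega> = 0"
proof -
  interpret Fj: sigma_finite_subalgebra P "F j" by (rule sigma_finite_F)
  have int: "integrable P (\<lambda>\<omega>. (trunc j \<omega> * a i \<omega>) * e i \<omega>)" if "i \<in> Bl j" for i
    by (rule bounded_weight_integrable[OF e_integrable[OF that] weight_measurable[OF that]])
       (rule abs_trunc_mult_le[OF a_bound[OF that]])
  have "AE \<omega> in P. \<forall>i\<in>Bl j. real_cond_exp P (F j) (\<lambda>\<omega>. (trunc j \<omega> * a i \<omega>) * e i \<omega>) \<omega>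
      = (trunc j \<omega> * a i \<omega>) * real_cond_exp P (F j) (e i) \<omega>"
    using Fj.real_cond_exp_mult[OF weight_measurable e_measurable int]
    by (intro AE_finite_allI finite_block) auto
  moreover have "AE \<omega> in P. \<forall>i\<in>Bl j. real_cond_exp P (F j) (e i) \<omega> = 0"
    using e_centred by (intro AE_finite_allI finite_block) auto
  moreover have "AE \<omega> in P. real_cond_exp P (F j) (\<lambda>\<omega>. \<Sum>i\<in>Bl j. (trunc j \<omega> * a i \<omega>) * e i \<omega>) \<omega>
      = (\<Sum>i\<in>Bl j. real_cond_exp P (F j) (\<lambda>\<omega>. (trunc j \<omega> * a i \<omega>) * e i \<omega>) \<omega>)"
    by (rule Fj.real_cond_exp_sum_on[OF int])
  moreover have "D a j = (\<lambda>\<omega>. \<Sum>i\<in>Bl j. (trunc j \<omega> * a i \<omega>) * e i \<omega>)"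
    by (simp add: D_def[abs_def] sum_distrib_left mult_ac)
  ultimately show ?thesis
    by (elim AE_mp) (auto intro!: AE_I2)
qed

lemma D_conditional_variance:
  "AE \<omega> in P. real_cond_exp P (F j) (\<lambda>\<omega>. (D a j \<omega>)\<^sup>2) \<omega>
    = trunc j \<omega> * (\<Sum>i\<in>Bl j. \<Sum>l\<in>Bl j. a i \<omega> * a l \<omega> * real_cond_exp P (F j) (\<lambda>\<omega>. e i \<omega> * e l \<omega>) \<omega>)"
proof -
  interpret Fj: sigma_finite_subalgebra P "F j" by (rule sigma_finite_F)
  let ?w = "\<lambda>k \<omega>. trunc j \<omega> * (a (fst k) \<omega> * a (snd k) \<omega>)"
  let ?e = "\<lambda>k \<omega>. e (fst k) \<omega> * e (snd k) \<omega>"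
  let ?I = "Bl j \<times> Bl j"
  have w: "?w k \<in> borel_measurable (F j)" if "k \<in> ?I" for k
    using trunc_measurable[of j] a_measurable[of "fst k" j] a_measurable[of "snd k" j] that by (auto simp: mem_Times_iff)
  have em: "?e k \<in> borel_measurable P" if "k \<in> ?I" for k
    using e_measurable that by (auto simp: mem_Times_iff)
  have int: "integrable P (\<lambda>\<omega>. ?w k \<omega> * ?e k \<omega>)" if "k \<in> ?I" for k
  proof (rule bounded_weight_integrable[OF _ w[OF that]])
    show "integrable P (?e k)" using that by (auto intro: e_prod_integrable)
    fix \<omega> assume "\<omega> \<in> space P"
    then show "\<bar>?w k \<omega>\<bar> \<le> C * C"
      using a_bound[of "fst k" j \<omega>] a_bound[of "snd k" j \<omega>] that
      by (intro abs_trunc_mult_le) (auto simp: abs_mult intro!: mult_mono order_trans[OF abs_ge_zero])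
  qed
  have "AE \<omega> in P. \<forall>k\<in>?I. real_cond_exp P (F j) (\<lambda>\<omega>. ?w k \<omega> * ?e k \<omega>) \<omega> = ?w k \<omega> * real_cond_exp P (F j) (?e k) \<omega>"
    using Fj.real_cond_exp_mult[OF w em int]
    by (intro AE_finite_allI finite_cartesian_product finite_block) auto
  moreover have "AE \<omega> in P. real_cond_exp P (F j) (\<lambda>\<omega>. \<Sum>k\<in>?I. ?w k \<omega> * ?e k \<omega>) \<omega>
      = (\<Sum>k\<in>?I. real_cond_exp P (F j) (\<lambda>\<omega>. ?w k \<omega> * ?e k \<omega>) \<omega>)"
    by (rule Fj.real_cond_exp_sum_on[OF int])
  moreover have "(\<lambda>\<omega>. (D a j \<omega>)\<^sup>2) = (\<lambda>\<omega>. \<Sum>k\<in>?I. ?w k \<omega> * ?e k \<omega>)"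
  proof
    fix \<omega>
    have "(D a j \<omega>)\<^sup>2 = trunc j \<omega> * (\<Sum>k\<in>?I. (a (fst k) \<omega> * e (fst k) \<omega>) * (a (snd k) \<omega> * e (snd k) \<omega>))"
      by (simp add: D_def power_mult_distrib trunc_01)
         (simp add: power2_eq_square sum_product sum.cartesian_product case_prod_beta)
    then show "(D a j \<omega>)\<^sup>2 = (\<Sum>k\<in>?I. ?w k \<omega> * ?e k \<omega>)"
      by (simp add: sum_distrib_left mult_ac)
  qed
  ultimately have "AE \<omega> in P. real_cond_exp P (F j) (\<lambda>\<omega>. (D a j \<omega>)\<^sup>2) \<omega> = (\<Sum>k\<in>?I. ?w k \<omega> * real_cond_exp P (F j) (?e k) \<omega>)"
    by (elim AE_mp) (auto intro!: AE_I2 sum.cong)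
  then show ?thesis
    by (elim AE_mp, intro AE_I2) (simp add: sum.cartesian_product sum_distrib_left case_prod_beta mult.assoc)
qed

lemma martingale_differences_D: "martingale_differences P F (D a)"
  by (intro martingale_differences.intro martingale_differences_axioms.intro subalgebra filtration
    D_adapted D_square_integrable D_centred) unfold_locales

lemma D_partial_sum_second_moment:
  "integrable P (\<lambda>\<omega>. (\<Sum>j<K. D a j \<omega>)\<^sup>2)"
  "(\<integral>\<omega>. (\<Sum>j<K. D a j \<omega>)\<^sup>2 \<partial>P) \<le> real K * (C\<^sup>2 * real m * c)"
proof -
  interpret martingale_differences P F "D a" by (rule martingale_differences_D)
  show "integrable P (\<lambda>\<omega>. (\<Sum>j<K. D a j \<omega>)\<^sup>2)" using partial_sum_square by blast
  have "(\<integral>\<omega>. (\<Sum>j<K. D a j \<omega>)\<^sup>2 \<partial>P) = (\<Sum>j<K. \<integral>\<omega>. (D a j \<omega>)\<^sup>2 \<partial>P)"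
    using partial_sum_square by blast
  also have "\<dots> \<le> (\<Sum>j<K. C\<^sup>2 * real m * c)"
    by (intro sum_mono D_second_moment)
  finally show "(\<integral>\<omega>. (\<Sum>j<K. D a j \<omega>)\<^sup>2 \<partial>P) \<le> real K * (C\<^sup>2 * real m * c)" by simp
qed

lemma D_conditional_variance_tendsto:
  assumes "AE \<omega> in P. (\<lambda>j. \<Sum>i\<in>Bl j. \<Sum>l\<in>Bl j. a i \<omega> * a l \<omega> *
      real_cond_exp P (F j) (\<lambda>\<omega>. e i \<omega> * e l \<omega>) \<omega>) \<longlonglongrightarrow> \<tau>2"
  shows "(\<lambda>j. \<integral>\<omega>. \<bar>real_cond_exp P (F j) (\<lambda>\<omega>. (D a j \<omega>)\<^sup>2) \<omega> - \<tau>2\<bar> \<partial>P) \<longlonglongrightarrow> 0"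
proof -
  let ?V = "\<lambda>j. real_cond_exp P (F j) (\<lambda>\<omega>. (D a j \<omega>)\<^sup>2)"
  let ?b = "C\<^sup>2 * real m * c"
  have V_meas [measurable]: "?V j \<in> borel_measurable P" for j by simp
  have V_bound: "AE \<omega> in P. 0 \<le> ?V j \<omega> \<and> ?V j \<omega> \<le> ?b" for j
  proof -
    interpret Fj: sigma_finite_subalgebra P "F j" by (rule sigma_finite_F)
    have i: "integrable P (\<lambda>\<omega>. C\<^sup>2 * real m * (trunc j \<omega> * Q j \<omega>))"
      using trunc_mult_integrable[OF Q_integrable, of j j] by simp
    have "AE \<omega> in P. 0 \<le> ?V j \<omega>"
      by (rule Fj.real_cond_exp_pos) auto
    moreover have "AE \<omega> in P. ?V j \<omega> \<le> real_cond_exp P (F j) (\<lambda>\<omega>. C\<^sup>2 * real m * (trunc j \<omega> * Q j \<omega>)) \<omega>"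
      using D_square_le by (intro Fj.real_cond_exp_mono AE_I2 D_square_integrable i)
    moreover have "AE \<omega> in P. real_cond_exp P (F j) (\<lambda>\<omega>. C\<^sup>2 * real m * (trunc j \<omega> * Q j \<omega>)) \<omega>
        = C\<^sup>2 * real m * real_cond_exp P (F j) (\<lambda>\<omega>. trunc j \<omega> * Q j \<omega>) \<omega>"
      by (rule Fj.real_cond_exp_cmult[OF trunc_mult_integrable[OF Q_integrable]])
    moreover have "AE \<omega> in P. real_cond_exp P (F j) (\<lambda>\<omega>. trunc j \<omega> * Q j \<omega>) \<omega> = trunc j \<omega> * W j \<omega>"
      unfolding W_def
      by (rule Fj.real_cond_exp_mult[OF trunc_measurable Q_measurable trunc_mult_integrable[OF Q_integrable]])
    ultimately show ?thesis
    proof eventually_elim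
      case (elim \<omega>)
      have "trunc j \<omega> * W j \<omega> \<le> c" using c_nonneg by (simp add: trunc_def)
      then have "C\<^sup>2 * real m * (trunc j \<omega> * W j \<omega>) \<le> ?b" by (intro mult_left_mono) auto
      with elim show ?case by simp
    qed
  qed
  have V_lim: "AE \<omega> in P. (\<lambda>j. \<bar>?V j \<omega> - \<tau>2\<bar>) \<longlonglongrightarrow> 0"
  proof -
    have "AE \<omega> in P. \<forall>j. ?V j \<omega> = trunc j \<omega> * (\<Sum>i\<in>Bl j. \<Sum>l\<in>Bl j. a i \<omega> * a l \<omega> *
        real_cond_exp P (F j) (\<lambda>\<omega>. e i \<omega> * e l \<omega>) \<omega>)"
      unfolding AE_all_countable using D_conditional_variance by blast
    with assms eventually_small show ?thesis
    proof eventually_elim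
      case (elim \<omega>)
      have "\<forall>\<^sub>F j in sequentially. (\<Sum>i\<in>Bl j. \<Sum>l\<in>Bl j. a i \<omega> * a l \<omega> *
        real_cond_exp P (F j) (\<lambda>\<omega>. e i \<omega> * e l \<omega>) \<omega>) = ?V j \<omega>"
        using elim(2) by eventually_elim (use elim(3) in \<open>auto simp: trunc_def W_def Q_def[abs_def]\<close>)
      with elim(1) have "(\<lambda>j. ?V j \<omega>) \<longlonglongrightarrow> \<tau>2"
        by (rule Lim_transform_eventually)
      then show ?case
        using tendsto_rabs_zero LIM_zero by blast
    qed
  qed
  have "(\<lambda>j. \<integral>\<omega>. \<bar>?V j \<omega> - \<tau>2\<bar> \<partial>P) \<longlonglongrightarrow> (\<integral>\<omega>. 0 \<partial>P)"
  proof (rule integral_dominated_convergence[where w = "\<lambda>_. ?b + \<bar>\<tau>2\<bar>"])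
    show "AE \<omega> in P. norm \<bar>?V j \<omega> - \<tau>2\<bar> \<le> ?b + \<bar>\<tau>2\<bar>" for j
      using V_bound[of j] by eventually_elim auto
  qed (use V_lim in auto)
  then show ?thesis by simp
qed

text \<open>The unconditional Lindeberg condition for the truncated weighted sums. A large \<open>D a j\<close> forces a large
  block of errors, and the averages of the truncated conditional Lindeberg terms are bounded by \<open>c\<close>, so
  that dominated convergence applies.\<close>
lemma D_lindeberg:
  assumes lindeberg: "\<And>\<epsilon>. \<epsilon> > 0 \<Longrightarrow> AE \<omega> in P. (\<lambda>K. (1 / real K) * (\<Sum>j<K. real_cond_exp P (F j)
      (\<lambda>\<omega>. Q j \<omega> * indicator {\<omega>. \<epsilon> * sqrt (real K) < sqrt (Q j \<omega>)} \<omega>) \<omega>)) \<longlonglongrightarrow> 0"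
    and "\<epsilon> > 0"
  shows "(\<lambda>K. (1 / real K) * (\<Sum>j<K. \<integral>\<omega>. (D a j \<omega>)\<^sup>2 * indicator {\<omega>. \<epsilon> * sqrt (real K) < \<bar>D a j \<omega>\<bar>} \<omega> \<partial>P)) \<longlonglongrightarrow> 0"
proof -
  \<comment> \<open>adding one ensures \<open>c1 > 0\<close>\<close>
  define c1 where "c1 = C\<^sup>2 * real m + 1"
  have "c1 > 0" by (simp add: c1_def add_nonneg_pos)
  define \<epsilon>' where "\<epsilon>' = \<epsilon> / sqrt c1"
  have "\<epsilon>' > 0" using \<open>\<epsilon> > 0\<close> \<open>c1 > 0\<close> by (simp add: \<epsilon>'_def)
  define R where "R = (\<lambda>K j \<omega>. Q j \<omega> * indicator {\<omega>. \<epsilon>' * sqrt (real K) < sqrt (Q j \<omega>)} \<omega> :: real)"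
  define G where "G = (\<lambda>K j. real_cond_exp P (F j) (R K j))"
  have R_meas [measurable]: "R K j \<in> borel_measurable P" for K j
    unfolding R_def by measurable
  have R: "0 \<le> R K j \<omega>" "R K j \<omega> \<le> Q j \<omega>" for K j \<omega>
    using Q_nonneg[of j \<omega>] by (auto simp: R_def indicator_def)
  have R_int: "integrable P (R K j)" for K j
    by (rule Bochner_Integration.integrable_bound[OF Q_integrable[of j]])
       (use R in \<open>auto intro!: AE_I2 order_trans[OF _ abs_ge_self]\<close>)
  have G_bound: "AE \<omega> in P. 0 \<le> G K j \<omega> \<and> G K j \<omega> \<le> W j \<omega>" for K j
  proof -
    interpret Fj: sigma_finite_subalgebra P "F j" by (rule sigma_finite_F)
    have "AE \<omega> in P. 0 \<le> G K j \<omega>"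
      unfolding G_def using R by (intro Fj.real_cond_exp_pos) auto
    moreover have "AE \<omega> in P. G K j \<omega> \<le> W j \<omega>"
      unfolding G_def W_def using R by (intro Fj.real_cond_exp_mono R_int Q_integrable) auto
    ultimately show ?thesis by eventually_elim simp
  qed
  have G_int: "integrable P (\<lambda>\<omega>. trunc j \<omega> * G K j \<omega>)"
    "(\<integral>\<omega>. trunc j \<omega> * G K j \<omega> \<partial>P) = (\<integral>\<omega>. trunc j \<omega> * R K j \<omega> \<partial>P)" for K j
  proof -
    interpret Fj: sigma_finite_subalgebra P "F j" by (rule sigma_finite_F)
    show "integrable P (\<lambda>\<omega>. trunc j \<omega> * G K j \<omega>)"
      "(\<integral>\<omega>. trunc j \<omega> * G K j \<omega> \<partial>P) = (\<integral>\<omega>. trunc j \<omega> * R K j \<omega> \<partial>P)"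
      unfolding G_def
      using Fj.real_cond_exp_intg[OF trunc_mult_integrable[OF R_int] trunc_measurable R_meas] by auto
  qed
  have pointwise: "(D a j \<omega>)\<^sup>2 * indicator {\<omega>. \<epsilon> * sqrt (real K) < \<bar>D a j \<omega>\<bar>} \<omega> \<le> c1 * (trunc j \<omega> * R K j \<omega>)"
    if "\<omega> \<in> space P" for K j \<omega>
  proof (cases "\<epsilon> * sqrt (real K) < \<bar>D a j \<omega>\<bar>")
    case True
    have D2: "(D a j \<omega>)\<^sup>2 \<le> c1 * (trunc j \<omega> * Q j \<omega>)"
      using D_square_le[OF that, of j] Q_nonneg[of j \<omega>] trunc_01[of j \<omega>]
      by (simp add: c1_def distrib_right add_increasing2)
    also have "\<dots> \<le> c1 * Q j \<omega>"
      using \<open>c1 > 0\<close> Q_nonneg trunc_01 by (intro mult_left_mono mult_left_le_one_le) auto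
    finally have "\<bar>D a j \<omega>\<bar> \<le> sqrt c1 * sqrt (Q j \<omega>)"
      using real_sqrt_le_mono by (fastforce simp: real_sqrt_mult)
    with True have "\<epsilon> * sqrt (real K) < sqrt c1 * sqrt (Q j \<omega>)" by simp
    then have "\<epsilon>' * sqrt (real K) < sqrt (Q j \<omega>)"
      using \<open>c1 > 0\<close> by (simp add: \<epsilon>'_def field_simps)
    with True D2 show ?thesis by (simp add: R_def)
  next
    case False
    then show ?thesis using \<open>c1 > 0\<close> R trunc_01 by simp
  qed
  define H where "H = (\<lambda>K \<omega>. (1 / real K) * (\<Sum>j<K. trunc j \<omega> * G K j \<omega>))"
  have G_meas [measurable]: "G K j \<in> borel_measurable P" for K j by (simp add: G_def)
  have H_meas [measurable]: "H K \<in> borel_measurable P" for K unfolding H_def by measurable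
  have upper: "(1 / real K) * (\<Sum>j<K. \<integral>\<omega>. (D a j \<omega>)\<^sup>2 * indicator {\<omega>. \<epsilon> * sqrt (real K) < \<bar>D a j \<omega>\<bar>} \<omega> \<partial>P)
      \<le> c1 * (\<integral>\<omega>. H K \<omega> \<partial>P)" for K
  proof -
    have "(\<integral>\<omega>. (D a j \<omega>)\<^sup>2 * indicator {\<omega>. \<epsilon> * sqrt (real K) < \<bar>D a j \<omega>\<bar>} \<omega> \<partial>P)
        \<le> c1 * (\<integral>\<omega>. trunc j \<omega> * G K j \<omega> \<partial>P)" for j
    proof -
      have "integrable P (\<lambda>\<omega>. (D a j \<omega>)\<^sup>2 * indicator {\<omega>. \<epsilon> * sqrt (real K) < \<bar>D a j \<omega>\<bar>} \<omega>)"
        by (rule Bochner_Integration.integrable_bound[OF D_square_integrable[of j]]) (auto split: split_indicator)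
      then have "(\<integral>\<omega>. (D a j \<omega>)\<^sup>2 * indicator {\<omega>. \<epsilon> * sqrt (real K) < \<bar>D a j \<omega>\<bar>} \<omega> \<partial>P)
          \<le> (\<integral>\<omega>. c1 * (trunc j \<omega> * R K j \<omega>) \<partial>P)"
        using trunc_mult_integrable[OF R_int] pointwise by (intro integral_mono) auto
      then show ?thesis by (simp add: G_int)
    qed
    then have "(\<Sum>j<K. \<integral>\<omega>. (D a j \<omega>)\<^sup>2 * indicator {\<omega>. \<epsilon> * sqrt (real K) < \<bar>D a j \<omega>\<bar>} \<omega> \<partial>P)
        \<le> (\<Sum>j<K. c1 * (\<integral>\<omega>. trunc j \<omega> * G K j \<omega> \<partial>P))"
      by (rule sum_mono)
    then have "(1 / real K) * (\<Sum>j<K. \<integral>\<omega>. (D a j \<omega>)\<^sup>2 * indicator {\<omega>. \<epsilon> * sqrt (real K) < \<bar>D a j \<omega>\<bar>} \<omega> \<partial>P)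
        \<le> (1 / real K) * (\<Sum>j<K. c1 * (\<integral>\<omega>. trunc j \<omega> * G K j \<omega> \<partial>P))"
      by (rule mult_left_mono) simp
    also have "\<dots> = c1 * ((1 / real K) * (\<Sum>j<K. \<integral>\<omega>. trunc j \<omega> * G K j \<omega> \<partial>P))"
      by (simp only: sum_distrib_left[symmetric] mult.left_commute)
    also have "(1 / real K) * (\<Sum>j<K. \<integral>\<omega>. trunc j \<omega> * G K j \<omega> \<partial>P) = (\<integral>\<omega>. H K \<omega> \<partial>P)"
      unfolding H_def using G_int(1) by simp
    finally show ?thesis .
  qed
  have "(\<lambda>K. \<integral>\<omega>. H K \<omega> \<partial>P) \<longlonglongrightarrow> (\<integral>\<omega>. 0 \<partial>P)"
  proof (rule integral_dominated_convergence[where w = "\<lambda>_. c"])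
    have GA: "AE \<omega> in P. \<forall>K j. 0 \<le> G K j \<omega> \<and> G K j \<omega> \<le> W j \<omega>"
      unfolding AE_all_countable using G_bound by blast
    have tG: "0 \<le> trunc j \<omega> * G K j \<omega> \<and> trunc j \<omega> * G K j \<omega> \<le> c \<and> trunc j \<omega> * G K j \<omega> \<le> G K j \<omega>"
      if "0 \<le> G K j \<omega> \<and> G K j \<omega> \<le> W j \<omega>" for K j \<omega>
      using that c_nonneg by (auto simp: trunc_def)
    show "AE \<omega> in P. norm (H K \<omega>) \<le> c" for K
      using GA
    proof eventually_elim
      case (elim \<omega>)
      have "(\<Sum>j<K. trunc j \<omega> * G K j \<omega>) \<le> (\<Sum>j<K. c)"
        by (rule sum_mono) (use tG elim in blast)
      moreover have "0 \<le> (\<Sum>j<K. trunc j \<omega> * G K j \<omega>)"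
        by (rule sum_nonneg) (use tG elim in blast)
      ultimately have "0 \<le> (\<Sum>j<K. trunc j \<omega> * G K j \<omega>) \<and> (\<Sum>j<K. trunc j \<omega> * G K j \<omega>) \<le> real K * c"
        by simp
      then show ?case
        using c_nonneg by (cases "K = 0") (auto simp: H_def field_simps)
    qed
    show "AE \<omega> in P. (\<lambda>K. H K \<omega>) \<longlonglongrightarrow> 0"
      using GA lindeberg[OF \<open>\<epsilon>' > 0\<close>]
    proof eventually_elim
      case (elim \<omega>)
      have lim: "(\<lambda>K. (1 / real K) * (\<Sum>j<K. G K j \<omega>)) \<longlonglongrightarrow> 0"
        using elim(2) by (simp add: G_def R_def[abs_def])
      show ?case
      proof (rule tendsto_sandwich[OF _ _ tendsto_const lim])
        show "\<forall>\<^sub>F K in sequentially. 0 \<le> H K \<omega>"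
          using tG elim(1) by (intro always_eventually allI) (auto simp: H_def intro!: sum_nonneg divide_nonneg_nonneg)
        show "\<forall>\<^sub>F K in sequentially. H K \<omega> \<le> 1 / real K * (\<Sum>j<K. G K j \<omega>)"
          unfolding H_def using tG elim(1) by (intro always_eventually allI mult_left_mono sum_mono) auto
      qed
    qed
  qed auto
  then have lim: "(\<lambda>K. c1 * (\<integral>\<omega>. H K \<omega> \<partial>P)) \<longlonglongrightarrow> 0"
    using tendsto_mult_right_zero by simp
  show ?thesis
  proof (rule tendsto_sandwich[OF _ _ tendsto_const lim])
    show "\<forall>\<^sub>F K in sequentially. (1 / real K) * (\<Sum>j<K. \<integral>\<omega>. (D a j \<omega>)\<^sup>2 *
        indicator {\<omega>. \<epsilon> * sqrt (real K) < \<bar>D a j \<omega>\<bar>} \<omega> \<partial>P) \<le> c1 * (\<integral>\<omega>. H K \<omega> \<partial>P)"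
      using upper by (intro always_eventually allI)
  qed (auto intro!: always_eventually divide_nonneg_nonneg sum_nonneg integral_nonneg_AE)
qed

theorem char_weighted_sum_tendsto:
  assumes "\<tau>2 \<ge> 0"
    and "AE \<omega> in P. (\<lambda>j. \<Sum>i\<in>Bl j. \<Sum>l\<in>Bl j. a i \<omega> * a l \<omega> *
      real_cond_exp P (F j) (\<lambda>\<omega>. e i \<omega> * e l \<omega>) \<omega>) \<longlonglongrightarrow> \<tau>2"
    and "\<And>\<epsilon>. \<epsilon> > 0 \<Longrightarrow> AE \<omega> in P. (\<lambda>K. (1 / real K) * (\<Sum>j<K. real_cond_exp P (F j)
      (\<lambda>\<omega>. Q j \<omega> * indicator {\<omega>. \<epsilon> * sqrt (real K) < sqrt (Q j \<omega>)} \<omega>) \<omega>)) \<longlonglongrightarrow> 0"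
  shows "(\<lambda>K. \<integral>\<omega>. iexp (t / sqrt (real K) * (\<Sum>j<K. D a j \<omega>)) \<partial>P) \<longlonglongrightarrow> complex_of_real (exp (- (t\<^sup>2 * \<tau>2 / 2)))"
proof -
  interpret martingale_differences P F "D a" by (rule martingale_differences_D)
  show ?thesis
    by (rule char_partial_sum_tendsto[OF assms(1) D_conditional_variance_tendsto[OF assms(2)] D_lindeberg[OF assms(3)]])
qed

end

end


section \<open>Convergence in probability\<close>

text \<open>The properties \<open>Q k\<close> hold with probability tending to one. The exceptional events are covered by
  measurable sets \<open>A\<close>, so that \<open>Q k\<close> itself need not be measurable.\<close>
definition with_high_prob :: "'w measure \<Rightarrow> (nat \<Rightarrow> 'w \<Rightarrow> bool) \<Rightarrow> bool" where
  "with_high_prob P Q \<longleftrightarrow>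
    (\<forall>\<delta>>0. \<forall>\<^sub>F k in sequentially. \<exists>A\<in>sets P. measure P A < \<delta> \<and> (\<forall>\<omega>\<in>space P - A. Q k \<omega>))"

text \<open>Upper boundedness in probability, for nonnegative sequences also known as tightness. Finitely many
  terms may be disregarded.\<close>
definition bounded_in_prob :: "'w measure \<Rightarrow> (nat \<Rightarrow> 'w \<Rightarrow> real) \<Rightarrow> bool" where
  "bounded_in_prob P R \<longleftrightarrow>
    (\<forall>\<delta>>0. \<exists>b. \<forall>\<^sub>F k in sequentially. \<exists>A\<in>sets P. measure P A < \<delta> \<and> (\<forall>\<omega>\<in>space P - A. R k \<omega> \<le> b))"

lemma with_high_prob_mono:
  assumes "with_high_prob P Q" "\<forall>\<^sub>F k in sequentially. \<forall>\<omega>\<in>space P. Q k \<omega> \<longrightarrow> R k \<omega>"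
  shows "with_high_prob P R"
  unfolding with_high_prob_def
proof (intro allI impI)
  fix \<delta> :: real assume "\<delta> > 0"
  with assms(1) have "\<forall>\<^sub>F k in sequentially. \<exists>A\<in>sets P. measure P A < \<delta> \<and> (\<forall>\<omega>\<in>space P - A. Q k \<omega>)"
    by (simp add: with_high_prob_def)
  with assms(2) show "\<forall>\<^sub>F k in sequentially. \<exists>A\<in>sets P. measure P A < \<delta> \<and> (\<forall>\<omega>\<in>space P - A. R k \<omega>)"
    by eventually_elim blast
qed

lemma bounded_in_prob_mono:
  assumes "bounded_in_prob P R" "\<forall>\<^sub>F k in sequentially. \<forall>\<omega>\<in>space P. R' k \<omega> \<le> R k \<omega>"
  shows "bounded_in_prob P R'"
  unfolding bounded_in_prob_def
proof (intro allI impI)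
  fix \<delta> :: real assume "\<delta> > 0"
  then obtain b where "\<forall>\<^sub>F k in sequentially. \<exists>A\<in>sets P. measure P A < \<delta> \<and> (\<forall>\<omega>\<in>space P - A. R k \<omega> \<le> b)"
    using assms(1) unfolding bounded_in_prob_def by blast
  with assms(2) have "\<forall>\<^sub>F k in sequentially. \<exists>A\<in>sets P. measure P A < \<delta> \<and> (\<forall>\<omega>\<in>space P - A. R' k \<omega> \<le> b)"
  proof eventually_elim
    case (elim k)
    then obtain A where "A \<in> sets P" "measure P A < \<delta>" "\<forall>\<omega>\<in>space P - A. R k \<omega> \<le> b" by blast
    with elim(1) show ?case
      by (intro bexI[of _ A] conjI ballI) (auto intro: order_trans)
  qed
  then show "\<exists>b. \<forall>\<^sub>F k in sequentially. \<exists>A\<in>sets P. measure P A < \<delta> \<and> (\<forall>\<omega>\<in>space P - A. R' k \<omega> \<le> b)" ..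
qed

context prob_space
begin

lemma with_high_prob_conj:
  assumes "with_high_prob M Q" "with_high_prob M R"
  shows "with_high_prob M (\<lambda>k \<omega>. Q k \<omega> \<and> R k \<omega>)"
  unfolding with_high_prob_def
proof (intro allI impI)
  fix \<delta> :: real assume "\<delta> > 0"
  then have "\<forall>\<^sub>F k in sequentially. \<exists>A\<in>sets M. prob A < \<delta> / 2 \<and> (\<forall>\<omega>\<in>space M - A. Q k \<omega>)"
    "\<forall>\<^sub>F k in sequentially. \<exists>A\<in>sets M. prob A < \<delta> / 2 \<and> (\<forall>\<omega>\<in>space M - A. R k \<omega>)"
    using assms half_gt_zero[OF \<open>\<delta> > 0\<close>] unfolding with_high_prob_def by blast+
  then show "\<forall>\<^sub>F k in sequentially. \<exists>A\<in>sets M. prob A < \<delta> \<and> (\<forall>\<omega>\<in>space M - A. Q k \<omega> \<and> R k \<omega>)"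
  proof eventually_elim
    case (elim k)
    then obtain A B where "A \<in> sets M" "prob A < \<delta> / 2" "\<forall>\<omega>\<in>space M - A. Q k \<omega>"
      "B \<in> sets M" "prob B < \<delta> / 2" "\<forall>\<omega>\<in>space M - B. R k \<omega>" by blast
    moreover have "prob (A \<union> B) \<le> prob A + prob B"
      using \<open>A \<in> sets M\<close> \<open>B \<in> sets M\<close> by (rule measure_Un_le)
    ultimately show ?case by (intro bexI[of _ "A \<union> B"]) auto
  qed
qed

lemma with_high_prob_all_finite:
  assumes "finite I" "\<And>i. i \<in> I \<Longrightarrow> with_high_prob M (Q i)"
  shows "with_high_prob M (\<lambda>k \<omega>. \<forall>i\<in>I. Q i k \<omega>)"
  using assms
proof (induction I rule: finite_induct)
  case empty
  show ?case by (auto simp: with_high_prob_def intro!: always_eventually bexI[of _ "{}"])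
next
  case (insert i I)
  then have "with_high_prob M (\<lambda>k \<omega>. Q i k \<omega> \<and> (\<forall>i\<in>I. Q i k \<omega>))"
    by (intro with_high_prob_conj) auto
  then show ?case by simp
qed

text \<open>Almost sure convergence implies convergence in probability.\<close>
lemma with_high_prob_AE:
  assumes meas: "\<And>k. {\<omega> \<in> space M. Q k \<omega>} \<in> sets M"
    and AE: "AE \<omega> in M. \<forall>\<^sub>F k in sequentially. Q k \<omega>"
  shows "with_high_prob M Q"
  unfolding with_high_prob_def
proof (intro allI impI)
  fix \<delta> :: real assume "\<delta> > 0"
  define A where "A = (\<lambda>K. \<Union>k\<in>{K..}. space M - {\<omega> \<in> space M. Q k \<omega>})"
  have A: "A K \<in> sets M" for K
    unfolding A_def using meas by (intro sets.countable_UN' ) auto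
  have "(\<lambda>K. prob (A K)) \<longlonglongrightarrow> prob (\<Inter>K. A K)"
    by (rule finite_Lim_measure_decseq) (use A in \<open>auto simp: A_def decseq_def\<close>)
  also have "prob (\<Inter>K. A K) = 0"
  proof -
    have "AE \<omega> in M. \<omega> \<notin> (\<Inter>K. A K)"
      using AE by eventually_elim (auto simp: A_def eventually_sequentially)
    moreover have "(\<Inter>K. A K) \<in> sets M" using A by auto
    ultimately show ?thesis by (simp add: prob_eq_0)
  qed
  finally have "\<forall>\<^sub>F K in sequentially. prob (A K) < \<delta>"
    using \<open>\<delta> > 0\<close> by (auto dest: order_tendstoD)
  then show "\<forall>\<^sub>F k in sequentially. \<exists>A\<in>sets M. prob A < \<delta> \<and> (\<forall>\<omega>\<in>space M - A. Q k \<omega>)"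
  proof eventually_elim
    case (elim K)
    with A[of K] show ?case by (intro bexI[of _ "A K"]) (auto simp: A_def)
  qed
qed

lemma markov:
  fixes R :: "'a \<Rightarrow> real"
  assumes "integrable M R" "\<And>\<omega>. \<omega> \<in> space M \<Longrightarrow> 0 \<le> R \<omega>" "\<epsilon> > 0"
  shows "{\<omega> \<in> space M. \<epsilon> < R \<omega>} \<in> sets M" "prob {\<omega> \<in> space M. \<epsilon> < R \<omega>} \<le> expectation R / \<epsilon>"
proof -
  have [measurable]: "R \<in> borel_measurable M" using assms(1) by auto
  show "{\<omega> \<in> space M. \<epsilon> < R \<omega>} \<in> sets M" by measurable
  have "prob {\<omega> \<in> space M. \<epsilon> < R \<omega>} \<le> prob {\<omega> \<in> space M. \<epsilon> \<le> R \<omega>}"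
    by (intro finite_measure_mono) auto
  also have "\<dots> \<le> expectation R / \<epsilon>"
    by (rule integral_Markov_inequality_measure[where A = "space M", OF assms(1)]) (use assms in auto)
  finally show "prob {\<omega> \<in> space M. \<epsilon> < R \<omega>} \<le> expectation R / \<epsilon>" .
qed

lemma with_high_prob_markov:
  fixes R :: "nat \<Rightarrow> 'a \<Rightarrow> real"
  assumes "\<And>k. integrable M (R k)" "\<And>k \<omega>. \<omega> \<in> space M \<Longrightarrow> 0 \<le> R k \<omega>"
    and "(\<lambda>k. expectation (R k)) \<longlonglongrightarrow> 0" "\<epsilon> > 0"
  shows "with_high_prob M (\<lambda>k \<omega>. R k \<omega> \<le> \<epsilon>)"
  unfolding with_high_prob_def
proof (intro allI impI)
  fix \<delta> :: real assume "\<delta> > 0"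
  with \<open>\<epsilon> > 0\<close> have "\<forall>\<^sub>F k in sequentially. expectation (R k) < \<delta> * \<epsilon>"
    by (intro order_tendstoD(2)[OF assms(3)]) simp
  then show "\<forall>\<^sub>F k in sequentially. \<exists>A\<in>sets M. prob A < \<delta> \<and> (\<forall>\<omega>\<in>space M - A. R k \<omega> \<le> \<epsilon>)"
  proof eventually_elim
    case (elim k)
    note m = markov[OF assms(1)[of k] assms(2) \<open>\<epsilon> > 0\<close>]
    have "expectation (R k) / \<epsilon> < \<delta>" using elim \<open>\<epsilon> > 0\<close> by (simp add: field_simps)
    with m show ?case
      by (intro bexI[of _ "{\<omega> \<in> space M. \<epsilon> < R k \<omega>}"]) auto
  qed
qed

lemma bounded_in_prob_moment:
  fixes R :: "nat \<Rightarrow> 'a \<Rightarrow> real"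
  assumes "\<And>k. integrable M (R k)" "\<And>k \<omega>. \<omega> \<in> space M \<Longrightarrow> 0 \<le> R k \<omega>"
    and "\<And>k. expectation (R k) \<le> C"
  shows "bounded_in_prob M R"
  unfolding bounded_in_prob_def
proof (intro allI impI)
  fix \<delta> :: real assume "\<delta> > 0"
  define b where "b = (\<bar>C\<bar> + 1) / \<delta>"
  have "b > 0" using \<open>\<delta> > 0\<close> by (simp add: b_def)
  have "\<exists>A\<in>sets M. prob A < \<delta> \<and> (\<forall>\<omega>\<in>space M - A. R k \<omega> \<le> b)" for k
  proof -
    note m = markov[OF assms(1)[of k] assms(2) \<open>b > 0\<close>]
    have "expectation (R k) < \<delta> * b" using assms(3)[of k] \<open>\<delta> > 0\<close> by (simp add: b_def)
    then have "expectation (R k) / b < \<delta>" using \<open>b > 0\<close> by (simp add: field_simps)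
    with m show ?thesis
      by (intro bexI[of _ "{\<omega> \<in> space M. b < R k \<omega>}"]) auto
  qed
  then show "\<exists>b. \<forall>\<^sub>F k in sequentially. \<exists>A\<in>sets M. prob A < \<delta> \<and> (\<forall>\<omega>\<in>space M - A. R k \<omega> \<le> b)"
    by (intro exI[of _ b] always_eventually) blast
qed

lemma bounded_in_prob_whp:
  assumes "with_high_prob M (\<lambda>k \<omega>. R k \<omega> \<le> b)"
  shows "bounded_in_prob M R"
  using assms unfolding with_high_prob_def bounded_in_prob_def by blast

lemma bounded_in_prob_add:
  assumes "bounded_in_prob M R" "bounded_in_prob M R'"
  shows "bounded_in_prob M (\<lambda>k \<omega>. R k \<omega> + R' k \<omega>)"
  unfolding bounded_in_prob_def
proof (intro allI impI)
  fix \<delta> :: real assume "\<delta> > 0"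
  then obtain b where b: "\<forall>\<^sub>F k in sequentially. \<exists>A\<in>sets M. prob A < \<delta> / 2 \<and> (\<forall>\<omega>\<in>space M - A. R k \<omega> \<le> b)"
    using assms(1) half_gt_zero[OF \<open>\<delta> > 0\<close>] unfolding bounded_in_prob_def by blast
  obtain b' where b': "\<forall>\<^sub>F k in sequentially. \<exists>A\<in>sets M. prob A < \<delta> / 2 \<and> (\<forall>\<omega>\<in>space M - A. R' k \<omega> \<le> b')"
    using assms(2) half_gt_zero[OF \<open>\<delta> > 0\<close>] unfolding bounded_in_prob_def by blast
  from b b' have "\<forall>\<^sub>F k in sequentially. \<exists>A\<in>sets M. prob A < \<delta> \<and> (\<forall>\<omega>\<in>space M - A. R k \<omega> + R' k \<omega> \<le> b + b')"
  proof eventually_elim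
    case (elim k)
    then obtain A B where "A \<in> sets M" "prob A < \<delta> / 2" "\<forall>\<omega>\<in>space M - A. R k \<omega> \<le> b"
      "B \<in> sets M" "prob B < \<delta> / 2" "\<forall>\<omega>\<in>space M - B. R' k \<omega> \<le> b'" by blast
    moreover have "prob (A \<union> B) \<le> prob A + prob B"
      using \<open>A \<in> sets M\<close> \<open>B \<in> sets M\<close> by (rule measure_Un_le)
    ultimately show ?case by (intro bexI[of _ "A \<union> B"]) (auto intro: add_mono)
  qed
  then show "\<exists>b. \<forall>\<^sub>F k in sequentially. \<exists>A\<in>sets M. prob A < \<delta> \<and> (\<forall>\<omega>\<in>space M - A. R k \<omega> + R' k \<omega> \<le> b)" ..
qed

text \<open>To show that a property holds with probability tending to one, a sequence that is bounded in
  probability may be assumed to be bounded by a constant.\<close>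
lemma with_high_prob_bounded:
  assumes R: "bounded_in_prob M R"
    and Q: "\<And>b. b > 0 \<Longrightarrow> with_high_prob M (\<lambda>k \<omega>. R k \<omega> \<le> b \<longrightarrow> Q k \<omega>)"
  shows "with_high_prob M Q"
  unfolding with_high_prob_def
proof (intro allI impI)
  fix \<delta> :: real assume "\<delta> > 0"
  then obtain b where b: "\<forall>\<^sub>F k in sequentially. \<exists>A\<in>sets M. prob A < \<delta> / 2 \<and> (\<forall>\<omega>\<in>space M - A. R k \<omega> \<le> b)"
    using R half_gt_zero[OF \<open>\<delta> > 0\<close>] unfolding bounded_in_prob_def by blast
  have "\<forall>\<^sub>F k in sequentially. \<exists>A\<in>sets M. prob A < \<delta> / 2 \<and> (\<forall>\<omega>\<in>space M - A. R k \<omega> \<le> max b 1 \<longrightarrow> Q k \<omega>)"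
  proof -
    have "max b 1 > 0" by simp
    from Q[OF this] show ?thesis
      using half_gt_zero[OF \<open>\<delta> > 0\<close>] unfolding with_high_prob_def by blast
  qed
  with b show "\<forall>\<^sub>F k in sequentially. \<exists>A\<in>sets M. prob A < \<delta> \<and> (\<forall>\<omega>\<in>space M - A. Q k \<omega>)"
  proof eventually_elim
    case (elim k)
    then obtain A B where "A \<in> sets M" "prob A < \<delta> / 2" "\<forall>\<omega>\<in>space M - A. R k \<omega> \<le> b"
      "B \<in> sets M" "prob B < \<delta> / 2" "\<forall>\<omega>\<in>space M - B. R k \<omega> \<le> max b 1 \<longrightarrow> Q k \<omega>" by blast
    moreover have "prob (A \<union> B) \<le> prob A + prob B"
      using \<open>A \<in> sets M\<close> \<open>B \<in> sets M\<close> by (rule measure_Un_le)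
    ultimately show ?case by (intro bexI[of _ "A \<union> B"]) (auto simp: le_max_iff_disj)
  qed
qed

text \<open>Slutsky's theorem, in terms of characteristic functions.\<close>
lemma char_tendsto_close:
  fixes Z T :: "nat \<Rightarrow> 'a \<Rightarrow> 'b::euclidean_space"
  assumes Z [measurable]: "\<And>k. Z k \<in> borel_measurable M" and T [measurable]: "\<And>k. T k \<in> borel_measurable M"
    and close: "\<And>\<epsilon>. \<epsilon> > 0 \<Longrightarrow> with_high_prob M (\<lambda>k \<omega>. norm (Z k \<omega> - T k \<omega>) \<le> \<epsilon>)"
    and char: "(\<lambda>k. \<integral>\<omega>. iexp (u \<bullet> T k \<omega>) \<partial>M) \<longlonglongrightarrow> \<phi>"
  shows "(\<lambda>k. \<integral>\<omega>. iexp (u \<bullet> Z k \<omega>) \<partial>M) \<longlonglongrightarrow> \<phi>"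
proof -
  have "(\<lambda>k. (\<integral>\<omega>. iexp (u \<bullet> Z k \<omega>) \<partial>M) - (\<integral>\<omega>. iexp (u \<bullet> T k \<omega>) \<partial>M)) \<longlonglongrightarrow> 0"
  proof (rule tendstoI)
    fix r :: real assume "r > 0"
    define \<epsilon> where "\<epsilon> = r / 2 / (norm u + 1)"
    have "norm u + 1 > 0" by (simp add: add_nonneg_pos)
    then have "\<epsilon> > 0" using \<open>r > 0\<close> by (simp add: \<epsilon>_def)
    have "norm u * \<epsilon> \<le> (norm u + 1) * \<epsilon>" using \<open>\<epsilon> > 0\<close> by (intro mult_right_mono) auto
    also have "\<dots> = r / 2"
    proof -
      have "y * (r / 2 / y) = r / 2" if "y > 0" for y :: real using that by simp
      from this[OF \<open>norm u + 1 > 0\<close>] show ?thesis unfolding \<epsilon>_def .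
    qed
    finally have u\<epsilon>: "norm u * \<epsilon> \<le> r / 2" .
    have "\<forall>\<^sub>F k in sequentially. \<exists>A\<in>sets M. prob A < r / 4 \<and> (\<forall>\<omega>\<in>space M - A. norm (Z k \<omega> - T k \<omega>) \<le> \<epsilon>)"
    proof -
      have "r / 4 > 0" using \<open>r > 0\<close> by simp
      then show ?thesis
        using close[OF \<open>\<epsilon> > 0\<close>] unfolding with_high_prob_def by blast
    qed
    then show "\<forall>\<^sub>F k in sequentially. dist ((\<integral>\<omega>. iexp (u \<bullet> Z k \<omega>) \<partial>M) - (\<integral>\<omega>. iexp (u \<bullet> T k \<omega>) \<partial>M)) 0 < r"
    proof eventually_elim
      case (elim k)
      then obtain A where A [measurable]: "A \<in> sets M" and pA: "prob A < r / 4"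
        and near: "\<And>\<omega>. \<omega> \<in> space M - A \<Longrightarrow> norm (Z k \<omega> - T k \<omega>) \<le> \<epsilon>" by blast
      have int: "integrable M (\<lambda>\<omega>. iexp (u \<bullet> Z k \<omega>))" "integrable M (\<lambda>\<omega>. iexp (u \<bullet> T k \<omega>))"
        by (auto intro!: integrable_const_bound[of _ 1])
      have pointwise: "cmod (iexp (u \<bullet> Z k \<omega>) - iexp (u \<bullet> T k \<omega>)) \<le> norm u * \<epsilon> + 2 * indicator A \<omega>" if "\<omega> \<in> space M" for \<omega>
      proof (cases "\<omega> \<in> A")
        case True
        have "cmod (iexp (u \<bullet> Z k \<omega>) - iexp (u \<bullet> T k \<omega>)) \<le> 1 + 1"
          by (rule order_trans[OF norm_triangle_ineq4]) simp
        moreover have "0 \<le> norm u * \<epsilon>" using \<open>\<epsilon> > 0\<close> by simp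
        ultimately show ?thesis using True by simp
      next
        case False
        have "iexp (u \<bullet> Z k \<omega>) - iexp (u \<bullet> T k \<omega>) = iexp (u \<bullet> T k \<omega>) * (iexp (u \<bullet> (Z k \<omega> - T k \<omega>)) - 1)"
          by (simp add: inner_diff_right algebra_simps exp_diff)
        also have "cmod \<dots> = cmod (iexp (u \<bullet> (Z k \<omega> - T k \<omega>)) - 1)"
          by (simp add: norm_mult)
        also have "\<dots> \<le> \<bar>u \<bullet> (Z k \<omega> - T k \<omega>)\<bar>"
          using iexp_approx1[of "u \<bullet> (Z k \<omega> - T k \<omega>)" 0] by simp
        also have "\<dots> \<le> norm u * norm (Z k \<omega> - T k \<omega>)"
          by (rule Cauchy_Schwarz_ineq2)
        also have "\<dots> \<le> norm u * \<epsilon>"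
          using near[of \<omega>] that False by (intro mult_left_mono) auto
        finally show ?thesis using False by simp
      qed
      have "dist ((\<integral>\<omega>. iexp (u \<bullet> Z k \<omega>) \<partial>M) - (\<integral>\<omega>. iexp (u \<bullet> T k \<omega>) \<partial>M)) 0
          = cmod (\<integral>\<omega>. iexp (u \<bullet> Z k \<omega>) - iexp (u \<bullet> T k \<omega>) \<partial>M)"
        using int by (simp add: dist_norm)
      also have "\<dots> \<le> (\<integral>\<omega>. cmod (iexp (u \<bullet> Z k \<omega>) - iexp (u \<bullet> T k \<omega>)) \<partial>M)"
        by (rule integral_norm_bound)
      also have "\<dots> \<le> (\<integral>\<omega>. norm u * \<epsilon> + 2 * indicator A \<omega> \<partial>M)"
      proof (rule integral_mono[OF _ _ pointwise])
        show "integrable M (\<lambda>\<omega>. cmod (iexp (u \<bullet> Z k \<omega>) - iexp (u \<bullet> T k \<omega>)))"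
          by (intro integrable_norm Bochner_Integration.integrable_diff int)
        show "integrable M (\<lambda>\<omega>. norm u * \<epsilon> + 2 * indicator A \<omega>)"
          by (auto simp: emeasure_eq_measure)
      qed
      also have "\<dots> = norm u * \<epsilon> + 2 * prob A"
        by (simp add: prob_space emeasure_eq_measure)
      also have "\<dots> < r" using u\<epsilon> pA \<open>r > 0\<close> by simp
      finally show ?case .
    qed
  qed
  from tendsto_add[OF this char] show ?thesis by simp
qed

end


section \<open>Limits of scores and information\<close>

lemma norm_le_sum_abs_entries: "norm (A::real^'n^'m) \<le> (\<Sum>i\<in>UNIV. \<Sum>j\<in>UNIV. \<bar>A $ i $ j\<bar>)"
proof -
  have "norm A \<le> (\<Sum>i\<in>UNIV. norm (A $ i))"
    by (subst norm_vec_def, rule L2_set_le_sum) simp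
  also have "\<dots> \<le> (\<Sum>i\<in>UNIV. \<Sum>j\<in>UNIV. \<bar>A $ i $ j\<bar>)"
    by (intro sum_mono norm_le_l1_cart)
  finally show ?thesis .
qed

text \<open>Errors in blocks together with gradients \<open>g i\<close> and Hessian matrices \<open>H i\<close> of the mean response at the
  true parameter. The number \<open>n k\<close> is the sample size after the blocks \<open>0, \<dots>, k\<close>, and \<open>M\<close> is the limiting
  information per observation.\<close>
locale regression_scores = block_errors P F e Bl m c
  for P :: "'w measure" and F e Bl m c +
  fixes g :: "nat \<Rightarrow> 'w \<Rightarrow> real^'p" and H :: "nat \<Rightarrow> 'w \<Rightarrow> real^'p^'p"
    and M :: "real^'p^'p" and n :: "nat \<Rightarrow> nat" and \<sigma>2 Cb :: real
  assumes g_measurable: "\<And>i j. i \<in> Bl j \<Longrightarrow> g i \<in> borel_measurable (F j)"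
    and g_bound: "\<And>i j \<omega>. i \<in> Bl j \<Longrightarrow> \<omega> \<in> space P \<Longrightarrow> norm (g i \<omega>) \<le> Cb"
    and H_measurable: "\<And>i j. i \<in> Bl j \<Longrightarrow> H i \<in> borel_measurable (F j)"
    and H_bound: "\<And>i j \<omega>. i \<in> Bl j \<Longrightarrow> \<omega> \<in> space P \<Longrightarrow> norm (H i \<omega>) \<le> Cb"
    and n_pos: "\<And>k. n k > 0"
    and n_asymp: "(\<lambda>k. real (n k) / real (Suc k)) \<longlonglongrightarrow> real CARD('p)"
    and information: "AE \<omega> in P. (\<lambda>j. \<Sum>i\<in>Bl j. outer (g i \<omega>)) \<longlonglongrightarrow> real CARD('p) *\<^sub>R M"
    and variance: "\<And>u. AE \<omega> in P. (\<lambda>j. \<Sum>i\<in>Bl j. \<Sum>l\<in>Bl j. (u \<bullet> g i \<omega>) * (u \<bullet> g l \<omega>) *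
        real_cond_exp P (F j) (\<lambda>\<omega>. e i \<omega> * e l \<omega>) \<omega>) \<longlonglongrightarrow> \<sigma>2 * real CARD('p) * (u \<bullet> (M *v u))"
    and lindeberg: "\<And>\<epsilon>. \<epsilon> > 0 \<Longrightarrow> AE \<omega> in P. (\<lambda>K. (1 / real K) * (\<Sum>j<K. real_cond_exp P (F j)
      (\<lambda>\<omega>. Q j \<omega> * indicator {\<omega>. \<epsilon> * sqrt (real K) < sqrt (Q j \<omega>)} \<omega>) \<omega>)) \<longlonglongrightarrow> 0"
    and \<sigma>2_nonneg: "\<sigma>2 \<ge> 0" and M_nonneg: "\<And>u. 0 \<le> u \<bullet> (M *v u)"
begin

text \<open>The score, that is the sum of the gradients weighted by the errors, and its truncated version.\<close>
definition score :: "nat \<Rightarrow> 'w \<Rightarrow> real^'p" where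
  "score k \<omega> = (\<Sum>j<Suc k. \<Sum>i\<in>Bl j. e i \<omega> *\<^sub>R g i \<omega>)"

definition trunc_score :: "nat \<Rightarrow> 'w \<Rightarrow> real^'p" where
  "trunc_score k \<omega> = (\<Sum>j<Suc k. trunc j \<omega> *\<^sub>R (\<Sum>i\<in>Bl j. e i \<omega> *\<^sub>R g i \<omega>))"

text \<open>The truncated score, normalized by \<open>\<surd>((k + 1) p)\<close>, which is asymptotically equivalent to \<open>\<surd>(n k)\<close>.\<close>
definition T :: "nat \<Rightarrow> 'w \<Rightarrow> real^'p" where
  "T k \<omega> = (1 / sqrt (real (Suc k) * real CARD('p))) *\<^sub>R trunc_score k \<omega>"

text \<open>The accumulated information, and the sum of the Hessian matrices weighted by the errors.\<close>
definition info :: "nat \<Rightarrow> 'w \<Rightarrow> real^'p^'p" where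
  "info k \<omega> = (\<Sum>j<Suc k. \<Sum>i\<in>Bl j. outer (g i \<omega>))"

definition hess_score :: "nat \<Rightarrow> 'w \<Rightarrow> real^'p^'p" where
  "hess_score k \<omega> = (\<Sum>j<Suc k. \<Sum>i\<in>Bl j. e i \<omega> *\<^sub>R H i \<omega>)"

lemma block_score_measurable: "(\<lambda>\<omega>. \<Sum>i\<in>Bl j. e i \<omega> *\<^sub>R g i \<omega>) \<in> borel_measurable P"
  by (intro borel_measurable_sum borel_measurable_scaleR e_measurable measurable_from_subalg[OF subalgebra g_measurable])

lemma score_measurable [measurable]: "score k \<in> borel_measurable P"
  unfolding score_def by (intro borel_measurable_sum block_score_measurable)

lemma trunc_score_measurable [measurable]: "trunc_score k \<in> borel_measurable P"
  unfolding trunc_score_def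
  by (intro borel_measurable_sum borel_measurable_scaleR trunc_measurable_P block_score_measurable)

lemma T_measurable [measurable]: "T k \<in> borel_measurable P"
  unfolding T_def by measurable

lemma info_measurable [measurable]: "info k \<in> borel_measurable P"
proof -
  have "continuous_on UNIV (outer :: real^'p \<Rightarrow> _)"
    unfolding continuous_on_def by (intro ballI tendsto_outer tendsto_ident_at)
  then have [measurable]: "(outer :: real^'p \<Rightarrow> _) \<in> borel_measurable borel"
    by (rule borel_measurable_continuous_onI)
  have "(\<lambda>\<omega>. outer (g i \<omega>)) \<in> borel_measurable P" if "i \<in> Bl j" for i j
    using measurable_from_subalg[OF subalgebra g_measurable[OF that]] by measurable
  then show ?thesis
    unfolding info_def by (intro borel_measurable_sum)
qed

lemma predictable_g: "predictable (\<lambda>i \<omega>. u \<bullet> g i \<omega>) (norm u * Cb)"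
  unfolding predictable_def
proof (intro allI ballI conjI)
  fix i j assume i: "i \<in> Bl j"
  show "(\<lambda>\<omega>. u \<bullet> g i \<omega>) \<in> borel_measurable (F j)"
    using g_measurable[OF i] by measurable
  show "\<bar>u \<bullet> g i \<omega>\<bar> \<le> norm u * Cb" if "\<omega> \<in> space P" for \<omega>
    using g_bound[OF i that] by (intro order_trans[OF Cauchy_Schwarz_ineq2] mult_left_mono) auto
qed

lemma predictable_H: "predictable (\<lambda>i \<omega>. H i \<omega> $ a $ b) Cb"
  unfolding predictable_def
proof (intro allI ballI conjI)
  fix i j assume i: "i \<in> Bl j"
  have "continuous_on UNIV (\<lambda>A :: real^'p^'p. A $ a $ b)" by (intro continuous_intros)
  then have "(\<lambda>A :: real^'p^'p. A $ a $ b) \<in> borel_measurable borel"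
    by (rule borel_measurable_continuous_onI)
  from measurable_compose[OF H_measurable[OF i] this]
  show "(\<lambda>\<omega>. H i \<omega> $ a $ b) \<in> borel_measurable (F j)" .
  show "\<bar>H i \<omega> $ a $ b\<bar> \<le> Cb" if "\<omega> \<in> space P" for \<omega>
    using component_le_norm_cart[of "H i \<omega> $ a" b] Finite_Cartesian_Product.norm_nth_le[of "H i \<omega>" a] H_bound[OF i that]
    by linarith
qed

lemma inner_trunc_score: "u \<bullet> trunc_score k \<omega> = (\<Sum>j<Suc k. D (\<lambda>i \<omega>. u \<bullet> g i \<omega>) j \<omega>)"
  by (simp add: trunc_score_def D_def inner_sum_right mult.commute del: sum.lessThan_Suc)

text \<open>The projections of \<open>T\<close> are normalized sums of martingale differences.\<close>
lemma char_T:
  "(\<lambda>k. \<integral>\<omega>. iexp (u \<bullet> T k \<omega>) \<partial>P) \<longlonglongrightarrow> complex_of_real (exp (- (\<sigma>2 * (u \<bullet> (M *v u))) / 2))"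
proof -
  let ?p = "real CARD('p)"
  let ?\<tau>2 = "\<sigma>2 * ?p * (u \<bullet> (M *v u))"
  have "(\<lambda>K. \<integral>\<omega>. iexp ((1 / sqrt ?p) / sqrt (real K) * (\<Sum>j<K. D (\<lambda>i \<omega>. u \<bullet> g i \<omega>) j \<omega>)) \<partial>P)
      \<longlonglongrightarrow> complex_of_real (exp (- ((1 / sqrt ?p)\<^sup>2 * ?\<tau>2 / 2)))"
    using \<sigma>2_nonneg M_nonneg by (intro char_weighted_sum_tendsto[OF predictable_g] variance lindeberg) auto
  from LIMSEQ_Suc[OF this]
  have lim: "(\<lambda>k. \<integral>\<omega>. iexp ((1 / sqrt ?p) / sqrt (real (Suc k)) * (\<Sum>j<Suc k. D (\<lambda>i \<omega>. u \<bullet> g i \<omega>) j \<omega>)) \<partial>P)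
      \<longlonglongrightarrow> complex_of_real (exp (- ((1 / sqrt ?p)\<^sup>2 * ?\<tau>2 / 2)))" .
  have T: "(1 / sqrt ?p) / sqrt (real (Suc k)) * (\<Sum>j<Suc k. D (\<lambda>i \<omega>. u \<bullet> g i \<omega>) j \<omega>) = u \<bullet> T k \<omega>" for k \<omega>
    unfolding T_def inner_scaleR_right inner_trunc_score real_sqrt_mult by (simp del: sum.lessThan_Suc)
  have \<tau>2: "- ((1 / sqrt ?p)\<^sup>2 * ?\<tau>2 / 2) = - (\<sigma>2 * (u \<bullet> (M *v u))) / 2"
    by (simp add: power_divide)
  show ?thesis
    using lim unfolding T \<tau>2 .
qed

lemma T_bounded_in_prob: "bounded_in_prob P (\<lambda>k \<omega>. norm (T k \<omega>))"
proof -
  let ?p = "real CARD('p)"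
  let ?C = "Cb\<^sup>2 * real m * c"
  have comp: "(T k \<omega> $ a)\<^sup>2 = (1 / (real (Suc k) * ?p)) * (\<Sum>j<Suc k. D (\<lambda>i \<omega>. axis a 1 \<bullet> g i \<omega>) j \<omega>)\<^sup>2" for k \<omega> a
  proof -
    have "T k \<omega> $ a = (1 / sqrt (real (Suc k) * ?p)) * (axis a 1 \<bullet> trunc_score k \<omega>)"
      by (simp add: T_def inner_axis')
    then show ?thesis
      unfolding inner_trunc_score by (simp add: power_mult_distrib power_divide del: sum.lessThan_Suc)
  qed
  note mom = D_partial_sum_second_moment[OF predictable_g[of "axis a 1" for a], simplified norm_axis_1 mult_1]
  have int: "integrable P (\<lambda>\<omega>. (T k \<omega> $ a)\<^sup>2)" for k a
    unfolding comp using mom(1)[of a "Suc k"] by (rule integrable_mult_right)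
  have E: "(\<integral>\<omega>. (T k \<omega> $ a)\<^sup>2 \<partial>P) \<le> ?C" for k a
  proof -
    have "(\<integral>\<omega>. (T k \<omega> $ a)\<^sup>2 \<partial>P) \<le> (1 / (real (Suc k) * ?p)) * (real (Suc k) * ?C)"
      unfolding comp using mom(2)[of a "Suc k"]
      by (subst integral_mult_right_zero, intro mult_left_mono) auto
    also have "\<dots> = ?C / ?p" by simp
    also have "\<dots> \<le> ?C / 1"
      using c_nonneg by (intro divide_left_mono) (auto simp: Suc_le_eq)
    also have "\<dots> = ?C" by simp
    finally show ?thesis .
  qed
  have norm2: "(norm (T k \<omega>))\<^sup>2 = (\<Sum>a\<in>UNIV. (T k \<omega> $ a)\<^sup>2)" for k \<omega>
    unfolding power2_norm_eq_inner inner_vec_def by (simp add: power2_eq_square)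
  have "bounded_in_prob P (\<lambda>k \<omega>. 1 + (norm (T k \<omega>))\<^sup>2)"
  proof (rule bounded_in_prob_moment[where C = "1 + ?p * ?C"])
    fix k
    show "integrable P (\<lambda>\<omega>. 1 + (norm (T k \<omega>))\<^sup>2)"
      unfolding norm2 using int by simp
    have "(\<integral>\<omega>. 1 + (norm (T k \<omega>))\<^sup>2 \<partial>P) = 1 + (\<Sum>a\<in>UNIV. \<integral>\<omega>. (T k \<omega> $ a)\<^sup>2 \<partial>P)"
      unfolding norm2 using int by (simp add: prob_space)
    also have "\<dots> \<le> 1 + (\<Sum>a\<in>(UNIV :: 'p set). ?C)"
      by (intro add_mono order_refl sum_mono E)
    finally show "(\<integral>\<omega>. 1 + (norm (T k \<omega>))\<^sup>2 \<partial>P) \<le> 1 + ?p * ?C" by simp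
  qed (auto simp: add_nonneg_nonneg)
  then show ?thesis
  proof (rule bounded_in_prob_mono)
    have "x \<le> 1 + x\<^sup>2" for x :: real
    proof -
      have "2 * x \<le> 1 + x\<^sup>2" using zero_le_power2[of "x - 1"] by (simp add: power2_diff)
      then show ?thesis using zero_le_power2[of x] by linarith
    qed
    then show "\<forall>\<^sub>F k in sequentially. \<forall>\<omega>\<in>space P. norm (T k \<omega>) \<le> 1 + (norm (T k \<omega>))\<^sup>2" by simp
  qed
qed

lemma truncated_part_negligible:
  fixes x :: "nat \<Rightarrow> 'w \<Rightarrow> 'b::euclidean_space"
  assumes [measurable]: "\<And>j. x j \<in> borel_measurable P" and r: "r \<longlonglongrightarrow> 0" and "\<epsilon> > 0"
  shows "with_high_prob P (\<lambda>k \<omega>. norm (r k *\<^sub>R (\<Sum>j<Suc k. (1 - trunc j \<omega>) *\<^sub>R x j \<omega>)) \<le> \<epsilon>)"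
proof (rule with_high_prob_AE)
  show "{\<omega> \<in> space P. norm (r k *\<^sub>R (\<Sum>j<Suc k. (1 - trunc j \<omega>) *\<^sub>R x j \<omega>)) \<le> \<epsilon>} \<in> sets P" for k
    by measurable
  show "AE \<omega> in P. \<forall>\<^sub>F k in sequentially. norm (r k *\<^sub>R (\<Sum>j<Suc k. (1 - trunc j \<omega>) *\<^sub>R x j \<omega>)) \<le> \<epsilon>"
    using trunc_sums_bounded[where 'b = 'b]
  proof eventually_elim
    case (elim \<omega>)
    then obtain b where b: "\<And>K. norm (\<Sum>j<K. (1 - trunc j \<omega>) *\<^sub>R x j \<omega>) \<le> b" by meson
    have "(\<lambda>k. \<bar>r k\<bar> * b) \<longlonglongrightarrow> 0"
      using tendsto_mult_left_zero[OF tendsto_rabs_zero[OF r]] .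
    then have "\<forall>\<^sub>F k in sequentially. \<bar>r k\<bar> * b < \<epsilon>"
      using \<open>\<epsilon> > 0\<close> by (rule order_tendstoD)
    then show ?case
    proof eventually_elim
      case (elim k)
      have "norm (r k *\<^sub>R (\<Sum>j<Suc k. (1 - trunc j \<omega>) *\<^sub>R x j \<omega>)) \<le> \<bar>r k\<bar> * b"
        unfolding norm_scaleR by (intro mult_left_mono b) simp
      with elim show ?case by simp
    qed
  qed
qed

lemma n_at_top: "filterlim (\<lambda>k. real (n k)) at_top sequentially"
proof -
  have "filterlim (\<lambda>k. real (n k) / real (Suc k) * real (Suc k)) at_top sequentially"
    by (rule filterlim_tendsto_pos_mult_at_top[OF n_asymp]) (simp, real_asymp)
  then show ?thesis by simp
qed

text \<open>A weak law of large numbers: the truncated sums have second moments of order \<open>k\<close>, and the sums that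
  are removed by the truncation stay bounded.\<close>
lemma weighted_errors_negligible:
  assumes a: "predictable a C" and "\<epsilon> > 0"
  shows "with_high_prob P (\<lambda>k \<omega>. \<bar>\<Sum>j<Suc k. \<Sum>i\<in>Bl j. a i \<omega> * e i \<omega>\<bar> / real (n k) \<le> \<epsilon>)"
proof -
  let ?C = "C\<^sup>2 * real m * c"
  let ?S = "\<lambda>k \<omega>. \<Sum>j<Suc k. D a j \<omega>"
  let ?x = "\<lambda>j \<omega>. \<Sum>i\<in>Bl j. a i \<omega> * e i \<omega>"
  note mom = D_partial_sum_second_moment[OF a]
  have inv0: "(\<lambda>k. 1 / real (n k)) \<longlonglongrightarrow> 0"
    using tendsto_inverse_0_at_top[OF n_at_top] by (simp add: inverse_eq_divide)
  have "with_high_prob P (\<lambda>k \<omega>. (1 / (real (n k))\<^sup>2) * (?S k \<omega>)\<^sup>2 \<le> (\<epsilon> / 2)\<^sup>2)"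
  proof (rule with_high_prob_markov)
    show "integrable P (\<lambda>\<omega>. (1 / (real (n k))\<^sup>2) * (?S k \<omega>)\<^sup>2)" for k
      using mom(1)[of "Suc k"] by (rule integrable_mult_right)
    have upper: "(\<integral>\<omega>. (1 / (real (n k))\<^sup>2) * (?S k \<omega>)\<^sup>2 \<partial>P) \<le> ?C * ((1 / real (n k)) * (1 / (real (n k) / real (Suc k))))" for k
    proof -
      have "(\<integral>\<omega>. (1 / (real (n k))\<^sup>2) * (?S k \<omega>)\<^sup>2 \<partial>P) \<le> (1 / (real (n k))\<^sup>2) * (real (Suc k) * ?C)"
        using mom(2)[of "Suc k"] by (subst integral_mult_right_zero, intro mult_left_mono) auto
      also have "\<dots> = ?C * ((1 / real (n k)) * (1 / (real (n k) / real (Suc k))))"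
        using n_pos[of k] by (simp add: power2_eq_square)
      finally show ?thesis .
    qed
    have lim: "(\<lambda>k. ?C * ((1 / real (n k)) * (1 / (real (n k) / real (Suc k))))) \<longlonglongrightarrow> ?C * (0 * (1 / real CARD('p)))"
      by (intro tendsto_mult tendsto_const inv0 tendsto_divide n_asymp) simp
    show "(\<lambda>k. \<integral>\<omega>. (1 / (real (n k))\<^sup>2) * (?S k \<omega>)\<^sup>2 \<partial>P) \<longlonglongrightarrow> 0"
      by (rule tendsto_sandwich[OF _ _ tendsto_const lim[simplified mult_zero_left mult_zero_right]])
         (use upper in \<open>auto intro!: always_eventually integral_nonneg_AE\<close>)
  qed (use \<open>\<epsilon> > 0\<close> in auto)
  moreover have "with_high_prob P (\<lambda>k \<omega>. norm ((1 / real (n k)) *\<^sub>R (\<Sum>j<Suc k. (1 - trunc j \<omega>) *\<^sub>R ?x j \<omega>)) \<le> \<epsilon> / 2)"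
  proof (rule truncated_part_negligible[OF _ inv0])
    show "?x j \<in> borel_measurable P" for j
      by (intro borel_measurable_sum borel_measurable_times e_measurable
        measurable_from_subalg[OF subalgebra a_measurable[OF a]])
  qed (use \<open>\<epsilon> > 0\<close> in simp)
  ultimately have "with_high_prob P (\<lambda>k \<omega>. (1 / (real (n k))\<^sup>2) * (?S k \<omega>)\<^sup>2 \<le> (\<epsilon> / 2)\<^sup>2 \<and>
      norm ((1 / real (n k)) *\<^sub>R (\<Sum>j<Suc k. (1 - trunc j \<omega>) *\<^sub>R ?x j \<omega>)) \<le> \<epsilon> / 2)"
    by (rule with_high_prob_conj)
  then show ?thesis
  proof (rule with_high_prob_mono, intro always_eventually allI ballI impI, elim conjE)
    fix k \<omega>
    assume 1: "(1 / (real (n k))\<^sup>2) * (?S k \<omega>)\<^sup>2 \<le> (\<epsilon> / 2)\<^sup>2"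
      and 2: "norm ((1 / real (n k)) *\<^sub>R (\<Sum>j<Suc k. (1 - trunc j \<omega>) *\<^sub>R ?x j \<omega>)) \<le> \<epsilon> / 2"
    have "(\<bar>?S k \<omega>\<bar> / real (n k))\<^sup>2 \<le> (\<epsilon> / 2)\<^sup>2"
      using 1 by (simp add: power_divide)
    then have "\<bar>?S k \<omega>\<bar> / real (n k) \<le> \<epsilon> / 2"
      by (rule power2_le_imp_le) (use \<open>\<epsilon> > 0\<close> in simp)
    moreover have "\<bar>\<Sum>j<Suc k. (1 - trunc j \<omega>) * ?x j \<omega>\<bar> / real (n k) \<le> \<epsilon> / 2"
      using 2 unfolding norm_scaleR real_norm_def real_scaleR_def by (simp only: abs_divide abs_one abs_of_nat times_divide_eq_left mult_1)
    moreover have "(\<Sum>j<Suc k. ?x j \<omega>) = ?S k \<omega> + (\<Sum>j<Suc k. (1 - trunc j \<omega>) * ?x j \<omega>)"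
      unfolding sum.distrib[symmetric] D_def by (intro sum.cong refl) (simp add: algebra_simps)
    then have "\<bar>\<Sum>j<Suc k. ?x j \<omega>\<bar> \<le> \<bar>?S k \<omega>\<bar> + \<bar>\<Sum>j<Suc k. (1 - trunc j \<omega>) * ?x j \<omega>\<bar>"
      by (simp only: abs_triangle_ineq)
    then have "\<bar>\<Sum>j<Suc k. ?x j \<omega>\<bar> / real (n k) \<le> (\<bar>?S k \<omega>\<bar> + \<bar>\<Sum>j<Suc k. (1 - trunc j \<omega>) * ?x j \<omega>\<bar>) / real (n k)"
      by (rule divide_right_mono) simp
    ultimately show "\<bar>\<Sum>j<Suc k. ?x j \<omega>\<bar> / real (n k) \<le> \<epsilon>"
      unfolding add_divide_distrib by linarith
  qed
qed

lemma hess_score_negligible: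
  assumes "\<epsilon> > 0"
  shows "with_high_prob P (\<lambda>k \<omega>. norm (hess_score k \<omega>) / real (n k) \<le> \<epsilon>)"
proof -
  let ?N = "real CARD('p) * real CARD('p)"
  let ?s = "\<lambda>ab k \<omega>. \<Sum>j<Suc k. \<Sum>i\<in>Bl j. H i \<omega> $ fst ab $ snd ab * e i \<omega>"
  have "with_high_prob P (\<lambda>k \<omega>. \<forall>ab\<in>UNIV. \<bar>?s ab k \<omega>\<bar> / real (n k) \<le> \<epsilon> / ?N)"
    using \<open>\<epsilon> > 0\<close> by (intro with_high_prob_all_finite weighted_errors_negligible[OF predictable_H]) auto
  then show ?thesis
  proof (rule with_high_prob_mono, intro always_eventually allI ballI impI)
    fix k \<omega> assume *: "\<forall>ab\<in>UNIV. \<bar>?s ab k \<omega>\<bar> / real (n k) \<le> \<epsilon> / ?N"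
    have comp: "hess_score k \<omega> $ a $ b = ?s (a, b) k \<omega>" for a b
      by (simp add: hess_score_def mult.commute del: sum.lessThan_Suc)
    have "norm (hess_score k \<omega>) / real (n k) \<le> (\<Sum>a\<in>UNIV. \<Sum>b\<in>UNIV. \<bar>?s (a, b) k \<omega>\<bar>) / real (n k)"
      using norm_le_sum_abs_entries[of "hess_score k \<omega>"] unfolding comp by (rule divide_right_mono) simp
    also have "\<dots> = (\<Sum>a\<in>UNIV. \<Sum>b\<in>UNIV. \<bar>?s (a, b) k \<omega>\<bar> / real (n k))"
      by (simp only: sum_divide_distrib)
    also have "\<dots> \<le> (\<Sum>a\<in>(UNIV :: 'p set). \<Sum>b\<in>(UNIV :: 'p set). \<epsilon> / ?N)"
      using * by (intro sum_mono) blast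
    also have "\<dots> = \<epsilon>" by simp
    finally show "norm (hess_score k \<omega>) / real (n k) \<le> \<epsilon>" .
  qed
qed

text \<open>The mean absolute error is bounded in probability, by comparison with second moments.\<close>
lemma abs_errors_bounded: "bounded_in_prob P (\<lambda>k \<omega>. (\<Sum>j<Suc k. \<Sum>i\<in>Bl j. \<bar>e i \<omega>\<bar>) / real (n k))"
proof -
  let ?x = "\<lambda>j \<omega>. \<Sum>i\<in>Bl j. \<bar>e i \<omega>\<bar>"
  have inv0: "(\<lambda>k. 1 / real (n k)) \<longlonglongrightarrow> 0"
    using tendsto_inverse_0_at_top[OF n_at_top] by (simp add: inverse_eq_divide)
  have x_meas [measurable]: "?x j \<in> borel_measurable P" for j
    using e_measurable by (intro borel_measurable_sum borel_measurable_abs)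
  have x_le: "?x j \<omega> \<le> real m + Q j \<omega>" for j \<omega>
  proof -
    have "x \<le> 1 + x\<^sup>2" for x :: real
    proof -
      have "2 * x \<le> 1 + x\<^sup>2" using zero_le_power2[of "x - 1"] by (simp add: power2_diff)
      then show ?thesis using zero_le_power2[of x] by linarith
    qed
    from this[of "\<bar>y\<bar>" for y] have "?x j \<omega> \<le> (\<Sum>i\<in>Bl j. 1 + (e i \<omega>)\<^sup>2)"
      by (intro sum_mono) simp
    also have "\<dots> \<le> real m + Q j \<omega>" using card_block[of j] by (simp add: sum.distrib Q_def)
    finally show ?thesis .
  qed
  have x_nonneg: "0 \<le> ?x j \<omega>" for j \<omega> by (simp add: sum_nonneg)
  have x_int: "integrable P (?x j)" for j
    using e_integrable by (intro Bochner_Integration.integrable_sum integrable_abs)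
  note tx_int = trunc_mult_integrable[OF x_int]
  have "bounded_in_prob P (\<lambda>k \<omega>. (2 / real (Suc k)) * (\<Sum>j<Suc k. trunc j \<omega> * ?x j \<omega>))"
  proof (rule bounded_in_prob_moment)
    show "integrable P (\<lambda>\<omega>. (2 / real (Suc k)) * (\<Sum>j<Suc k. trunc j \<omega> * ?x j \<omega>))" for k
      by (intro integrable_mult_right Bochner_Integration.integrable_sum tx_int)
    show "0 \<le> (2 / real (Suc k)) * (\<Sum>j<Suc k. trunc j \<omega> * ?x j \<omega>)" for k \<omega>
      using trunc_01 x_nonneg by (intro mult_nonneg_nonneg sum_nonneg) auto
    show "(\<integral>\<omega>. (2 / real (Suc k)) * (\<Sum>j<Suc k. trunc j \<omega> * ?x j \<omega>) \<partial>P) \<le> 2 * (real m + c)" for k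
    proof -
      have "(\<integral>\<omega>. trunc j \<omega> * ?x j \<omega> \<partial>P) \<le> real m + c" for j
      proof -
        note tQ = trunc_mult_integrable[OF Q_integrable, of j j]
        have "(\<integral>\<omega>. trunc j \<omega> * ?x j \<omega> \<partial>P) \<le> (\<integral>\<omega>. real m + trunc j \<omega> * Q j \<omega> \<partial>P)"
          using x_le tQ by (intro integral_mono tx_int) (auto simp: trunc_def)
        also have "\<dots> = real m + (\<integral>\<omega>. trunc j \<omega> * Q j \<omega> \<partial>P)"
          using tQ by (simp add: prob_space)
        finally show ?thesis using trunc_Q_integral[of j] by simp
      qed
      then have "(\<Sum>j<Suc k. \<integral>\<omega>. trunc j \<omega> * ?x j \<omega> \<partial>P) \<le> (\<Sum>j<Suc k. real m + c)"
        by (rule sum_mono)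
      then have "(2 / real (Suc k)) * (\<Sum>j<Suc k. \<integral>\<omega>. trunc j \<omega> * ?x j \<omega> \<partial>P) \<le> (2 / real (Suc k)) * (real (Suc k) * (real m + c))"
        by (intro mult_left_mono) (auto simp del: sum.lessThan_Suc)
      moreover have "(\<integral>\<omega>. (2 / real (Suc k)) * (\<Sum>j<Suc k. trunc j \<omega> * ?x j \<omega>) \<partial>P)
          = (2 / real (Suc k)) * (\<Sum>j<Suc k. \<integral>\<omega>. trunc j \<omega> * ?x j \<omega> \<partial>P)"
        by (subst integral_mult_right_zero, subst Bochner_Integration.integral_sum) (rule tx_int, rule refl)
      moreover have "(2 / real (Suc k)) * (real (Suc k) * (real m + c)) = 2 * (real m + c)" by simp
      ultimately show ?thesis by (simp del: sum.lessThan_Suc)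
    qed
  qed
  moreover have "bounded_in_prob P (\<lambda>k \<omega>. norm ((1 / real (n k)) *\<^sub>R (\<Sum>j<Suc k. (1 - trunc j \<omega>) *\<^sub>R ?x j \<omega>)))"
    by (rule bounded_in_prob_whp[OF truncated_part_negligible[OF x_meas inv0 zero_less_one]])
  ultimately have "bounded_in_prob P (\<lambda>k \<omega>. (2 / real (Suc k)) * (\<Sum>j<Suc k. trunc j \<omega> * ?x j \<omega>)
      + norm ((1 / real (n k)) *\<^sub>R (\<Sum>j<Suc k. (1 - trunc j \<omega>) *\<^sub>R ?x j \<omega>)))"
    by (rule bounded_in_prob_add)
  then show ?thesis
  proof (rule bounded_in_prob_mono)
    have "\<forall>\<^sub>F k in sequentially. real (n k) / real (Suc k) > 1 / 2"
    proof -
      have "1 \<le> CARD('p)" by (simp add: Suc_le_eq)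
      then have "1 / 2 < real CARD('p)" by linarith
      then show ?thesis by (rule order_tendstoD(1)[OF n_asymp])
    qed
    then show "\<forall>\<^sub>F k in sequentially. \<forall>\<omega>\<in>space P. (\<Sum>j<Suc k. ?x j \<omega>) / real (n k)
        \<le> (2 / real (Suc k)) * (\<Sum>j<Suc k. trunc j \<omega> * ?x j \<omega>)
          + norm ((1 / real (n k)) *\<^sub>R (\<Sum>j<Suc k. (1 - trunc j \<omega>) *\<^sub>R ?x j \<omega>))"
    proof eventually_elim
      case (elim k)
      have inv: "1 / real (n k) \<le> 2 / real (Suc k)"
        using elim n_pos[of k] by (simp add: field_simps)
      show ?case
      proof
        fix \<omega>
        let ?t = "\<Sum>j<Suc k. trunc j \<omega> * ?x j \<omega>" and ?u = "\<Sum>j<Suc k. (1 - trunc j \<omega>) *\<^sub>R ?x j \<omega>"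
        have "(\<Sum>j<Suc k. ?x j \<omega>) = ?t + ?u"
          unfolding sum.distrib[symmetric] by (intro sum.cong refl) (simp add: algebra_simps)
        then have "(\<Sum>j<Suc k. ?x j \<omega>) / real (n k) = (1 / real (n k)) * ?t + (1 / real (n k)) *\<^sub>R ?u"
          by (simp only: add_divide_distrib real_scaleR_def) (simp del: sum.lessThan_Suc)
        also have "(1 / real (n k)) * ?t \<le> (2 / real (Suc k)) * ?t"
          using trunc_01 x_nonneg by (intro mult_right_mono inv sum_nonneg mult_nonneg_nonneg) auto
        also have "(1 / real (n k)) *\<^sub>R ?u \<le> norm ((1 / real (n k)) *\<^sub>R ?u)"
          unfolding real_norm_def by (rule abs_ge_self)
        finally show "(\<Sum>j<Suc k. ?x j \<omega>) / real (n k) \<le> (2 / real (Suc k)) * ?t + norm ((1 / real (n k)) *\<^sub>R ?u)"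
          by simp
      qed
    qed
  qed
qed

lemma score_close_T:
  assumes "\<epsilon> > 0"
  shows "with_high_prob P (\<lambda>k \<omega>. norm ((1 / sqrt (real (n k))) *\<^sub>R score k \<omega> - T k \<omega>) \<le> \<epsilon>)"
proof -
  let ?p = "real CARD('p)"
  let ?r = "\<lambda>k. sqrt (real (Suc k) * ?p) / sqrt (real (n k)) - 1"
  let ?x = "\<lambda>j \<omega>. \<Sum>i\<in>Bl j. e i \<omega> *\<^sub>R g i \<omega>"
  have r: "?r \<longlonglongrightarrow> 0"
  proof -
    have "(\<lambda>k. sqrt (?p / (real (n k) / real (Suc k))) - 1) \<longlonglongrightarrow> sqrt (?p / ?p) - 1"
      by (intro tendsto_intros n_asymp) simp
    then show ?thesis by (simp add: real_sqrt_divide[symmetric] mult.commute)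
  qed
  have inv0: "(\<lambda>k. 1 / sqrt (real (n k))) \<longlonglongrightarrow> 0"
    using tendsto_inverse_0_at_top[OF filterlim_compose[OF sqrt_at_top n_at_top]] by (simp add: inverse_eq_divide)
  have 1: "with_high_prob P (\<lambda>k \<omega>. norm ((1 / sqrt (real (n k))) *\<^sub>R (\<Sum>j<Suc k. (1 - trunc j \<omega>) *\<^sub>R ?x j \<omega>)) \<le> \<epsilon> / 2)"
    using \<open>\<epsilon> > 0\<close> by (intro truncated_part_negligible block_score_measurable inv0) simp
  show ?thesis
  proof (rule with_high_prob_bounded[OF T_bounded_in_prob])
    fix b :: real assume "b > 0"
    have "(\<lambda>k. \<bar>?r k\<bar> * b) \<longlonglongrightarrow> 0"
      using tendsto_mult_left_zero[OF tendsto_rabs_zero[OF r]] .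
    then have "\<forall>\<^sub>F k in sequentially. \<bar>?r k\<bar> * b < \<epsilon> / 2"
      using \<open>\<epsilon> > 0\<close> by (intro order_tendstoD) auto
    then have ev: "\<forall>\<^sub>F k in sequentially. \<forall>\<omega>\<in>space P.
        norm ((1 / sqrt (real (n k))) *\<^sub>R (\<Sum>j<Suc k. (1 - trunc j \<omega>) *\<^sub>R ?x j \<omega>)) \<le> \<epsilon> / 2 \<longrightarrow>
        (norm (T k \<omega>) \<le> b \<longrightarrow> norm ((1 / sqrt (real (n k))) *\<^sub>R score k \<omega> - T k \<omega>) \<le> \<epsilon>)"
    proof eventually_elim
      case (elim k)
      show ?case
      proof (intro ballI impI)
        fix \<omega>
        let ?u = "(1 / sqrt (real (n k))) *\<^sub>R (\<Sum>j<Suc k. (1 - trunc j \<omega>) *\<^sub>R ?x j \<omega>)"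
        assume u: "norm ?u \<le> \<epsilon> / 2" and T: "norm (T k \<omega>) \<le> b"
        have "score k \<omega> = trunc_score k \<omega> + (\<Sum>j<Suc k. (1 - trunc j \<omega>) *\<^sub>R ?x j \<omega>)"
          unfolding score_def trunc_score_def sum.distrib[symmetric] by (intro sum.cong refl) (simp add: algebra_simps)
        moreover have "trunc_score k \<omega> = sqrt (real (Suc k) * ?p) *\<^sub>R T k \<omega>"
          by (simp add: T_def)
        ultimately have "(1 / sqrt (real (n k))) *\<^sub>R score k \<omega> - T k \<omega> = ?r k *\<^sub>R T k \<omega> + ?u"
          by (simp only: scaleR_add_right scaleR_left_diff_distrib) simp
        also have "norm \<dots> \<le> \<bar>?r k\<bar> * norm (T k \<omega>) + norm ?u"
          by (rule order_trans[OF norm_triangle_ineq]) simp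
        also have "\<bar>?r k\<bar> * norm (T k \<omega>) \<le> \<bar>?r k\<bar> * b"
          by (intro mult_left_mono T) simp
        finally show "norm ((1 / sqrt (real (n k))) *\<^sub>R score k \<omega> - T k \<omega>) \<le> \<epsilon>"
          using elim u by linarith
      qed
    qed
    show "with_high_prob P (\<lambda>k \<omega>. norm (T k \<omega>) \<le> b \<longrightarrow> norm ((1 / sqrt (real (n k))) *\<^sub>R score k \<omega> - T k \<omega>) \<le> \<epsilon>)"
      by (rule with_high_prob_mono[OF 1 ev])
  qed
qed

lemma info_close:
  assumes "\<epsilon> > 0"
  shows "with_high_prob P (\<lambda>k \<omega>. norm ((1 / real (n k)) *\<^sub>R info k \<omega> - M) \<le> \<epsilon>)"
proof (rule with_high_prob_AE)
  show "{\<omega> \<in> space P. norm ((1 / real (n k)) *\<^sub>R info k \<omega> - M) \<le> \<epsilon>} \<in> sets P" for k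
    by measurable
  show "AE \<omega> in P. \<forall>\<^sub>F k in sequentially. norm ((1 / real (n k)) *\<^sub>R info k \<omega> - M) \<le> \<epsilon>"
    using information
  proof eventually_elim
    case (elim \<omega>)
    have "(\<lambda>k. (1 / (real (n k) / real (Suc k))) *\<^sub>R ((1 / real (Suc k)) *\<^sub>R info k \<omega>))
        \<longlonglongrightarrow> (1 / real CARD('p)) *\<^sub>R (real CARD('p) *\<^sub>R M)"
      unfolding info_def
      by (intro tendsto_scaleR tendsto_divide tendsto_const n_asymp LIMSEQ_Suc[OF cesaro_mean_tendsto[OF elim]]) simp
    then have "(\<lambda>k. (1 / real (n k)) *\<^sub>R info k \<omega>) \<longlonglongrightarrow> M" by simp
    then have "\<forall>\<^sub>F k in sequentially. dist ((1 / real (n k)) *\<^sub>R info k \<omega>) M < \<epsilon>"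
      using \<open>\<epsilon> > 0\<close> by (rule tendstoD)
    then show ?case by eventually_elim (simp add: dist_norm)
  qed
qed

end


section \<open>Asymptotic normality of the least squares estimator\<close>

lemma sample_size_Suc: "sample_size p n1 (Suc k) = n1 + k * p"
  by (simp add: sample_size_def)

lemma sample_size_mono: "sample_size p n1 k \<le> sample_size p n1 (Suc k)"
  by (cases k) (simp_all add: sample_size_def)

lemma sum_over_blocks:
  fixes x :: "nat \<Rightarrow> 'a::comm_monoid_add"
  shows "(\<Sum>i=1..sample_size p n1 k. x i) = (\<Sum>j<k. \<Sum>i\<in>block p n1 (Suc j). x i)"
proof (induction k)
  case (Suc k)
  have "{1..sample_size p n1 (Suc k)} = {1..sample_size p n1 k} \<union> block p n1 (Suc k)"
    using sample_size_mono[of p n1 k] by (auto simp: block_def)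
  moreover have "{1..sample_size p n1 k} \<inter> block p n1 (Suc k) = {}"
    by (auto simp: block_def)
  ultimately have "(\<Sum>i=1..sample_size p n1 (Suc k). x i)
      = (\<Sum>i=1..sample_size p n1 k. x i) + (\<Sum>i\<in>block p n1 (Suc k). x i)"
    by (simp add: sum.union_disjoint block_def)
  then show ?case using Suc.IH by simp
qed (simp add: sample_size_def)

text \<open>From the second block on, blocks have length \<open>p\<close> and are indexed by the coordinates.\<close>
lemma sum_later_block:
  fixes x :: "nat \<Rightarrow> 'a::comm_monoid_add"
  assumes "j \<ge> 1"
  shows "(\<Sum>i\<in>block CARD('p::finite) n1 (Suc j). x i) = (\<Sum>\<alpha>\<in>(UNIV :: 'p set). x (sample_size CARD('p) n1 j + pos \<alpha>))"
proof -
  let ?s = "sample_size CARD('p) n1 j"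
  have "block CARD('p) n1 (Suc j) = {?s + 1..?s + CARD('p)}"
    using assms by (cases j) (simp_all add: block_def sample_size_def)
  moreover have "bij_betw ((+) ?s) {1..CARD('p)} {?s + 1..?s + CARD('p)}"
    by (simp add: bij_betw_def)
  ultimately have "bij_betw (((+) ?s) \<circ> pos) (UNIV :: 'p set) (block CARD('p) n1 (Suc j))"
    using bij_betw_trans[OF bij_betw_pos] by metis
  from sum.reindex_bij_betw[OF this, of x] show ?thesis by simp
qed

lemma block_ge_1: "i \<in> block p n1 k \<Longrightarrow> i \<ge> 1"
  by (simp add: block_def)

lemma finite_block: "finite (block p n1 k)"
  by (simp add: block_def)

lemma card_block_le: "card (block p n1 (Suc j)) \<le> n1 + p"
  by (cases j) (simp_all add: block_def sample_size_def)

lemma adaptive_estimators_measurable: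
  fixes est :: "nat \<Rightarrow> 'w \<Rightarrow> real^'p"
  assumes "adaptive_estimators P \<X> \<Theta> X Y N est"
    and X: "\<And>i. i \<ge> 1 \<Longrightarrow> X i \<in> P \<rightarrow>\<^sub>M restrict_space borel \<X>"
    and Y: "\<And>i. i \<ge> 1 \<Longrightarrow> Y i \<in> borel_measurable P" and "k \<ge> 1"
  shows "est k \<in> P \<rightarrow>\<^sub>M restrict_space borel \<Theta>"
proof -
  obtain T where T: "T \<in> PiM {1..N k} (\<lambda>_. restrict_space borel \<X> \<Otimes>\<^sub>M borel) \<rightarrow>\<^sub>M restrict_space borel \<Theta>"
    and eq: "\<And>\<omega>. \<omega> \<in> space P \<Longrightarrow> est k \<omega> = T (observations X Y (N k) \<omega>)"
    using assms(1,4) unfolding adaptive_estimators_def by blast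
  have "observations X Y (N k) \<in> P \<rightarrow>\<^sub>M PiM {1..N k} (\<lambda>_. restrict_space borel \<X> \<Otimes>\<^sub>M borel)"
    unfolding observations_def by (intro measurable_restrict measurable_Pair X Y) auto
  from measurable_compose[OF this T] show ?thesis
    by (subst measurable_cong[OF eq]) auto
qed

text \<open>If \<open>V j\<close> converges to a multiple of the identity matrix, then its quadratic forms at bounded vectors
  behave like the same multiple of the squared norms.\<close>
lemma quadratic_form_tendsto:
  fixes y :: "nat \<Rightarrow> 'p::finite \<Rightarrow> real" and V :: "nat \<Rightarrow> real^'p^'p"
  assumes y: "\<forall>\<^sub>F j in sequentially. \<forall>\<alpha>. \<bar>y j \<alpha>\<bar> \<le> C"
    and V: "V \<longlonglongrightarrow> \<sigma>2 *\<^sub>R mat 1"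
    and s: "(\<lambda>j. \<Sum>\<alpha>\<in>UNIV. (y j \<alpha>)\<^sup>2) \<longlonglongrightarrow> s"
  shows "(\<lambda>j. \<Sum>\<alpha>\<in>UNIV. \<Sum>\<beta>\<in>UNIV. y j \<alpha> * y j \<beta> * V j $ \<alpha> $ \<beta>) \<longlonglongrightarrow> \<sigma>2 * s"
proof -
  define \<Delta> where "\<Delta> = (\<lambda>j. V j - \<sigma>2 *\<^sub>R mat 1)"
  have \<Delta>: "(\<lambda>j. \<Delta> j $ \<alpha> $ \<beta>) \<longlonglongrightarrow> 0" for \<alpha> \<beta>
    using tendsto_vec_nth[OF tendsto_vec_nth[OF LIM_zero[OF V]], of \<alpha> \<beta>] by (simp add: \<Delta>_def)
  have "(\<lambda>j. y j \<alpha> * y j \<beta> * \<Delta> j $ \<alpha> $ \<beta>) \<longlonglongrightarrow> 0" for \<alpha> \<beta>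
  proof (rule Lim_null_comparison)
    show "(\<lambda>j. (\<bar>C\<bar> * \<bar>C\<bar>) * \<bar>\<Delta> j $ \<alpha> $ \<beta>\<bar>) \<longlonglongrightarrow> 0"
      by (intro tendsto_mult_right_zero tendsto_rabs_zero \<Delta>)
    show "\<forall>\<^sub>F j in sequentially. norm (y j \<alpha> * y j \<beta> * \<Delta> j $ \<alpha> $ \<beta>) \<le> (\<bar>C\<bar> * \<bar>C\<bar>) * \<bar>\<Delta> j $ \<alpha> $ \<beta>\<bar>"
      using y
    proof eventually_elim
      case (elim j)
      then have "\<bar>y j \<alpha>\<bar> \<le> \<bar>C\<bar>" "\<bar>y j \<beta>\<bar> \<le> \<bar>C\<bar>" by (meson abs_ge_self order_trans)+
      then have "\<bar>y j \<alpha>\<bar> * \<bar>y j \<beta>\<bar> \<le> \<bar>C\<bar> * \<bar>C\<bar>" by (intro mult_mono) auto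
      then show ?case unfolding real_norm_def abs_mult by (rule mult_right_mono) simp
    qed
  qed
  then have "(\<lambda>j. (\<Sum>\<alpha>\<in>UNIV. \<Sum>\<beta>\<in>UNIV. y j \<alpha> * y j \<beta> * \<Delta> j $ \<alpha> $ \<beta>) + \<sigma>2 * (\<Sum>\<alpha>\<in>UNIV. (y j \<alpha>)\<^sup>2))
      \<longlonglongrightarrow> (\<Sum>\<alpha>\<in>(UNIV :: 'p set). \<Sum>\<beta>\<in>(UNIV :: 'p set). 0) + \<sigma>2 * s"
    by (intro tendsto_intros s)
  moreover have "(\<Sum>\<alpha>\<in>UNIV. \<Sum>\<beta>\<in>UNIV. y j \<alpha> * y j \<beta> * \<Delta> j $ \<alpha> $ \<beta>) + \<sigma>2 * (\<Sum>\<alpha>\<in>UNIV. (y j \<alpha>)\<^sup>2)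
      = (\<Sum>\<alpha>\<in>UNIV. \<Sum>\<beta>\<in>UNIV. y j \<alpha> * y j \<beta> * V j $ \<alpha> $ \<beta>)" for j
  proof -
    have "(\<Sum>\<beta>\<in>UNIV. y j \<alpha> * y j \<beta> * \<Delta> j $ \<alpha> $ \<beta>) + \<sigma>2 * (y j \<alpha>)\<^sup>2 = (\<Sum>\<beta>\<in>UNIV. y j \<alpha> * y j \<beta> * V j $ \<alpha> $ \<beta>)" for \<alpha>
    proof -
      have "\<sigma>2 * (y j \<alpha>)\<^sup>2 = (\<Sum>\<beta>\<in>UNIV. y j \<alpha> * y j \<beta> * (\<sigma>2 * mat 1 $ \<alpha> $ \<beta>))"
        by (simp add: mat_def if_distrib power2_eq_square mult_ac cong: if_cong)
      then show ?thesis
        by (simp add: \<Delta>_def sum.distrib[symmetric] algebra_simps)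
    qed
    then show ?thesis
      by (simp add: sum_distrib_left sum.distrib[symmetric])
  qed
  ultimately show ?thesis by simp
qed

lemma sum_inner_square: "(\<Sum>i\<in>I. (u \<bullet> g i)\<^sup>2) = u \<bullet> ((\<Sum>i\<in>I. outer (g i)) *v u)"
  unfolding sum_outer_mult inner_sum_right by (simp add: power2_eq_square inner_commute)

lemma tendsto_quadratic:
  fixes A :: "'b \<Rightarrow> real^'p^'p"
  assumes "(A \<longlongrightarrow> L) F"
  shows "((\<lambda>k. u \<bullet> (A k *v u)) \<longlongrightarrow> u \<bullet> (L *v u)) F"
  unfolding inner_vec_def matrix_vector_mult_def vec_lambda_beta by (intro tendsto_intros assms)

text \<open>Inverse, symmetry and a factorization of a multiple of the Gram matrix of linearly independent vectors,
  the rows of \<open>G\<close>.\<close>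
lemma gram_matrix:
  fixes G :: "real^'p^'p"
  assumes "det G \<noteq> 0" and M: "M = r *\<^sub>R (transpose G ** G)" and "r > 0" "\<sigma>2 > 0"
  shows gram_matrix_inv: "matrix_inv M ** M = mat 1" "M ** matrix_inv M = mat 1"
    and gram_matrix_inv_symmetric: "transpose (matrix_inv M) = matrix_inv M"
    and gram_matrix_nonneg: "0 \<le> u \<bullet> (M *v u)"
    and gram_matrix_inv_factor: "\<exists>A :: real^'p^'p. invertible A \<and> \<sigma>2 *\<^sub>R matrix_inv M = A ** transpose A"
proof -
  have invG: "invertible G" using assms(1) by (simp add: invertible_det_nz)
  let ?K = "matrix_inv G"
  have GK: "G ** ?K = mat 1" "?K ** G = mat 1"
    by (rule matrix_inv_right[OF invG], rule matrix_inv_left[OF invG])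
  have KtGt: "transpose G ** transpose ?K = mat 1"
    using arg_cong[OF GK(2), of transpose] by (simp add: matrix_transpose_mul)
  have MN: "M ** ((1 / r) *\<^sub>R (?K ** transpose ?K)) = mat 1"
  proof -
    have "M ** ((1 / r) *\<^sub>R (?K ** transpose ?K)) = (transpose G ** G) ** (?K ** transpose ?K)"
      using \<open>r > 0\<close> by (simp add: M matrix_scalar_ac scalar_matrix_assoc[symmetric])
    also have "\<dots> = transpose G ** ((G ** ?K) ** transpose ?K)"
      by (simp only: matrix_mul_assoc)
    finally show ?thesis using KtGt by (simp add: GK)
  qed
  then have invM: "invertible M"
    using invertible_right_inverse by blast
  show inv: "matrix_inv M ** M = mat 1" "M ** matrix_inv M = mat 1"
    by (rule matrix_inv_left[OF invM], rule matrix_inv_right[OF invM])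
  have Mi: "matrix_inv M = (1 / r) *\<^sub>R (?K ** transpose ?K)"
    by (metis MN inv(1) matrix_mul_assoc matrix_mul_lid matrix_mul_rid)
  show "transpose (matrix_inv M) = matrix_inv M"
    by (simp add: Mi transpose_scalar matrix_transpose_mul)
  have "u \<bullet> (M *v u) = r * ((G *v u) \<bullet> (G *v u))"
  proof -
    have "u \<bullet> ((transpose G ** G) *v u) = (G *v u) \<bullet> (G *v u)"
      by (metis dot_lmul_matrix matrix_vector_mul_assoc vector_transpose_matrix transpose_transpose)
    then show ?thesis by (simp add: M scaleR_matrix_vector_assoc[symmetric])
  qed
  then show "0 \<le> u \<bullet> (M *v u)" using \<open>r > 0\<close> by simp
  let ?A = "sqrt (\<sigma>2 / r) *\<^sub>R ?K"
  have "det ?K \<noteq> 0" using GK(1) by (metis det_I det_mul mult_zero_right zero_neq_one)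
  then have "invertible ?K" by (simp add: invertible_det_nz)
  have "?A ** ((1 / sqrt (\<sigma>2 / r)) *\<^sub>R G) = mat 1"
    using assms GK by (simp add: matrix_scalar_ac scalar_matrix_assoc[symmetric])
  then have "invertible ?A" using invertible_right_inverse by blast
  moreover have "\<sigma>2 *\<^sub>R matrix_inv M = ?A ** transpose ?A"
    unfolding Mi using \<open>r > 0\<close> \<open>\<sigma>2 > 0\<close>
    by (simp add: transpose_scalar matrix_scalar_ac scalar_matrix_assoc[symmetric])
  ultimately show "\<exists>A :: real^'p^'p. invertible A \<and> \<sigma>2 *\<^sub>R matrix_inv M = A ** transpose A"
    by (intro exI[of _ ?A] conjI)
qed

text \<open>The pathwise estimate behind the theorem: \<open>s\<close> is the score, \<open>J\<close> the accumulated information, \<open>h\<close> the error of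
  the least squares estimator, \<open>hs\<close> the norm of the sum of the weighted Hessian matrices, and \<open>a\<close> the sum of the
  absolute errors. If \<open>s / \<surd>n\<close> is close to \<open>T\<close> and \<open>J / n\<close> is close to \<open>M\<close>, then \<open>\<surd>n h\<close> is close to the solution of
  \<open>M z = T\<close>.\<close>
lemma linearized_estimator_close:
  fixes M Mi J :: "real^'p^'p" and h s T :: "real^'p" and n :: real
  assumes "n > 0" and inv: "Mi ** M = mat 1"
    and lin: "norm (s - J *v h) \<le> (hs + \<eta> * a + n * (\<eta> * (2 * C + \<eta>))) * norm h"
    and hs: "hs / n \<le> \<rho> / 4" and a: "a / n \<le> b" and J: "norm ((1 / n) *\<^sub>R J - M) \<le> \<rho> / 4"
    and \<eta>: "\<eta> \<ge> 0" "\<eta> * b \<le> \<rho> / 4" "\<eta> * (2 * C + \<eta>) \<le> \<rho> / 4"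
    and s: "norm ((1 / sqrt n) *\<^sub>R s - T) \<le> \<kappa>" and T: "norm T \<le> b" and "\<kappa> \<le> 1"
    and \<rho>: "norm Mi * \<rho> \<le> 1 / 2" "2 * (norm Mi)\<^sup>2 * \<rho> * (b + 1) \<le> \<epsilon> / 2" "\<rho> \<ge> 0"
    and \<kappa>: "norm Mi * \<kappa> \<le> \<epsilon> / 2"
  shows "norm (sqrt n *\<^sub>R h - Mi *v T) \<le> \<epsilon>"
proof -
  let ?N = "(1 / sqrt n) *\<^sub>R s" and ?z = "sqrt n *\<^sub>R h"
  have "sqrt n > 0" using \<open>n > 0\<close> by simp
  have split: "?N - M *v ?z = (1 / sqrt n) *\<^sub>R (s - J *v h) + ((1 / n) *\<^sub>R J - M) *v ?z"
  proof -
    have "((1 / n) *\<^sub>R J) *v ?z = (sqrt n / n) *\<^sub>R (J *v h)"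
      by (simp add: scaleR_matrix_vector_assoc[symmetric] matrix_vector_mult_scaleR)
    also have "sqrt n / n = 1 / sqrt n" using \<open>n > 0\<close> by (simp add: field_simps)
    finally show ?thesis by (simp add: matrix_vector_mult_diff_rdistrib scaleR_diff_right)
  qed
  have "norm ((1 / sqrt n) *\<^sub>R (s - J *v h)) \<le> (1 / sqrt n) * ((hs + \<eta> * a + n * (\<eta> * (2 * C + \<eta>))) * norm h)"
    using \<open>sqrt n > 0\<close> lin by (simp add: divide_right_mono)
  also have "\<dots> = (hs / n + \<eta> * (a / n) + \<eta> * (2 * C + \<eta>)) * norm ?z"
  proof -
    let ?Y = "hs / n + \<eta> * (a / n) + \<eta> * (2 * C + \<eta>)"
    have "hs + \<eta> * a + n * (\<eta> * (2 * C + \<eta>)) = n * ?Y"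
      using \<open>n > 0\<close> by (simp add: distrib_left)
    moreover have "(1 / sqrt n) * ((n * ?Y) * norm h) = (n / sqrt n) * (?Y * norm h)" by simp
    moreover have "n / sqrt n = sqrt n" using \<open>n > 0\<close> by (simp add: real_div_sqrt)
    moreover have "norm ?z = sqrt n * norm h" using \<open>n > 0\<close> by simp
    ultimately show ?thesis by (simp only: mult.left_commute)
  qed
  also have "\<dots> \<le> (\<rho> / 4 + \<rho> / 4 + \<rho> / 4) * norm ?z"
  proof (intro mult_right_mono add_mono hs \<eta>)
    have "\<eta> * (a / n) \<le> \<eta> * b" by (intro mult_left_mono a \<eta>)
    then show "\<eta> * (a / n) \<le> \<rho> / 4" using \<eta>(2) by (rule order_trans)
  qed simp
  finally have 1: "norm ((1 / sqrt n) *\<^sub>R (s - J *v h)) \<le> (\<rho> / 4 + \<rho> / 4 + \<rho> / 4) * norm ?z" .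
  have 2: "norm (((1 / n) *\<^sub>R J - M) *v ?z) \<le> \<rho> / 4 * norm ?z"
    by (rule order_trans[OF norm_matrix_vector_mult_le]) (intro mult_right_mono J, simp)
  have "norm (?N - M *v ?z) \<le> \<rho> * norm ?z"
    unfolding split by (rule order_trans[OF norm_triangle_ineq]) (use add_mono[OF 1 2] in \<open>simp add: algebra_simps\<close>)
  from approx_linear_solution[OF inv this \<rho>(1)]
  have "norm (?z - Mi *v ?N) \<le> 2 * (norm Mi)\<^sup>2 * \<rho> * norm ?N" .
  also have "\<dots> \<le> 2 * (norm Mi)\<^sup>2 * \<rho> * (b + 1)"
  proof (rule mult_left_mono)
    show "norm ?N \<le> b + 1"
      using norm_triangle_ineq[of T "?N - T"] s T \<open>\<kappa> \<le> 1\<close> by simp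
  qed (use \<rho>(3) in simp)
  finally have 3: "norm (?z - Mi *v ?N) \<le> \<epsilon> / 2" using \<rho>(2) by simp
  have "norm (Mi *v (?N - T)) \<le> norm Mi * \<kappa>"
    by (rule order_trans[OF norm_matrix_vector_mult_le]) (intro mult_left_mono s, simp)
  then have 4: "norm (Mi *v (?N - T)) \<le> \<epsilon> / 2" using \<kappa> by simp
  have eq: "?z - Mi *v T = (?z - Mi *v ?N) + Mi *v (?N - T)"
    by (simp add: matrix_vector_mult_diff_distrib)
  show ?thesis
    unfolding eq by (rule order_trans[OF norm_triangle_ineq]) (use 3 4 in linarith)
qed

lemma (in prob_space) bounded_in_prob_cmult:
  assumes "bounded_in_prob M R" "r \<ge> 0"
  shows "bounded_in_prob M (\<lambda>k \<omega>. r * R k \<omega>)"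
  unfolding bounded_in_prob_def
proof (intro allI impI)
  fix \<delta> :: real assume "\<delta> > 0"
  then obtain b where "\<forall>\<^sub>F k in sequentially. \<exists>A\<in>sets M. prob A < \<delta> \<and> (\<forall>\<omega>\<in>space M - A. R k \<omega> \<le> b)"
    using assms(1) unfolding bounded_in_prob_def by blast
  then have "\<forall>\<^sub>F k in sequentially. \<exists>A\<in>sets M. prob A < \<delta> \<and> (\<forall>\<omega>\<in>space M - A. r * R k \<omega> \<le> r * b)"
    by eventually_elim (use assms(2) in \<open>blast intro: mult_left_mono\<close>)
  then show "\<exists>b. \<forall>\<^sub>F k in sequentially. \<exists>A\<in>sets M. prob A < \<delta> \<and> (\<forall>\<omega>\<in>space M - A. r * R k \<omega> \<le> b)" ..
qed

lemma (in prob_space) bounded_in_prob_tight: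
  fixes Z :: "nat \<Rightarrow> 'a \<Rightarrow> 'b::real_normed_vector"
  assumes "bounded_in_prob M (\<lambda>k \<omega>. norm (Z k \<omega>))" "\<epsilon> > 0"
  shows "\<exists>R. \<forall>\<^sub>F k in sequentially. prob {\<omega> \<in> space M. R < norm (Z k \<omega>)} < \<epsilon>"
proof -
  obtain b where "\<forall>\<^sub>F k in sequentially. \<exists>A\<in>sets M. prob A < \<epsilon> \<and> (\<forall>\<omega>\<in>space M - A. norm (Z k \<omega>) \<le> b)"
    using assms unfolding bounded_in_prob_def by blast
  then have "\<forall>\<^sub>F k in sequentially. prob {\<omega> \<in> space M. b < norm (Z k \<omega>)} < \<epsilon>"
  proof eventually_elim
    case (elim k)
    then obtain A where A: "A \<in> sets M" "prob A < \<epsilon>" "\<forall>\<omega>\<in>space M - A. norm (Z k \<omega>) \<le> b" by blast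
    have "prob {\<omega> \<in> space M. b < norm (Z k \<omega>)} \<le> prob A"
      using A by (intro finite_measure_mono) (auto simp: not_le[symmetric])
    with A show ?case by simp
  qed
  then show ?thesis ..
qed

lemma converges_in_distribution_Suc:
  "converges_in_distribution P (\<lambda>k. Z (Suc k)) N \<Longrightarrow> converges_in_distribution P Z N"
  unfolding converges_in_distribution_def by (auto dest: LIMSEQ_imp_Suc)

theorem theorem5p2:
  fixes \<X> :: "'x::metric_space set"
    and \<Theta> :: "(real ^ 'p) set"
    and \<mu> :: "'x \<Rightarrow> real ^ 'p \<Rightarrow> real"
    and f :: "real ^ 'p \<Rightarrow> 'x \<Rightarrow> real ^ 'p"
    and P :: "'w measure"
    and X :: "nat \<Rightarrow> 'w \<Rightarrow> 'x"
    and Y e :: "nat \<Rightarrow> 'w \<Rightarrow> real"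
    and \<theta>\<^sub>0 :: "real ^ 'p"
    and n1 :: nat
    and n :: "nat \<Rightarrow> nat"
    and B :: "nat \<Rightarrow> nat set"
    and est est_LS :: "nat \<Rightarrow> 'w \<Rightarrow> real ^ 'p"
    and F :: "nat \<Rightarrow> 'w measure"
    and grad :: "'x \<Rightarrow> real ^ 'p \<Rightarrow> real ^ 'p"
    and hess :: "'x \<Rightarrow> real ^ 'p \<Rightarrow> real ^ 'p ^ 'p"
    and \<sigma>2 :: real
  defines "n \<equiv> sample_size CARD('p) n1"
    and "B \<equiv> block CARD('p) n1"
  (* setting *)
  assumes "compact \<X>" and "compact \<Theta>"
    and "continuous_on (\<X> \<times> \<Theta>) (\<lambda>(x, \<theta>). \<mu> x \<theta>)"
    and "continuous_on (\<X> \<times> \<Theta>) (\<lambda>(x, \<theta>). f \<theta> x)"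
    and "\<forall>\<theta>\<in>\<Theta>. span (f \<theta> ` \<X>) = UNIV"
    and "\<theta>\<^sub>0 \<in> \<Theta>"
  (* process and algorithm *)
    and "prob_space P"
    and "\<forall>i\<ge>1. X i \<in> P \<rightarrow>\<^sub>M restrict_space borel \<X>"
    and "\<forall>i\<ge>1. Y i \<in> borel_measurable P"
    and "n1 \<ge> 1"
    and "adaptive_estimators P \<X> \<Theta> X Y n est"
    and "\<forall>k\<ge>1. \<forall>\<omega>\<in>space P.
           is_arg_max (sq_det f (est k \<omega>)) (\<lambda>z. \<forall>j. z j \<in> \<X>) (\<lambda>j. X (n k + pos j) \<omega>)"
  (* adaptive least squares estimators *)
    and "adaptive_estimators P \<X> \<Theta> X Y n est_LS"
    and "\<forall>k\<ge>1. \<forall>\<omega>\<in>space P.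
           is_arg_min (\<lambda>\<theta>. \<Sum>i=1..n k. (Y i \<omega> - \<mu> (X i \<omega>) \<theta>)\<^sup>2) (\<lambda>\<theta>. \<theta> \<in> \<Theta>) (est_LS k \<omega>)"
  (* (a1) *)
    and "\<forall>k. subalgebra P (F k)"
    and "\<forall>k. sets (F k) \<subseteq> sets (F (Suc k))"
    and "\<forall>k\<ge>1. (\<lambda>\<omega>. \<lambda>i\<in>B k. X i \<omega>) \<in> F (k - 1) \<rightarrow>\<^sub>M PiM (B k) (\<lambda>_. restrict_space borel \<X>)"
    and "\<forall>k\<ge>1. (\<lambda>\<omega>. \<lambda>i\<in>B k. Y i \<omega>) \<in> F k \<rightarrow>\<^sub>M PiM (B k) (\<lambda>_. borel)"
  (* (a2) *)
    and "\<forall>i\<ge>1. \<forall>\<omega>\<in>space P. Y i \<omega> = \<mu> (X i \<omega>) \<theta>\<^sub>0 + e i \<omega>"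
    and "\<forall>i\<ge>1. e i \<in> borel_measurable P \<and> integrable P (\<lambda>\<omega>. (e i \<omega>)\<^sup>2)"
    and "\<forall>k\<ge>1. \<forall>i\<in>B k. AE \<omega> in P. real_cond_exp P (F (k - 1)) (e i) \<omega> = 0"
    and "AE \<omega> in P. bdd_above
           ((\<lambda>k. real_cond_exp P (F (k - 1)) (\<lambda>\<omega>'. (L2_set (\<lambda>i. e i \<omega>') (B k))\<^sup>2) \<omega>) ` {1..})"
  (* (b5) *)
    and "interior \<Theta> \<noteq> {}"
    and "\<forall>x\<in>\<X>. \<forall>\<theta>\<in>interior \<Theta>. GDERIV (\<mu> x) \<theta> :> (grad x \<theta>)"
    and "\<forall>x\<in>\<X>. \<forall>\<theta>\<in>interior \<Theta>. (grad x has_derivative (\<lambda>h. hess x \<theta> *v h)) (at \<theta>)"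
    and "continuous_on (\<X> \<times> interior \<Theta>) (\<lambda>(x, \<theta>). grad x \<theta>)"
    and "continuous_on (\<X> \<times> interior \<Theta>) (\<lambda>(x, \<theta>). hess x \<theta>)"
    and "\<forall>x\<in>\<X>. \<forall>\<theta>\<in>interior \<Theta>. f \<theta> x = grad x \<theta>"
  (* (L) *)
    and "\<forall>\<epsilon>>0. AE \<omega> in P.
           (\<lambda>k. 1 / real k * (\<Sum>j=1..k. real_cond_exp P (F (j - 1))
              (\<lambda>\<omega>'. (L2_set (\<lambda>i. e i \<omega>') (B j))\<^sup>2 *
                 indicator {\<omega>''. L2_set (\<lambda>i. e i \<omega>'') (B j) > \<epsilon> * sqrt (real k)} \<omega>') \<omega>))
           \<longlonglongrightarrow> 0"
  (* (AH), written for the block k + 1, which has length p if k is at least 1 *)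
    and "\<sigma>2 > 0"
    and "AE \<omega> in P.
           (\<lambda>k. (\<chi> i j. real_cond_exp P (F k)
              (\<lambda>\<omega>'. e (n k + pos i) \<omega>' * e (n k + pos j) \<omega>') \<omega>) :: real ^ 'p ^ 'p)
           \<longlonglongrightarrow> \<sigma>2 *\<^sub>R mat 1"
  (* (SD) *)
    and "\<forall>\<eta> \<eta>'. D_optimal_saturated \<X> f \<theta>\<^sub>0 \<eta> \<and> D_optimal_saturated \<X> f \<theta>\<^sub>0 \<eta>' \<longrightarrow>
           info_matrix f \<eta> \<theta>\<^sub>0 = info_matrix f \<eta>' \<theta>\<^sub>0"
  (* strong consistency *)
    and "AE \<omega> in P. (\<lambda>k. est k \<omega>) \<longlonglongrightarrow> \<theta>\<^sub>0"
    and "AE \<omega> in P. (\<lambda>k. est_LS k \<omega>) \<longlonglongrightarrow> \<theta>\<^sub>0"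
    and "\<theta>\<^sub>0 \<in> interior \<Theta>"
  shows "converges_in_distribution P
           (\<lambda>k \<omega>. sqrt (real (n k)) *\<^sub>R (est_LS k \<omega> - \<theta>\<^sub>0))
           (centred_normal (\<sigma>2 *\<^sub>R matrix_inv (D_optimal_saturated_info \<X> f \<theta>\<^sub>0)))"
proof -
  note compX = assms(3) and compT = assms(4) and cont_mu = assms(5) and cont_f = assms(6)
    and spanning = assms(7) and \<theta>0T = assms(8) and prob = assms(9)
    and X_meas = assms(10)[rule_format] and Y_meas = assms(11)[rule_format] and n1 = assms(12)
    and est_adapted = assms(13) and est_max = assms(14)[rule_format]
    and LS_adapted = assms(15) and LS_min = assms(16)[rule_format]
    and subalg = assms(17)[rule_format] and filt = assms(18)[rule_format]
    and X_pred = assms(19)[rule_format] and Y_adapted = assms(20)[rule_format]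
    and Y_eq = assms(21)[rule_format] and e_sq = assms(22)[rule_format] and e_centred = assms(23)[rule_format]
    and grad_deriv = assms(26)[rule_format] and hess_deriv = assms(27)[rule_format]
    and grad_cont = assms(28) and hess_cont = assms(29) and f_grad = assms(30)[rule_format]
    and lindeberg = assms(31)[rule_format] and \<sigma>2_pos = assms(32) and AH = assms(33)
    and SD = assms(34)[rule_format] and est_lim = assms(35) and LS_lim = assms(36) and \<theta>0_int = assms(37)
  let ?p = "CARD('p)"
  interpret prob_space P by (rule prob)
  \<comment> \<open>blocks are counted from zero, so \<open>Bl j\<close> is revealed between times \<open>j\<close> and \<open>j + 1\<close>\<close>
  define Bl where "Bl = (\<lambda>j. B (Suc j))"
  define g where "g = (\<lambda>i \<omega>. f \<theta>\<^sub>0 (X i \<omega>))"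
  define H where "H = (\<lambda>i \<omega>. hess (X i \<omega>) \<theta>\<^sub>0)"
  define M where "M = D_optimal_saturated_info \<X> f \<theta>\<^sub>0"
  define m where "m = n1 + ?p"
  \<comment> \<open>the conditional second moments of the blocks converge to \<open>p \<sigma>2 < c\<close>\<close>
  define c where "c = real ?p * \<sigma>2 + 1"
  have n_Suc: "n (Suc k) = n1 + k * ?p" for k
    by (simp add: n_def sample_size_Suc)
  have n_ge: "n (Suc k) \<ge> 1" for k using n1 by (simp add: n_Suc)
  have Bl_ge: "i \<ge> 1" if "i \<in> Bl j" for i j using block_ge_1 that by (auto simp: Bl_def B_def)
  have fin_Bl: "finite (Bl j)" for j by (simp add: Bl_def B_def finite_block)
  have late: "(\<Sum>i\<in>Bl j. x i) = (\<Sum>\<alpha>\<in>(UNIV :: 'p set). x (n j + pos \<alpha>))" if "j \<ge> 1"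
    for j and x :: "nat \<Rightarrow> 'b::comm_monoid_add"
    unfolding Bl_def B_def n_def by (rule sum_later_block[OF that])
  have X_in: "X i \<omega> \<in> \<X>" if "i \<ge> 1" "\<omega> \<in> space P" for i \<omega>
    using measurable_space[OF X_meas[OF that(1)] that(2)] by (simp add: space_restrict_space)

  have est_in: "est k \<omega> \<in> \<Theta>" if "k \<ge> 1" "\<omega> \<in> space P" for k \<omega>
    using measurable_space[OF adaptive_estimators_measurable[OF est_adapted X_meas Y_meas that(1)] that(2)]
    by (simp add: space_restrict_space)
  have LS_meas: "est_LS k \<in> borel_measurable P" and LS_in: "\<And>\<omega>. \<omega> \<in> space P \<Longrightarrow> est_LS k \<omega> \<in> \<Theta>" if "k \<ge> 1" for k
  proof -
    note m = adaptive_estimators_measurable[OF LS_adapted X_meas Y_meas that]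
    show "est_LS k \<in> borel_measurable P"
      using m by (simp add: measurable_restrict_space2_iff)
    show "est_LS k \<omega> \<in> \<Theta>" if "\<omega> \<in> space P" for \<omega>
      using measurable_space[OF m that] by (simp add: space_restrict_space)
  qed
  have X_F: "X i \<in> F j \<rightarrow>\<^sub>M restrict_space borel \<X>" if "i \<in> Bl j" for i j
    using measurable_compose[OF X_pred[of "Suc j"] measurable_component_singleton[of i]] that
    by (simp add: Bl_def)
  have Y_F: "Y i \<in> borel_measurable (F (Suc j))" if "i \<in> Bl j" for i j
    using measurable_compose[OF Y_adapted[of "Suc j"] measurable_component_singleton[of i]] that
    by (simp add: Bl_def)
  have cont_f0: "continuous_on \<X> (f \<theta>\<^sub>0)"
    by (rule continuous_on_compose2[OF cont_f, of _ "\<lambda>x. (x, \<theta>\<^sub>0)", simplified])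
       (use \<theta>0T in \<open>auto intro!: continuous_intros\<close>)
  have cont_mu0: "continuous_on \<X> (\<lambda>x. \<mu> x \<theta>\<^sub>0)"
    by (rule continuous_on_compose2[OF cont_mu, of _ "\<lambda>x. (x, \<theta>\<^sub>0)", simplified])
       (use \<theta>0T in \<open>auto intro!: continuous_intros\<close>)
  have cont_hess0: "continuous_on \<X> (\<lambda>x. hess x \<theta>\<^sub>0)"
    by (rule continuous_on_compose2[OF hess_cont, of _ "\<lambda>x. (x, \<theta>\<^sub>0)", simplified])
       (use \<theta>0_int in \<open>auto intro!: continuous_intros\<close>)
  have g_F: "g i \<in> borel_measurable (F j)" and H_F: "H i \<in> borel_measurable (F j)" if "i \<in> Bl j" for i j
    unfolding g_def H_def
    by (rule measurable_compose[OF X_F[OF that] borel_measurable_continuous_on_restrict[OF cont_f0]],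
        rule measurable_compose[OF X_F[OF that] borel_measurable_continuous_on_restrict[OF cont_hess0]])
  have spF: "space (F j) = space P" for j using subalg by (simp add: subalgebra_def)
  have e_F: "e i \<in> borel_measurable (F (Suc j))" if "i \<in> Bl j" for i j
  proof -
    have "(\<lambda>\<omega>. \<mu> (X i \<omega>) \<theta>\<^sub>0) \<in> borel_measurable (F j)"
      by (rule measurable_compose[OF X_F[OF that] borel_measurable_continuous_on_restrict[OF cont_mu0]])
    then have "(\<lambda>\<omega>. \<mu> (X i \<omega>) \<theta>\<^sub>0) \<in> borel_measurable (F (Suc j))"
      using filt[of j] spF by (auto simp: measurable_def)
    with Y_F[OF that] have "(\<lambda>\<omega>. Y i \<omega> - \<mu> (X i \<omega>) \<theta>\<^sub>0) \<in> borel_measurable (F (Suc j))"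
      by measurable
    then show ?thesis
      by (rule measurable_cong[THEN iffD1, rotated]) (use Y_eq Bl_ge[OF that] in \<open>auto simp: spF\<close>)
  qed

  obtain Cb where Cb: "\<And>x. x \<in> \<X> \<Longrightarrow> norm (f \<theta>\<^sub>0 x) \<le> Cb" "\<And>x. x \<in> \<X> \<Longrightarrow> norm (hess x \<theta>\<^sub>0) \<le> Cb" "Cb \<ge> 0"
  proof -
    obtain C1 where C1: "\<And>x. x \<in> \<X> \<Longrightarrow> norm (f \<theta>\<^sub>0 x) \<le> C1"
      using compact_imp_bounded[OF compact_continuous_image[OF cont_f0 compX]] by (auto simp: bounded_iff)
    obtain C2 where C2: "\<And>x. x \<in> \<X> \<Longrightarrow> norm (hess x \<theta>\<^sub>0) \<le> C2"
      using compact_imp_bounded[OF compact_continuous_image[OF cont_hess0 compX]] by (auto simp: bounded_iff)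
    show ?thesis
    proof (rule that[of "max 0 (max C1 C2)"])
      fix x assume "x \<in> \<X>"
      from C1[OF this] C2[OF this]
      show "norm (f \<theta>\<^sub>0 x) \<le> max 0 (max C1 C2)" "norm (hess x \<theta>\<^sub>0) \<le> max 0 (max C1 C2)" by linarith+
    qed simp
  qed

  have span0: "span (f \<theta>\<^sub>0 ` \<X>) = UNIV" using spanning \<theta>0T by blast
  obtain z where z: "is_arg_max (sq_det f \<theta>\<^sub>0) (\<lambda>z. \<forall>j. z j \<in> \<X>) z" "sq_det f \<theta>\<^sub>0 z > 0"
    using exists_D_optimal_points[of \<X> f \<theta>\<^sub>0, OF compX cont_f0 span0] by blast
  define Gz where "Gz = ((\<chi> j. f \<theta>\<^sub>0 (z j)) :: real^'p^'p)"
  have detG: "det Gz \<noteq> 0" using z(2) by (simp add: Gz_def sq_det_eq)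
  have M_eq: "M = (1 / real ?p) *\<^sub>R (transpose Gz ** Gz)"
    unfolding M_def sum_outer_eq[symmetric] Gz_def vec_lambda_beta
    by (rule D_optimal_saturated_info_eq[OF z]) (use SD in blast)
  have p_pos: "1 / real ?p > 0" by simp
  define Mi where "Mi = matrix_inv M"
  note gm = gram_matrix[OF detG M_eq p_pos \<sigma>2_pos, folded Mi_def]
  obtain A :: "real^'p^'p" where A: "invertible A" "\<sigma>2 *\<^sub>R Mi = A ** transpose A"
    using gm(5) by blast

  have info_blocks: "AE \<omega> in P. (\<lambda>j. \<Sum>i\<in>Bl j. outer (g i \<omega>)) \<longlonglongrightarrow> real ?p *\<^sub>R M"
    using est_lim AE_space
  proof eventually_elim
    case (elim \<omega>)
    have "(\<lambda>k. \<Sum>\<alpha>\<in>UNIV. outer (f \<theta>\<^sub>0 (X (n (Suc k) + pos (\<alpha> :: 'p)) \<omega>))) \<longlonglongrightarrow> real ?p *\<^sub>R M"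
      unfolding M_def
    proof (rule information_of_adaptive_blocks[OF compX compT cont_f span0 \<theta>0T, where est = "\<lambda>k. est (Suc k) \<omega>"])
      show "(\<lambda>k. est (Suc k) \<omega>) \<longlonglongrightarrow> \<theta>\<^sub>0" by (rule LIMSEQ_Suc[OF elim(1)])
      show "est (Suc k) \<omega> \<in> \<Theta>" for k by (rule est_in[OF _ elim(2)]) simp
      show "is_arg_max (sq_det f (est (Suc k) \<omega>)) (\<lambda>z. \<forall>j. z j \<in> \<X>) (\<lambda>\<alpha>. X (n (Suc k) + pos \<alpha>) \<omega>)" for k
        by (rule est_max[OF _ elim(2)]) simp
      show "info_matrix f \<eta> \<theta>\<^sub>0 = info_matrix f \<eta>' \<theta>\<^sub>0"
        if "D_optimal_saturated \<X> f \<theta>\<^sub>0 \<eta>" "D_optimal_saturated \<X> f \<theta>\<^sub>0 \<eta>'" for \<eta> \<eta>'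
        using SD that by blast
    qed
    then have "(\<lambda>k. \<Sum>i\<in>Bl (Suc k). outer (g i \<omega>)) \<longlonglongrightarrow> real ?p *\<^sub>R M"
      by (simp add: late g_def)
    then show ?case by (rule LIMSEQ_imp_Suc)
  qed

  have e_sq': "integrable P (\<lambda>\<omega>. (e i \<omega>)\<^sup>2)" if "i \<ge> 1" for i
    using e_sq[OF that] by simp
  have AH_entry: "AE \<omega> in P. \<forall>\<alpha> \<beta>. (\<lambda>k. real_cond_exp P (F k) (\<lambda>\<omega>'. e (n k + pos \<alpha>) \<omega>' * e (n k + pos \<beta>) \<omega>') \<omega>)
      \<longlonglongrightarrow> \<sigma>2 * mat 1 $ \<alpha> $ (\<beta> :: 'p)"
    using AH
  proof eventually_elim
    case (elim \<omega>)
    show ?case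
    proof (intro allI)
      fix \<alpha> \<beta> :: 'p
      show "(\<lambda>k. real_cond_exp P (F k) (\<lambda>\<omega>'. e (n k + pos \<alpha>) \<omega>' * e (n k + pos \<beta>) \<omega>') \<omega>) \<longlonglongrightarrow> \<sigma>2 * mat 1 $ \<alpha> $ \<beta>"
        using tendsto_vec_nth[OF tendsto_vec_nth[OF elim], of \<alpha> \<beta>] by simp
    qed
  qed
  have small: "AE \<omega> in P. \<forall>\<^sub>F j in sequentially. real_cond_exp P (F j) (\<lambda>\<omega>. \<Sum>i\<in>Bl j. (e i \<omega>)\<^sup>2) \<omega> \<le> c"
  proof -
    have "AE \<omega> in P. real_cond_exp P (F j) (\<lambda>\<omega>. \<Sum>i\<in>Bl j. (e i \<omega>)\<^sup>2) \<omega> = (\<Sum>i\<in>Bl j. real_cond_exp P (F j) (\<lambda>\<omega>. (e i \<omega>)\<^sup>2) \<omega>)" for j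
    proof -
      interpret Fj: sigma_finite_subalgebra P "F j"
        by (intro finite_measure_subalgebra_is_sigma_finite finite_measure_subalgebra.intro
          finite_measure_subalgebra_axioms.intro subalg) unfold_locales
      show ?thesis by (rule Fj.real_cond_exp_sum_on) (use e_sq' Bl_ge in blast)
    qed
    then have "AE \<omega> in P. \<forall>j. real_cond_exp P (F j) (\<lambda>\<omega>. \<Sum>i\<in>Bl j. (e i \<omega>)\<^sup>2) \<omega> = (\<Sum>i\<in>Bl j. real_cond_exp P (F j) (\<lambda>\<omega>. (e i \<omega>)\<^sup>2) \<omega>)"
      unfolding AE_all_countable by blast
    with AH_entry show ?thesis
    proof eventually_elim
      case (elim \<omega>)
      note sum_eq = elim(2)
      have "(\<lambda>j. \<Sum>\<alpha>\<in>(UNIV :: 'p set). real_cond_exp P (F j) (\<lambda>\<omega>'. e (n j + pos \<alpha>) \<omega>' * e (n j + pos \<alpha>) \<omega>') \<omega>)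
          \<longlonglongrightarrow> (\<Sum>\<alpha>\<in>(UNIV :: 'p set). \<sigma>2 * mat 1 $ \<alpha> $ \<alpha>)"
        using elim(1) by (intro tendsto_sum) blast
      moreover have "(\<Sum>\<alpha>\<in>(UNIV :: 'p set). \<sigma>2 * mat 1 $ \<alpha> $ \<alpha>) < c"
        by (simp add: mat_def c_def)
      ultimately have "\<forall>\<^sub>F j in sequentially. (\<Sum>\<alpha>\<in>(UNIV :: 'p set). real_cond_exp P (F j)
          (\<lambda>\<omega>'. e (n j + pos \<alpha>) \<omega>' * e (n j + pos \<alpha>) \<omega>') \<omega>) < c"
        by (rule order_tendstoD)
      then show ?case using eventually_ge_at_top[of 1]
      proof eventually_elim
        case (elim j)
        then show ?case
          unfolding sum_eq[rule_format] unfolding late[OF elim(2)] power2_eq_square by simp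
      qed
    qed
  qed
  interpret BE: block_errors P F e Bl m c
  proof (intro block_errors.intro block_errors_axioms.intro prob subalg filt fin_Bl e_F small)
    show "card (Bl j) \<le> m" for j unfolding Bl_def B_def m_def by (rule card_block_le)
    show "integrable P (\<lambda>\<omega>. (e i \<omega>)\<^sup>2)" if "i \<in> Bl j" for i j using e_sq'[OF Bl_ge[OF that]] .
    show "AE \<omega> in P. real_cond_exp P (F j) (e i) \<omega> = 0" if "i \<in> Bl j" for i j
      using e_centred[of "Suc j" i] that by (simp add: Bl_def)
    show "c \<ge> 0" using \<sigma>2_pos by (simp add: c_def)
  qed
  interpret RS: regression_scores P F e Bl m c g H M "\<lambda>k. n (Suc k)" \<sigma>2 Cb
  proof (intro regression_scores.intro regression_scores_axioms.intro BE.block_errors_axioms g_F H_F info_blocks)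
    show "norm (g i \<omega>) \<le> Cb" "norm (H i \<omega>) \<le> Cb" if "i \<in> Bl j" "\<omega> \<in> space P" for i j \<omega>
      using Cb X_in[OF Bl_ge[OF that(1)] that(2)] by (auto simp: g_def H_def)
    show "0 < n (Suc k)" for k using n_ge[of k] by simp
    have "(\<lambda>k. (real n1 + real k * real ?p) / real (Suc k)) \<longlonglongrightarrow> real ?p"
      by real_asymp
    then show "(\<lambda>k. real (n (Suc k)) / real (Suc k)) \<longlonglongrightarrow> real ?p"
      by (simp add: n_Suc)
    show "0 \<le> \<sigma>2" using \<sigma>2_pos by simp
    show "0 \<le> u \<bullet> (M *v u)" for u by (rule gm(4))
    fix u :: "real^'p"
    show "AE \<omega> in P. (\<lambda>j. \<Sum>i\<in>Bl j. \<Sum>l\<in>Bl j. (u \<bullet> g i \<omega>) * (u \<bullet> g l \<omega>) *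
        real_cond_exp P (F j) (\<lambda>\<omega>. e i \<omega> * e l \<omega>) \<omega>) \<longlonglongrightarrow> \<sigma>2 * real ?p * (u \<bullet> (M *v u))"
      using AH info_blocks AE_space
    proof eventually_elim
      case (elim \<omega>)
      let ?y = "\<lambda>j (\<alpha> :: 'p). u \<bullet> g (n j + pos \<alpha>) \<omega>"
      let ?V = "\<lambda>k. (\<chi> i j. real_cond_exp P (F k) (\<lambda>\<omega>'. e (n k + pos i) \<omega>' * e (n k + pos j) \<omega>') \<omega>) :: real^'p^'p"
      have ev: "\<forall>\<^sub>F j in sequentially. (\<Sum>i\<in>Bl j. (u \<bullet> g i \<omega>)\<^sup>2) = (\<Sum>\<alpha>\<in>UNIV. (?y j \<alpha>)\<^sup>2)"
        using eventually_ge_at_top[of 1] by eventually_elim (rule late)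
      have "(\<lambda>j. \<Sum>i\<in>Bl j. (u \<bullet> g i \<omega>)\<^sup>2) \<longlonglongrightarrow> u \<bullet> ((real ?p *\<^sub>R M) *v u)"
        unfolding sum_inner_square by (rule tendsto_quadratic[OF elim(2)])
      then have s: "(\<lambda>j. \<Sum>\<alpha>\<in>UNIV. (?y j \<alpha>)\<^sup>2) \<longlonglongrightarrow> u \<bullet> ((real ?p *\<^sub>R M) *v u)"
        by (rule Lim_transform_eventually[OF _ ev])
      have "\<bar>?y j \<alpha>\<bar> \<le> norm u * Cb" for j \<alpha>
      proof -
        have "n j + pos \<alpha> \<ge> 1" by (simp add: pos_def)
        from Cb(1)[OF X_in[OF this elim(3)]] show ?thesis
          by (intro order_trans[OF Cauchy_Schwarz_ineq2] mult_left_mono) (auto simp: g_def)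
      qed
      then have "(\<lambda>j. \<Sum>\<alpha>\<in>UNIV. \<Sum>\<beta>\<in>UNIV. ?y j \<alpha> * ?y j \<beta> * ?V j $ \<alpha> $ \<beta>) \<longlonglongrightarrow> \<sigma>2 * (u \<bullet> ((real ?p *\<^sub>R M) *v u))"
        by (intro quadratic_form_tendsto[OF _ elim(1) s] always_eventually allI)
      moreover have "u \<bullet> ((real ?p *\<^sub>R M) *v u) = real ?p * (u \<bullet> (M *v u))"
        by (simp add: scaleR_matrix_vector_assoc[symmetric])
      ultimately have "(\<lambda>j. \<Sum>\<alpha>\<in>UNIV. \<Sum>\<beta>\<in>UNIV. ?y j \<alpha> * ?y j \<beta> * ?V j $ \<alpha> $ \<beta>) \<longlonglongrightarrow> \<sigma>2 * real ?p * (u \<bullet> (M *v u))"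
        by (simp only: mult.assoc)
      moreover have "\<forall>\<^sub>F j in sequentially. (\<Sum>\<alpha>\<in>UNIV. \<Sum>\<beta>\<in>UNIV. ?y j \<alpha> * ?y j \<beta> * ?V j $ \<alpha> $ \<beta>)
          = (\<Sum>i\<in>Bl j. \<Sum>l\<in>Bl j. (u \<bullet> g i \<omega>) * (u \<bullet> g l \<omega>) * real_cond_exp P (F j) (\<lambda>\<omega>. e i \<omega> * e l \<omega>) \<omega>)"
        using eventually_ge_at_top[of 1] by eventually_elim (simp add: late)
      ultimately show ?case by (rule Lim_transform_eventually)
    qed
  next
    fix \<epsilon> :: real assume "\<epsilon> > 0"
    from lindeberg[OF this]
    show "AE \<omega> in P. (\<lambda>K. (1 / real K) * (\<Sum>j<K. real_cond_exp P (F j)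
        (\<lambda>\<omega>. BE.Q j \<omega> * indicator {\<omega>. \<epsilon> * sqrt (real K) < sqrt (BE.Q j \<omega>)} \<omega>) \<omega>)) \<longlonglongrightarrow> 0"
      unfolding BE.Q_def by (simp add: sum.atLeast1_atMost_eq L2_set_def Bl_def sum_nonneg)
  qed

  \<comment> \<open>the estimators are considered from \<open>k = 1\<close> on, where they are measurable\<close>
  define h where "h = (\<lambda>k \<omega>. est_LS (Suc k) \<omega> - \<theta>\<^sub>0)"
  define Z where "Z = (\<lambda>k \<omega>. sqrt (real (n (Suc k))) *\<^sub>R h k \<omega>)"
  have h_meas [measurable]: "h k \<in> borel_measurable P" for k
    unfolding h_def using LS_meas[of "Suc k"] by measurable
  have Z_meas [measurable]: "Z k \<in> borel_measurable P" for k
    unfolding Z_def by measurable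
  have blocks: "(\<Sum>i=1..n (Suc k). x i) = (\<Sum>j<Suc k. \<Sum>i\<in>Bl j. x i)" for k and x :: "nat \<Rightarrow> 'b::comm_monoid_add"
    unfolding Bl_def B_def n_def by (rule sum_over_blocks)
  have grad0: "grad x \<theta>\<^sub>0 = f \<theta>\<^sub>0 x" if "x \<in> \<X>" for x
    using f_grad[OF that \<theta>0_int] by simp
  \<comment> \<open>\<open>\<surd>n (est_LS - \<theta>\<^sub>0)\<close> is asymptotically the linear image \<open>M\<^sup>-\<^sup>1 T\<close> of the normalized score\<close>
  have close: "with_high_prob P (\<lambda>k \<omega>. norm (Z k \<omega> - Mi *v RS.T k \<omega>) \<le> \<epsilon>)" if "\<epsilon> > 0" for \<epsilon>
  proof (rule with_high_prob_bounded[OF bounded_in_prob_add[OF RS.T_bounded_in_prob RS.abs_errors_bounded]])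
    fix b :: real assume "b > 0"
    let ?a = "\<lambda>k \<omega>. (\<Sum>j<Suc k. \<Sum>i\<in>Bl j. \<bar>e i \<omega>\<bar>)"
    \<comment> \<open>the constants are chosen to meet the hypotheses of \<open>linearized_estimator_close\<close>\<close>
    define \<mu>i where "\<mu>i = norm Mi + 1"
    have "\<mu>i > 0" "norm Mi \<le> \<mu>i" by (auto simp: \<mu>i_def add_nonneg_pos)
    define \<rho> where "\<rho> = min (1 / 2 / \<mu>i) (\<epsilon> / 4 / (\<mu>i\<^sup>2 * (b + 1)))"
    have "\<rho> > 0" using \<open>\<mu>i > 0\<close> \<open>b > 0\<close> \<open>\<epsilon> > 0\<close> by (simp add: \<rho>_def)
    have \<rho>1: "norm Mi * \<rho> \<le> 1 / 2"
    proof -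
      have "norm Mi * \<rho> \<le> \<mu>i * (1 / 2 / \<mu>i)"
        using \<open>norm Mi \<le> \<mu>i\<close> \<open>\<rho> > 0\<close> \<open>\<mu>i > 0\<close> by (intro mult_mono) (auto simp: \<rho>_def)
      then show ?thesis using \<open>\<mu>i > 0\<close> by simp
    qed
    have \<rho>2: "2 * (norm Mi)\<^sup>2 * \<rho> * (b + 1) \<le> \<epsilon> / 2"
    proof -
      have pos: "\<mu>i\<^sup>2 * (b + 1) > 0" using \<open>\<mu>i > 0\<close> \<open>b > 0\<close> by simp
      have "(norm Mi)\<^sup>2 \<le> \<mu>i\<^sup>2" using \<open>norm Mi \<le> \<mu>i\<close> by (intro power_mono) auto
      then have "((norm Mi)\<^sup>2 * (b + 1)) * \<rho> \<le> (\<mu>i\<^sup>2 * (b + 1)) * (\<epsilon> / 4 / (\<mu>i\<^sup>2 * (b + 1)))"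
        using \<open>\<rho> > 0\<close> \<open>b > 0\<close> pos by (intro mult_mono) (auto simp: \<rho>_def)
      also have "\<dots> = \<epsilon> / 4"
      proof -
        have "y * (\<epsilon> / 4 / y) = \<epsilon> / 4" if "y > 0" for y using that by simp
        from this[OF pos] show ?thesis .
      qed
      finally show ?thesis by (simp add: mult_ac)
    qed
    define \<kappa> where "\<kappa> = min 1 (\<epsilon> / 2 / \<mu>i)"
    have "\<kappa> > 0" "\<kappa> \<le> 1" using \<open>\<mu>i > 0\<close> \<open>\<epsilon> > 0\<close> by (auto simp: \<kappa>_def)
    have \<kappa>: "norm Mi * \<kappa> \<le> \<epsilon> / 2"
    proof -
      have "norm Mi * \<kappa> \<le> \<mu>i * (\<epsilon> / 2 / \<mu>i)"
        using \<open>norm Mi \<le> \<mu>i\<close> \<open>\<kappa> > 0\<close> \<open>\<mu>i > 0\<close> by (intro mult_mono) (auto simp: \<kappa>_def)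
      then show ?thesis using \<open>\<mu>i > 0\<close> by simp
    qed
    define \<eta> where "\<eta> = min 1 (\<rho> / 4 / (b + 2 * Cb + 1))"
    have den: "b + 2 * Cb + 1 > 0" using \<open>b > 0\<close> Cb(3) by simp
    have "\<eta> > 0" "\<eta> \<le> 1" using den \<open>\<rho> > 0\<close> by (auto simp: \<eta>_def)
    have "\<eta> * (b + 2 * Cb + 1) \<le> (\<rho> / 4 / (b + 2 * Cb + 1)) * (b + 2 * Cb + 1)"
      using den by (intro mult_right_mono) (auto simp: \<eta>_def)
    also have "\<dots> = \<rho> / 4"
    proof -
      have "\<rho> / 4 / y * y = \<rho> / 4" if "y > 0" for y using that by simp
      from this[OF den] show ?thesis .
    qed
    finally have \<eta>0: "\<eta> * (b + 2 * Cb + 1) \<le> \<rho> / 4" .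
    have \<eta>1: "\<eta> * b \<le> \<rho> / 4"
      by (rule order_trans[OF mult_left_mono \<eta>0]) (use \<open>\<eta> > 0\<close> Cb(3) in auto)
    have \<eta>2: "\<eta> * (2 * Cb + \<eta>) \<le> \<rho> / 4"
      by (rule order_trans[OF mult_left_mono \<eta>0]) (use \<open>\<eta> > 0\<close> \<open>\<eta> \<le> 1\<close> \<open>b > 0\<close> in auto)
    obtain \<delta>1 where "\<delta>1 > 0" and \<delta>1: "\<And>x h. x \<in> \<X> \<Longrightarrow> norm h < \<delta>1 \<Longrightarrow> norm (\<mu> x (\<theta>\<^sub>0 + h) - \<mu> x \<theta>\<^sub>0 - h \<bullet> grad x \<theta>\<^sub>0) \<le> \<eta> * norm h"
    proof (rule uniform_first_order_expansion[of \<X> "interior \<Theta>" \<theta>\<^sub>0 \<mu> "\<lambda>v h. h \<bullet> v" grad \<eta>, OF compX open_interior \<theta>0_int])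
      show "(\<mu> x has_derivative (\<lambda>h. h \<bullet> grad x \<theta>)) (at \<theta>)" if "x \<in> \<X>" "\<theta> \<in> interior \<Theta>" for x \<theta>
        using grad_deriv[OF that] by (simp add: gderiv_def)
      show "norm (h \<bullet> u - h \<bullet> v) \<le> norm (u - v) * norm h" for u v h :: "real^'p"
        using Cauchy_Schwarz_ineq2[of h "u - v"] by (simp add: inner_diff_right mult.commute)
    qed (use grad_cont \<open>\<eta> > 0\<close> in auto)
    obtain \<delta>2 where "\<delta>2 > 0" and \<delta>2ball: "ball \<theta>\<^sub>0 \<delta>2 \<subseteq> interior \<Theta>"
      and \<delta>2: "\<And>x h. x \<in> \<X> \<Longrightarrow> norm h < \<delta>2 \<Longrightarrow> norm (grad x (\<theta>\<^sub>0 + h) - grad x \<theta>\<^sub>0 - hess x \<theta>\<^sub>0 *v h) \<le> \<eta> * norm h"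
    proof (rule uniform_first_order_expansion[of \<X> "interior \<Theta>" \<theta>\<^sub>0 grad "(*v)" hess \<eta>, OF compX open_interior \<theta>0_int])
      show "norm (u *v h - v *v h) \<le> norm (u - v) * norm h" for u v :: "real^'p^'p" and h
        using norm_matrix_vector_mult_le[of "u - v" h] by (simp add: matrix_vector_mult_diff_rdistrib)
    qed (use hess_deriv hess_cont \<open>\<eta> > 0\<close> in auto)
    obtain \<delta>3 where "\<delta>3 > 0" and \<delta>3: "\<And>x \<theta>. x \<in> \<X> \<Longrightarrow> \<theta> \<in> \<Theta> \<Longrightarrow> dist \<theta> \<theta>\<^sub>0 < \<delta>3 \<Longrightarrow> dist (f \<theta> x) (f \<theta>\<^sub>0 x) < \<eta>"
      using uniform_limit_in_parameter[OF compX compT cont_f \<theta>0T \<open>\<eta> > 0\<close>] by blast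
    define \<delta> where "\<delta> = min \<delta>1 (min \<delta>2 \<delta>3)"
    have "\<delta> > 0" using \<open>\<delta>1 > 0\<close> \<open>\<delta>2 > 0\<close> \<open>\<delta>3 > 0\<close> by (simp add: \<delta>_def)
    have ev_h: "with_high_prob P (\<lambda>k \<omega>. norm (h k \<omega>) < \<delta>)"
    proof (rule with_high_prob_AE)
      show "{\<omega> \<in> space P. norm (h k \<omega>) < \<delta>} \<in> sets P" for k by measurable
      show "AE \<omega> in P. \<forall>\<^sub>F k in sequentially. norm (h k \<omega>) < \<delta>"
        using LS_lim
      proof eventually_elim
        case (elim \<omega>)
        from tendstoD[OF LIMSEQ_Suc[OF elim] \<open>\<delta> > 0\<close>] show ?case
          by eventually_elim (simp add: h_def dist_norm)
      qed
    qed
    have "\<rho> / 4 > 0" using \<open>\<rho> > 0\<close> by simp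
    have "with_high_prob P (\<lambda>k \<omega>. norm (h k \<omega>) < \<delta> \<and> norm (RS.hess_score k \<omega>) / real (n (Suc k)) \<le> \<rho> / 4 \<and>
        norm ((1 / real (n (Suc k))) *\<^sub>R RS.info k \<omega> - M) \<le> \<rho> / 4 \<and>
        norm ((1 / sqrt (real (n (Suc k)))) *\<^sub>R RS.score k \<omega> - RS.T k \<omega>) \<le> \<kappa>)"
      by (intro with_high_prob_conj ev_h RS.hess_score_negligible[OF \<open>\<rho> / 4 > 0\<close>] RS.info_close[OF \<open>\<rho> / 4 > 0\<close>]
        RS.score_close_T[OF \<open>\<kappa> > 0\<close>])
    then show "with_high_prob P (\<lambda>k \<omega>. norm (RS.T k \<omega>) + ?a k \<omega> / real (n (Suc k)) \<le> b \<longrightarrow>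
        norm (Z k \<omega> - Mi *v RS.T k \<omega>) \<le> \<epsilon>)"
    proof (rule with_high_prob_mono, intro always_eventually allI ballI impI, elim conjE)
      fix k \<omega> assume \<omega>: "\<omega> \<in> space P" and small: "norm (h k \<omega>) < \<delta>"
        and hs: "norm (RS.hess_score k \<omega>) / real (n (Suc k)) \<le> \<rho> / 4"
        and info: "norm ((1 / real (n (Suc k))) *\<^sub>R RS.info k \<omega> - M) \<le> \<rho> / 4"
        and score: "norm ((1 / sqrt (real (n (Suc k)))) *\<^sub>R RS.score k \<omega> - RS.T k \<omega>) \<le> \<kappa>"
        and bnd: "norm (RS.T k \<omega>) + ?a k \<omega> / real (n (Suc k)) \<le> b"
      have "?a k \<omega> \<ge> 0" by (intro sum_nonneg) auto
      then have "?a k \<omega> / real (n (Suc k)) \<ge> 0" by (rule divide_nonneg_nonneg) simp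
      with bnd have T_b: "norm (RS.T k \<omega>) \<le> b" and a_b: "?a k \<omega> / real (n (Suc k)) \<le> b"
        using norm_ge_zero[of "RS.T k \<omega>"] by linarith+
      have h_eq: "est_LS (Suc k) \<omega> = \<theta>\<^sub>0 + h k \<omega>" by (simp add: h_def)
      have in_int: "\<theta>\<^sub>0 + h k \<omega> \<in> interior \<Theta>"
        using small \<delta>2ball by (intro subsetD[OF \<delta>2ball]) (simp add: \<delta>_def dist_norm)
      have Xi: "X i \<omega> \<in> \<X>" if "i \<in> {1..n (Suc k)}" for i
        using X_in[OF _ \<omega>] that by simp
      have "(\<Sum>i\<in>{1..n (Suc k)}. (Y i \<omega> - \<mu> (X i \<omega>) (\<theta>\<^sub>0 + h k \<omega>)) *\<^sub>R grad (X i \<omega>) (\<theta>\<^sub>0 + h k \<omega>)) = 0"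
        using LS_min[of "Suc k", OF _ \<omega>] grad_deriv[OF Xi in_int]
        by (intro least_squares_normal_equation[OF _ in_int]) (auto simp: is_arg_min_linorder h_eq)
      then have normal: "(\<Sum>i\<in>{1..n (Suc k)}. (\<mu> (X i \<omega>) \<theta>\<^sub>0 + e i \<omega> - \<mu> (X i \<omega>) (\<theta>\<^sub>0 + h k \<omega>)) *\<^sub>R grad (X i \<omega>) (\<theta>\<^sub>0 + h k \<omega>)) = 0"
        using Y_eq[OF _ \<omega>] by simp
      have "norm ((\<Sum>i\<in>{1..n (Suc k)}. e i \<omega> *\<^sub>R grad (X i \<omega>) \<theta>\<^sub>0) - (\<Sum>i\<in>{1..n (Suc k)}. outer (grad (X i \<omega>) \<theta>\<^sub>0)) *v h k \<omega>)
        \<le> (norm (\<Sum>i\<in>{1..n (Suc k)}. e i \<omega> *\<^sub>R hess (X i \<omega>) \<theta>\<^sub>0) + \<eta> * (\<Sum>i\<in>{1..n (Suc k)}. \<bar>e i \<omega>\<bar>)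
          + real (card {1..n (Suc k)}) * (\<eta> * (2 * Cb + \<eta>))) * norm (h k \<omega>)"
      proof (rule score_linearization[where I = "{1..n (Suc k)}" and x = "\<lambda>i. X i \<omega>" and \<X> = \<X> and \<mu> = \<mu> and grad = grad
          and hess = hess and e = "\<lambda>i. e i \<omega>" and h = "h k \<omega>" and \<theta>\<^sub>0 = \<theta>\<^sub>0 and C = Cb, OF _ Xi normal])
        fix x assume x: "x \<in> \<X>"
        show "norm (grad x \<theta>\<^sub>0) \<le> Cb" using Cb(1)[OF x] grad0[OF x] by simp
        have "dist (f (\<theta>\<^sub>0 + h k \<omega>) x) (f \<theta>\<^sub>0 x) < \<eta>"
          using small in_int interior_subset[of \<Theta>] by (intro \<delta>3 x) (auto simp: \<delta>_def dist_norm)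
        then show "norm (grad x (\<theta>\<^sub>0 + h k \<omega>) - grad x \<theta>\<^sub>0) \<le> \<eta>"
          using f_grad[OF x in_int] grad0[OF x] by (simp add: dist_norm)
        show "\<bar>\<mu> x (\<theta>\<^sub>0 + h k \<omega>) - \<mu> x \<theta>\<^sub>0 - grad x \<theta>\<^sub>0 \<bullet> h k \<omega>\<bar> \<le> \<eta> * norm (h k \<omega>)"
          using \<delta>1[OF x, of "h k \<omega>"] small by (simp add: \<delta>_def inner_commute)
        show "norm (grad x (\<theta>\<^sub>0 + h k \<omega>) - grad x \<theta>\<^sub>0 - hess x \<theta>\<^sub>0 *v h k \<omega>) \<le> \<eta> * norm (h k \<omega>)"
          using \<delta>2[OF x, of "h k \<omega>"] small by (simp add: \<delta>_def)
      qed (use \<open>\<eta> > 0\<close> Cb(3) in auto)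
      also have "(\<Sum>i\<in>{1..n (Suc k)}. e i \<omega> *\<^sub>R grad (X i \<omega>) \<theta>\<^sub>0) = RS.score k \<omega>"
        unfolding RS.score_def blocks[symmetric] by (intro sum.cong refl) (simp add: g_def grad0 Xi)
      also have "(\<Sum>i\<in>{1..n (Suc k)}. outer (grad (X i \<omega>) \<theta>\<^sub>0)) = RS.info k \<omega>"
        unfolding RS.info_def blocks[symmetric] by (intro sum.cong refl) (simp add: g_def grad0 Xi)
      also have "(\<Sum>i\<in>{1..n (Suc k)}. e i \<omega> *\<^sub>R hess (X i \<omega>) \<theta>\<^sub>0) = RS.hess_score k \<omega>"
        unfolding RS.hess_score_def blocks[symmetric] by (simp add: H_def)
      also have "(\<Sum>i\<in>{1..n (Suc k)}. \<bar>e i \<omega>\<bar>) = ?a k \<omega>" by (rule blocks)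
      also have "real (card {1..n (Suc k)}) = real (n (Suc k))" by simp
      finally have lin: "norm (RS.score k \<omega> - RS.info k \<omega> *v h k \<omega>)
        \<le> (norm (RS.hess_score k \<omega>) + \<eta> * ?a k \<omega> + real (n (Suc k)) * (\<eta> * (2 * Cb + \<eta>))) * norm (h k \<omega>)" .
      have "real (n (Suc k)) > 0" using n_ge[of k] by simp
      from linearized_estimator_close[OF this gm(1) lin hs a_b info _ \<eta>1 \<eta>2 score T_b \<open>\<kappa> \<le> 1\<close> \<rho>1 \<rho>2 _ \<kappa>]
      show "norm (Z k \<omega> - Mi *v RS.T k \<omega>) \<le> \<epsilon>"
        using \<open>\<eta> > 0\<close> \<open>\<rho> > 0\<close> by (simp add: Z_def)
    qed
  qed

  have MiT_meas: "(\<lambda>\<omega>. Mi *v RS.T k \<omega>) \<in> borel_measurable P" for k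
    by (rule measurable_compose[OF RS.T_measurable borel_measurable_linear]) simp
  have "converges_in_distribution P Z (centred_normal (A ** transpose A))"
  proof (rule converges_in_distribution_char_tight[OF prob _ prob_space_centred_normal[OF A(1)]])
    fix u :: "real^'p"
    \<comment> \<open>at \<open>M\<^sup>-\<^sup>1 u\<close> the limit of the characteristic functions of \<open>T\<close> is the one of the normal distribution at \<open>u\<close>\<close>
    have adj: "u \<bullet> (Mi *v v) = (Mi *v u) \<bullet> v" for v
      using gm(3) by (metis dot_lmul_matrix vector_transpose_matrix)
    have "(\<lambda>k. \<integral>\<omega>. iexp ((Mi *v u) \<bullet> RS.T k \<omega>) \<partial>P)
        \<longlonglongrightarrow> complex_of_real (exp (- (\<sigma>2 * ((Mi *v u) \<bullet> (M *v (Mi *v u)))) / 2))"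
      by (rule RS.char_T)
    also have "(Mi *v u) \<bullet> (M *v (Mi *v u)) = u \<bullet> (Mi *v u)"
      by (simp add: matrix_vector_mul_assoc gm(2) inner_commute)
    also have "\<sigma>2 * (u \<bullet> (Mi *v u)) = u \<bullet> ((A ** transpose A) *v u)"
      unfolding A(2)[symmetric] by (simp add: scaleR_matrix_vector_assoc[symmetric])
    finally have lim: "(\<lambda>k. \<integral>\<omega>. iexp (u \<bullet> (Mi *v RS.T k \<omega>)) \<partial>P)
        \<longlonglongrightarrow> (\<integral>x. iexp (u \<bullet> x) \<partial>centred_normal (A ** transpose A))"
      unfolding char_centred_normal[OF A(1)] adj .
    show "(\<lambda>k. \<integral>\<omega>. iexp (u \<bullet> Z k \<omega>) \<partial>P) \<longlonglongrightarrow> (\<integral>x. iexp (u \<bullet> x) \<partial>centred_normal (A ** transpose A))"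
      by (rule char_tendsto_close[OF Z_meas MiT_meas _ lim]) (rule close)
  next
    fix \<epsilon> :: real assume "\<epsilon> > 0"
    have "bounded_in_prob P (\<lambda>k \<omega>. norm (Z k \<omega> - Mi *v RS.T k \<omega>) + norm Mi * norm (RS.T k \<omega>))"
      by (intro bounded_in_prob_add bounded_in_prob_cmult RS.T_bounded_in_prob
        bounded_in_prob_whp[OF close[OF zero_less_one]] norm_ge_zero)
    then have "bounded_in_prob P (\<lambda>k \<omega>. norm (Z k \<omega>))"
    proof (rule bounded_in_prob_mono, intro always_eventually allI ballI)
      fix k \<omega>
      show "norm (Z k \<omega>) \<le> norm (Z k \<omega> - Mi *v RS.T k \<omega>) + norm Mi * norm (RS.T k \<omega>)"
        using norm_triangle_sub[of "Z k \<omega>" "Mi *v RS.T k \<omega>"] norm_matrix_vector_mult_le[of Mi "RS.T k \<omega>"] by linarith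
    qed
    then show "\<exists>R. \<forall>\<^sub>F k in sequentially. prob {\<omega> \<in> space P. R < norm (Z k \<omega>)} < \<epsilon>"
      using \<open>\<epsilon> > 0\<close> by (rule bounded_in_prob_tight)
  qed auto
  then have "converges_in_distribution P (\<lambda>k \<omega>. sqrt (real (n (Suc k))) *\<^sub>R (est_LS (Suc k) \<omega> - \<theta>\<^sub>0)) (centred_normal (\<sigma>2 *\<^sub>R Mi))"
    by (simp add: Z_def h_def A(2))
  then show ?thesis
    unfolding Mi_def M_def by (rule converges_in_distribution_Suc[of P "\<lambda>k \<omega>. sqrt (real (n k)) *\<^sub>R (est_LS k \<omega> - \<theta>\<^sub>0)"])
qed

end
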